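(* Let $g$ be a positive integer and let $\mathcal{U}\subset\mathbb{R}^{2g}$ be the set of $2g$-tuples $a=(a_1,\dots,a_{2g})$ of real numbers with $-1<a_1<a_2<\cdots<a_{2g}<1$. For $a\in\mathcal{U}$ let $H_a$ be the hyperelliptic curve over $\mathbb{R}$ with affine equation $y^2=(x^2-1)\prod_{i=1}^{2g}(x-a_i)$, and let $\infty^+,\infty^-$ be its two points over $x=\infty$. Then the set of $a\in\mathcal{U}$ such that the class of the divisor $[\infty^+]-[\infty^-]$ is a torsion element of the Jacobian $\operatorname{Jac}(H_a)$ is dense in $\mathcal{U}$ (for the topology induced from $\mathbb{R}^{2g}$).
   Context: For $a\in\mathcal{U}$, put $f(x)=(x^2-1)\prod_{i=1}^{2g}(x-a_i)$. The plane projective curve $P_a\subset\mathbb{P}^2$ over $\mathbb{R}$ given by $y^2=f(x)$ has a single point $\infty$ at infinity, at which it is singular; $H_a$ denotes the normalization of $P_a$. It is a smooth projective curve of genus $g$ over $\mathbb{R}$ with exactly two points lying over $\infty$, both defined over $\mathbb{R}$ and distinguished by the sign of $y/x^{g+1}$ there; these are $\infty^+$ and $\infty^-$. A tuple $a$ is said to be of torsion type if the class of $[\infty^+]-[\infty^-]$ in $\operatorname{Jac}(H_a)$ is torsion (this condition may be checked after base change to $\mathbb{C}$). *)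

theory Defs
  imports
    "HOL-Analysis.Analysis"
    "HOL-Computational_Algebra.Polynomial"
    "HOL-Computational_Algebra.Fraction_Field"
    "HOL-Algebra.QuotRing"
    "HOL-Algebra.Embedded_Algebras"
    "HOL-Algebra.Free_Abelian_Groups"
begin

text \<open>
  A smooth projective curve over a field \<open>k\<close> is given by its function field \<open>K\<close>: its closed
  points are the discrete valuations of \<open>K\<close> that are trivial on \<open>k\<close>. The normalization of a
  projective plane curve is the smooth projective curve obtained in this way from the function
  field of the plane curve.

  A closed point is represented by its normalized valuation (order of vanishing at the point) on
  the nonzero elements of \<open>K\<close>. Being \<open>extensional\<close> makes the representation unique, so that
  distinct functions are distinct points.
\<close>

definition places :: "('a, 'm) ring_scheme \<Rightarrow> 'a set \<Rightarrow> ('a \<Rightarrow> int) set" where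
  "places K k = {v \<in> extensional (carrier K - {\<zero>\<^bsub>K\<^esub>}).
     v ` (carrier K - {\<zero>\<^bsub>K\<^esub>}) = UNIV \<and>
     (\<forall>h \<in> carrier K - {\<zero>\<^bsub>K\<^esub>}. \<forall>h' \<in> carrier K - {\<zero>\<^bsub>K\<^esub>}.
        v (h \<otimes>\<^bsub>K\<^esub> h') = v h + v h' \<and>
        (h \<oplus>\<^bsub>K\<^esub> h' \<noteq> \<zero>\<^bsub>K\<^esub> \<longrightarrow> min (v h) (v h') \<le> v (h \<oplus>\<^bsub>K\<^esub> h'))) \<and>
     (\<forall>c \<in> k - {\<zero>\<^bsub>K\<^esub>}. v c = 0)}"

definition valuation_ring_of :: "('a, 'm) ring_scheme \<Rightarrow> ('a \<Rightarrow> int) \<Rightarrow> 'a set" where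
  "valuation_ring_of K v = {h \<in> carrier K. h = \<zero>\<^bsub>K\<^esub> \<or> v h \<ge> 0}"

definition maximal_ideal_of :: "('a, 'm) ring_scheme \<Rightarrow> ('a \<Rightarrow> int) \<Rightarrow> 'a set" where
  "maximal_ideal_of K v = {h \<in> carrier K. h = \<zero>\<^bsub>K\<^esub> \<or> v h > 0}"

definition residue_field :: "('a, 'm) ring_scheme \<Rightarrow> ('a \<Rightarrow> int) \<Rightarrow> 'a set ring" where
  "residue_field K v = (K\<lparr>carrier := valuation_ring_of K v\<rparr>) Quot maximal_ideal_of K v"

definition place_degree :: "('a, 'm) ring_scheme \<Rightarrow> 'a set \<Rightarrow> ('a \<Rightarrow> int) \<Rightarrow> nat" where
  "place_degree K k v =
     ring.dim (residue_field K v) ((\<lambda>c. maximal_ideal_of K v +>\<^bsub>K\<^esub> c) ` k)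
       (carrier (residue_field K v))"

definition divisor_group ::
    "('a, 'm) ring_scheme \<Rightarrow> 'a set \<Rightarrow> (('a \<Rightarrow> int) \<Rightarrow>\<^sub>0 int) monoid" where
  "divisor_group K k = free_Abelian_group (places K k)"

definition divisor_degree ::
    "('a, 'm) ring_scheme \<Rightarrow> 'a set \<Rightarrow> (('a \<Rightarrow> int) \<Rightarrow>\<^sub>0 int) \<Rightarrow> int" where
  "divisor_degree K k D =
     (\<Sum>v \<in> Poly_Mapping.keys D. Poly_Mapping.lookup D v * int (place_degree K k v))"

definition principal_divisors ::
    "('a, 'm) ring_scheme \<Rightarrow> 'a set \<Rightarrow> (('a \<Rightarrow> int) \<Rightarrow>\<^sub>0 int) set" where
  "principal_divisors K k = {D \<in> carrier (divisor_group K k).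
     \<exists>h \<in> carrier K - {\<zero>\<^bsub>K\<^esub>}. \<forall>v \<in> places K k. Poly_Mapping.lookup D v = v h}"

definition divisor_class ::
    "('a, 'm) ring_scheme \<Rightarrow> 'a set \<Rightarrow> (('a \<Rightarrow> int) \<Rightarrow>\<^sub>0 int) \<Rightarrow>
      (('a \<Rightarrow> int) \<Rightarrow>\<^sub>0 int) set" where
  "divisor_class K k D = principal_divisors K k #>\<^bsub>divisor_group K k\<^esub> D"

definition picard_group ::
    "('a, 'm) ring_scheme \<Rightarrow> 'a set \<Rightarrow> (('a \<Rightarrow> int) \<Rightarrow>\<^sub>0 int) set monoid" where
  "picard_group K k = divisor_group K k Mod principal_divisors K k"

text \<open>
  The group of divisor classes of degree 0. For a curve with a \<open>k\<close>-rational point this is the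
  group of \<open>k\<close>-rational points of the Jacobian variety.
\<close>

definition jacobian ::
    "('a, 'm) ring_scheme \<Rightarrow> 'a set \<Rightarrow> (('a \<Rightarrow> int) \<Rightarrow>\<^sub>0 int) set monoid" where
  "jacobian K k = (picard_group K k)
     \<lparr>carrier := divisor_class K k `
        {D \<in> carrier (divisor_group K k). divisor_degree K k D = 0}\<rparr>"

definition torsion_element :: "('g, 'm) monoid_scheme \<Rightarrow> 'g \<Rightarrow> bool" where
  "torsion_element G c \<longleftrightarrow> c \<in> carrier G \<and> (\<exists>n::nat. n > 0 \<and> c [^]\<^bsub>G\<^esub> n = \<one>\<^bsub>G\<^esub>)"

text \<open>
  The function field \<open>\<real>(x)[y]/(y\<^sup>2 - f)\<close> of the curve \<open>y\<^sup>2 = f(x)\<close>, where \<open>f\<close> is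
  not a square in \<open>\<real>(x)\<close>. The pair \<open>(u, w)\<close> represents \<open>u + w y\<close>.
\<close>

type_synonym hyp_fun = "real poly fract \<times> real poly fract"

definition hyp_field :: "real poly \<Rightarrow> hyp_fun ring" where
  "hyp_field f = \<lparr>carrier = UNIV,
     monoid.mult = (\<lambda>(u, w) (u', w'). (u * u' + Fraction_Field.Fract f 1 * (w * w'), u * w' + w * u')),
     one = (1, 0),
     ring.zero = (0, 0),
     ring.add = (\<lambda>(u, w) (u', w'). (u + u', w + w'))\<rparr>"

definition hyp_const :: "real \<Rightarrow> hyp_fun" where
  "hyp_const c = (Fraction_Field.Fract [:c:] 1, 0)"

definition hyp_x :: hyp_fun where
  "hyp_x = (Fraction_Field.Fract [:0, 1:] 1, 0)"

definition hyp_y :: hyp_fun where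
  "hyp_y = (0, 1)"

abbreviation hyp_constants :: "hyp_fun set" where
  "hyp_constants \<equiv> range hyp_const"

text \<open>
  The point over \<open>x = \<infinity>\<close> at which the value of \<open>y / x\<^sup>g\<^sup>+\<^sup>1\<close> is a real number of sign \<open>s\<close>;
  here \<open>s\<close> is \<open>1\<close> or \<open>-1\<close>, and \<open>f\<close> is monic of degree \<open>2g + 2\<close>.
\<close>

definition infinity_place :: "real poly \<Rightarrow> nat \<Rightarrow> real \<Rightarrow> hyp_fun \<Rightarrow> int" where
  "infinity_place f g s = (let K = hyp_field f in
     THE v. v \<in> places K hyp_constants \<and> v hyp_x < 0 \<and>
       (\<exists>c. sgn c = s \<and>
          hyp_y \<otimes>\<^bsub>K\<^esub> inv\<^bsub>K\<^esub> (hyp_x [^]\<^bsub>K\<^esub> (g + 1)) \<ominus>\<^bsub>K\<^esub> hyp_const c \<in> maximal_ideal_of K v))"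

text \<open>
  Points of \<open>Euclidean_space n\<close> have coordinates with indices \<open>0, \<dots>, n - 1\<close>, so the
  \<open>a\<^sub>1, \<dots>, a\<^sub>2\<^sub>g\<close> of the usual notation are \<open>a 0, \<dots>, a (2 * g - 1)\<close>.
\<close>

definition ordered_tuples :: "nat \<Rightarrow> (nat \<Rightarrow> real) set" where
  "ordered_tuples g = {a \<in> topspace (Euclidean_space (2 * g)).
     (\<forall>i < 2 * g. - 1 < a i \<and> a i < 1) \<and> strict_mono_on {..<2 * g} a}"

definition hyp_poly :: "nat \<Rightarrow> (nat \<Rightarrow> real) \<Rightarrow> real poly" where
  "hyp_poly g a = ([:0, 1:]\<^sup>2 - 1) * (\<Prod>i<2 * g. [:0, 1:] - [:a i:])"

definition torsion_type :: "nat \<Rightarrow> (nat \<Rightarrow> real) \<Rightarrow> bool" where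
  "torsion_type g a \<longleftrightarrow> (let f = hyp_poly g a; K = hyp_field f in
     torsion_element (jacobian K hyp_constants)
       (divisor_class K hyp_constants
         (frag_of (infinity_place f g 1) - frag_of (infinity_place f g (- 1)))))"

end

theory Submission
  imports
    Defs
    "HOL-Complex_Analysis.Complex_Analysis"
    "HOL-Computational_Algebra.Polynomial_Factorial"
    "HOL-Computational_Algebra.Field_as_Ring"
begin

text \<open>
  Let \<open>e\<^sub>0 < \<dots> < e\<^sub>2\<^sub>g\<^sub>+\<^sub>1\<close> be the roots of \<open>f\<close>. On the bands \<open>[e\<^sub>2\<^sub>j, e\<^sub>2\<^sub>j\<^sub>+\<^sub>1]\<close> the
  polynomial \<open>f\<close> is negative, on the gaps between them it is positive. There is a unique monic \<open>r\<close> of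
  degree \<open>g\<close> such that \<open>r dx / \<surd>f\<close> has integral \<open>0\<close> over every gap; its integrals over the bands,
  divided by \<open>\<pi> \<i>\<close>, are up to sign the harmonic measures of the bands seen from infinity.

  If these measures all lie in \<open>(1/n) \<int>\<close> and \<open>G\<close> is a primitive of the differential on the upper half
  plane, then \<open>cosh (n G)\<close> is real on the real axis. By reflection it is entire, of polynomial growth,
  hence a polynomial \<open>A\<close>, and \<open>f A'\<^sup>2 = n\<^sup>2 r\<^sup>2 (A\<^sup>2 - 1)\<close> yields a solution of the Pell equation
  \<open>A\<^sup>2 - f B\<^sup>2 = 1\<close>. The divisor of \<open>A + B y\<close> is then a nonzero multiple of \<open>\<infinity>\<^sup>+ - \<infinity>\<^sup>-\<close>.

  For density, only the left ends \<open>e\<^sub>2, \<dots>, e\<^sub>2\<^sub>g\<close> are moved. Lowering one of them decreases the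
  measures of all other bands: for two such configurations, a count of the roots of
  \<open>r\<^sup>2 f' - r'\<^sup>2 f\<close> (divided by the common roots of \<open>f\<close> and \<open>f'\<close>) in the gaps leaves no root
  on the bands. A minimization argument then moves the left ends by an arbitrarily small amount
  so that all measures become rational.
\<close>

section \<open>Periods and the normalized differential\<close>

text \<open>Density would follow at once if the free measures were local coordinates on the space of
  ends, but proving that by differentiation needs variational formulas. Continuity, strict
  monotonicity in a single end, and compactness take their place. The outermost ends stay fixed, so
  g left ends face g + 1 measures of sum 1; the measure of the first band is what the others leave
  over. In the comparison of two configurations the root count leaves one linear factor
  undetermined. Its sign is settled at infinity: both primitives have the same logarithmic
  singularity there, so their difference cannot keep growing along the real line through infinity.
  All primitives live on the closed upper half plane, which is simply connected, so that no cycles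
  on the curve have to be handled; on its boundary every phase is a power of \<i>. The inverse
  square roots at the ends are tamed by a cosine substitution on the real line, and by a bound
  \<open>C / sqrt (Im z)\<close> above it.\<close>

definition cheb_node :: "real \<Rightarrow> real \<Rightarrow> real \<Rightarrow> real" where
  "cheb_node u v \<phi> = (u + v) / 2 + (v - u) / 2 * cos \<phi>"

text \<open>Under \<open>x = cheb_node u v \<phi>\<close> the form
  \<open>dx / sqrt ((x - u) * (v - x))\<close> becomes \<open>d\<phi>\<close> up to orientation.
  This is thus the integral of \<open>h\<close> against the arcsine weight, with both end
  singularities removed.\<close>

definition cheb_int :: "real \<Rightarrow> real \<Rightarrow> (real \<Rightarrow> real) \<Rightarrow> real" where
  "cheb_int u v h = integral {0..pi} (\<lambda>\<phi>. h (cheb_node u v \<phi>))"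

lemma cheb_node_bounds:
  assumes "u \<le> v" shows "u \<le> cheb_node u v \<phi>" "cheb_node u v \<phi> \<le> v"
proof -
  have "(v - u) / 2 * (-1) \<le> (v - u) / 2 * cos \<phi>" "(v - u) / 2 * cos \<phi> \<le> (v - u) / 2 * 1"
    using assms by (intro mult_left_mono; simp)+
  then show "u \<le> cheb_node u v \<phi>" "cheb_node u v \<phi> \<le> v"
    unfolding cheb_node_def by (simp_all add: field_simps)
qed

lemma cheb_node_interior:
  assumes "u < v" "0 < \<phi>" "\<phi> < pi" shows "u < cheb_node u v \<phi>" "cheb_node u v \<phi> < v"
proof -
  have "cos \<phi> < 1" "-1 < cos \<phi>"
    using cos_monotone_0_pi[of 0 \<phi>] cos_monotone_0_pi[of \<phi> pi] assms by auto
  then have "(v - u) / 2 * (-1) < (v - u) / 2 * cos \<phi>" "(v - u) / 2 * cos \<phi> < (v - u) / 2 * 1"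
    using assms by (intro mult_strict_left_mono; simp)+
  then show "u < cheb_node u v \<phi>" "cheb_node u v \<phi> < v"
    unfolding cheb_node_def by (simp_all add: field_simps)
qed

lemma cheb_node_ends [simp]: "cheb_node u v 0 = v" "cheb_node u v pi = u"
  by (simp_all add: cheb_node_def field_simps)

lemma continuous_on_cheb_node [continuous_intros]:
  fixes f :: "'a::topological_space \<Rightarrow> real"
  assumes "continuous_on S u" "continuous_on S v" "continuous_on S f"
  shows "continuous_on S (\<lambda>x. cheb_node (u x) (v x) (f x))"
proof -
  have "continuous_on S (\<lambda>x. cos (f x))"
    by (rule continuous_on_compose2[of UNIV cos]) (auto intro!: continuous_intros assms)
  then show ?thesis
    unfolding cheb_node_def by (intro continuous_intros assms) auto
qed

lemma continuous_on_comp_cheb_node: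
  assumes "u \<le> v" "continuous_on {u..v} h" shows "continuous_on {0..pi} (\<lambda>\<phi>. h (cheb_node u v \<phi>))"
  by (rule continuous_on_compose2[OF assms(2)])
     (auto intro!: continuous_intros simp: cheb_node_bounds[OF assms(1)])

lemma cheb_int_less:
  assumes "u < v" "continuous_on {u..v} h" "continuous_on {u..v} k"
    and "\<And>x. u < x \<Longrightarrow> x < v \<Longrightarrow> h x < k x"
  shows "cheb_int u v h < cheb_int u v k"
  unfolding cheb_int_def
  by (rule integral_less_real)
     (use assms pi_gt_zero in \<open>auto intro!: continuous_on_comp_cheb_node cheb_node_interior assms(4) simp del: pi_gt_zero\<close>)

lemma cheb_int_0 [simp]: "cheb_int u v (\<lambda>x. 0) = 0"
  by (simp add: cheb_int_def)

lemma cheb_int_cmult: "cheb_int u v (\<lambda>x. c * h x) = c * cheb_int u v h"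
  by (simp add: cheb_int_def)

lemma cheb_int_diff:
  assumes "u \<le> v" "continuous_on {u..v} h" "continuous_on {u..v} k"
  shows "cheb_int u v (\<lambda>x. h x - k x) = cheb_int u v h - cheb_int u v k"
  unfolding cheb_int_def
  by (rule integral_diff) (use assms in \<open>auto intro!: integrable_continuous_real continuous_on_comp_cheb_node\<close>)

lemma cheb_int_cong:
  assumes "u \<le> v" "\<And>x. u \<le> x \<Longrightarrow> x \<le> v \<Longrightarrow> h x = k x"
  shows "cheb_int u v h = cheb_int u v k"
  unfolding cheb_int_def by (rule integral_cong) (use assms cheb_node_bounds in auto)

lemma constant_sign_or_root:
  fixes h :: "real \<Rightarrow> real"
  assumes "continuous_on {u..v} h" and "\<And>x. u < x \<Longrightarrow> x < v \<Longrightarrow> h x \<noteq> 0"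
  shows "(\<forall>x. u < x \<longrightarrow> x < v \<longrightarrow> 0 < h x) \<or> (\<forall>x. u < x \<longrightarrow> x < v \<longrightarrow> h x < 0)"
proof (rule ccontr)
  assume "\<not> ?thesis"
  then obtain x y where xy: "u < x" "x < v" "h x < 0" "u < y" "y < v" "0 < h y"
    using assms(2) by (meson linorder_neqE_linordered_idom)
  have "connected (h ` {u<..<v})"
    by (rule connected_continuous_image) (auto intro: continuous_on_subset[OF assms(1)])
  then have "0 \<in> h ` {u<..<v}"
    by (rule connectedD_interval[of _ "h x" "h y"]) (use xy in auto)
  then show False using assms(2) by auto
qed

lemma cheb_int_root:
  assumes "u < v" "continuous_on {u..v} h" "cheb_int u v h = 0"
  obtains x where "u < x" "x < v" "h x = 0"
proof -
  have "\<exists>x. u < x \<and> x < v \<and> h x = 0"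
  proof (rule ccontr)
    assume "\<not> ?thesis"
    then have "(\<forall>x. u < x \<longrightarrow> x < v \<longrightarrow> 0 < h x) \<or> (\<forall>x. u < x \<longrightarrow> x < v \<longrightarrow> h x < 0)"
      by (intro constant_sign_or_root assms) auto
    then show False
    proof
      assume "\<forall>x. u < x \<longrightarrow> x < v \<longrightarrow> 0 < h x"
      then have "cheb_int u v (\<lambda>x. 0) < cheb_int u v h"
        using assms by (intro cheb_int_less) auto
      then show False using assms by simp
    next
      assume "\<forall>x. u < x \<longrightarrow> x < v \<longrightarrow> h x < 0"
      then have "cheb_int u v h < cheb_int u v (\<lambda>x. 0)"
        using assms by (intro cheb_int_less) auto
      then show False using assms by simp
    qed
  qed
  then show ?thesis using that by blast
qed

section \<open>Tuples of ends and the periods over bands and gaps\<close>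

definition end_tuples :: "nat \<Rightarrow> (nat \<Rightarrow> real) set" where
  "end_tuples g = {e. \<forall>i < 2 * g + 1. e i < e (Suc i)}"

lemma end_tuples_less:
  assumes "e \<in> end_tuples g" "i < j" "j < 2 * g + 2" shows "e i < e j"
  using assms(2,3)
proof (induction j)
  case (Suc j)
  then show ?case
    using assms(1) unfolding end_tuples_def
    by (cases "i = j") (auto intro: order.strict_trans[of _ "e j"])
qed simp

lemma end_tuples_le:
  assumes "e \<in> end_tuples g" "i \<le> j" "j < 2 * g + 2" shows "e i \<le> e j"
  using end_tuples_less[OF assms(1), of i j] assms by (cases "i = j") auto

text \<open>The part of |f| left after the two factors vanishing at the ends of the interval are
  absorbed by the cosine substitution; it has no zero on the closed interval.\<close>

definition rest :: "nat \<Rightarrow> (nat \<Rightarrow> real) \<Rightarrow> nat \<Rightarrow> real \<Rightarrow> real" where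
  "rest g e k x = (\<Prod>i\<in>{..<2 * g + 2} - {k, Suc k}. \<bar>x - e i\<bar>)"

lemma rest_pos:
  assumes "e \<in> end_tuples g" "k < 2 * g + 1" "e k \<le> x" "x \<le> e (Suc k)"
  shows "0 < rest g e k x"
  unfolding rest_def
proof (rule prod_pos)
  fix i assume i: "i \<in> {..<2 * g + 2} - {k, Suc k}"
  show "0 < \<bar>x - e i\<bar>"
  proof (cases "i < k")
    case True
    then show ?thesis using end_tuples_less[OF assms(1), of i k] assms by auto
  next
    case False
    then have "Suc k < i" using i by auto
    then show ?thesis using end_tuples_less[OF assms(1), of "Suc k" i] assms i by auto
  qed
qed

lemma continuous_on_rest: "continuous_on S (rest g e k)"
  unfolding rest_def[abs_def] by (intro continuous_intros)

text \<open>The integral of \<open>p / sqrt \<bar>f\<bar>\<close> over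
  \<open>[e k, e (Suc k)]\<close>, without the phase of the root. Even \<open>k\<close> are bands,
  odd \<open>k\<close> are gaps.\<close>

definition period :: "nat \<Rightarrow> (nat \<Rightarrow> real) \<Rightarrow> nat \<Rightarrow> real poly \<Rightarrow> real" where
  "period g e k p = cheb_int (e k) (e (Suc k)) (\<lambda>x. poly p x / sqrt (rest g e k x))"

lemma period_integrand_continuous:
  assumes "e \<in> end_tuples g" "k < 2 * g + 1"
  shows "continuous_on {e k..e (Suc k)} (\<lambda>x. poly p x / sqrt (rest g e k x))"
  by (intro continuous_intros continuous_on_rest)
     (use rest_pos[OF assms] in \<open>auto simp: less_le\<close>)

lemma period_diff:
  assumes "e \<in> end_tuples g" "k < 2 * g + 1"
  shows "period g e k (p - q) = period g e k p - period g e k q"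
proof -
  have "e k \<le> e (Suc k)" using assms by (auto simp: end_tuples_def less_imp_le)
  then show ?thesis
    unfolding period_def by (subst cheb_int_diff[symmetric])
      (auto intro!: period_integrand_continuous assms simp: diff_divide_distrib)
qed

lemma period_smult: "period g e k (Polynomial.smult c p) = c * period g e k p"
  unfolding period_def by (subst cheb_int_cmult[symmetric]) simp

lemma period_root:
  assumes "e \<in> end_tuples g" "k < 2 * g + 1" "period g e k p = 0"
  obtains x where "e k < x" "x < e (Suc k)" "poly p x = 0"
proof -
  have "e k < e (Suc k)" using assms by (auto simp: end_tuples_def)
  from cheb_int_root[OF this period_integrand_continuous[OF assms(1,2)] assms(3)[unfolded period_def]]
  obtain x where x: "e k < x" "x < e (Suc k)" "poly p x / sqrt (rest g e k x) = 0" .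
  then have "poly p x = 0" using rest_pos[OF assms(1,2), of x] by auto
  then show ?thesis using that x by blast
qed

text \<open>Elimination in the manner of Gram and Schmidt: step \<open>m\<close> cancels the period
  over gap \<open>m\<close> by a multiple of the monic polynomial of degree \<open>m\<close> that
  already has period 0 over the earlier gaps. An explicit recursion, unlike a chosen solution of a
  linear system, makes continuity in \<open>e\<close> provable by induction.\<close>

fun gap_poly :: "nat \<Rightarrow> (nat \<Rightarrow> real) \<Rightarrow> nat \<Rightarrow> nat \<Rightarrow> real poly" where
  "gap_poly g e 0 d = Polynomial.monom 1 d"
| "gap_poly g e (Suc m) d = gap_poly g e m d -
     Polynomial.smult (period g e (2 * m + 1) (gap_poly g e m d) / period g e (2 * m + 1) (gap_poly g e m m))
       (gap_poly g e m m)"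

text \<open>A vanishing period forces a zero inside the gap. The gaps are disjoint, so
  \<open>m\<close> of them account for every root of a polynomial of degree
  \<open>m\<close>.\<close>

lemma poly_roots_in_gaps:
  fixes p :: "real poly" and e :: "nat \<Rightarrow> real"
  assumes e: "e \<in> end_tuples g" and "m \<le> g" and roots: "\<And>j. j < m \<Longrightarrow> period g e (2 * j + 1) p = 0"
    and "degree p = m" "lead_coeff p = 1"
  obtains c where "\<And>j. j < m \<Longrightarrow> e (2 * j + 1) < c j \<and> c j < e (2 * j + 2)"
    "p = (\<Prod>j<m. [:- c j, 1:])"
proof -
  have "\<forall>j\<in>{..<m}. \<exists>x. e (2 * j + 1) < x \<and> x < e (2 * j + 2) \<and> poly p x = 0"
  proof
    fix j assume "j \<in> {..<m}"
    then obtain x where "e (2 * j + 1) < x" "x < e (Suc (2 * j + 1))" "poly p x = 0"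
      using roots[of j] period_root[OF e, of "2 * j + 1" p] \<open>m \<le> g\<close> by auto
    then show "\<exists>x. e (2 * j + 1) < x \<and> x < e (2 * j + 2) \<and> poly p x = 0"
      by (intro exI[of _ x]) simp
  qed
  then obtain c where c: "\<And>j. j < m \<Longrightarrow> e (2 * j + 1) < c j \<and> c j < e (2 * j + 2) \<and> poly p (c j) = 0"
    unfolding bchoice_iff by auto
  have inj: "inj_on c {..<m}"
  proof (rule linorder_inj_onI')
    fix i j assume ij: "i \<in> {..<m}" "j \<in> {..<m}" "i < j"
    have "c i < e (2 * i + 2)" "e (2 * j + 1) < c j" using c ij by auto
    moreover have "e (2 * i + 2) \<le> e (2 * j + 1)"
      by (rule end_tuples_le[OF e]) (use ij \<open>m \<le> g\<close> in auto)
    ultimately show "c i \<noteq> c j" by linarith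
  qed
  have "p = (\<Prod>j<m. [:- c j, 1:])"
  proof (rule poly_eqI_degree_lead_coeff)
    show "card (c ` {..<m}) \<ge> m" using inj by (simp add: card_image)
    show "degree p \<le> m" "degree (\<Prod>j<m. [:- c j, 1:]) \<le> m"
      using assms by (simp_all add: degree_prod_eq_sum_degree)
    show "poly.coeff p m = poly.coeff (\<Prod>j<m. [:- c j, 1:]) m"
      using assms lead_coeff_prod[of "\<lambda>j. [:- c j, 1:]" "{..<m}"] by (simp add: degree_prod_eq_sum_degree)
  qed (auto simp: poly_prod c)
  then show ?thesis using c that by blast
qed

text \<open>Otherwise a polynomial of degree \<open>m\<close> would have roots in
  \<open>m + 1\<close> disjoint gaps. These periods are the denominators in
  \<open>gap_poly\<close>.\<close>

lemma period_nonzero: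
  fixes p :: "real poly"
  assumes e: "e \<in> end_tuples g" and "m < g" and "\<And>j. j < m \<Longrightarrow> period g e (2 * j + 1) p = 0"
    and "degree p = m" "lead_coeff p = 1"
  shows "period g e (2 * m + 1) p \<noteq> 0"
proof
  assume "period g e (2 * m + 1) p = 0"
  then obtain x where x: "e (2 * m + 1) < x" "poly p x = 0"
    using period_root[OF e, of "2 * m + 1" p] \<open>m < g\<close> by auto
  obtain c where c: "\<And>j. j < m \<Longrightarrow> e (2 * j + 1) < c j \<and> c j < e (2 * j + 2)"
    "p = (\<Prod>j<m. [:- c j, 1:])"
    using poly_roots_in_gaps[OF e, of m p] assms by auto
  have "x = c j \<Longrightarrow> j < m \<Longrightarrow> False" for j
    using c(1)[of j] x end_tuples_le[OF e, of "2 * j + 2" "2 * m + 1"] \<open>m < g\<close> by force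
  then show False using x c(2) by (auto simp: poly_prod)
qed

lemma gap_poly_props:
  assumes e: "e \<in> end_tuples g" and "m \<le> g" "m \<le> d"
  shows "degree (gap_poly g e m d) = d \<and> lead_coeff (gap_poly g e m d) = 1 \<and>
    (\<forall>j<m. period g e (2 * j + 1) (gap_poly g e m d) = 0)"
  using assms(2,3)
proof (induction m arbitrary: d)
  case 0
  then show ?case by (simp add: degree_monom_eq)
next
  case (Suc m)
  define p q where "p = gap_poly g e m d" and "q = gap_poly g e m m"
  define c where "c = period g e (2 * m + 1) p / period g e (2 * m + 1) q"
  have p: "degree p = d" "lead_coeff p = 1" "\<And>j. j < m \<Longrightarrow> period g e (2 * j + 1) p = 0"
    and q: "degree q = m" "lead_coeff q = 1" "\<And>j. j < m \<Longrightarrow> period g e (2 * j + 1) q = 0"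
    using Suc.IH[of d] Suc.IH[of m] Suc.prems by (auto simp: p_def q_def)
  have nz: "period g e (2 * m + 1) q \<noteq> 0"
    using period_nonzero[OF e _ q(3) q(1,2)] Suc.prems by auto
  have eq: "gap_poly g e (Suc m) d = p - Polynomial.smult c q"
    by (simp add: p_def q_def c_def)
  have lt: "degree (Polynomial.smult c q) < degree p"
    using p q Suc.prems degree_smult_le[of c q] by linarith
  have "degree (p - Polynomial.smult c q) = d"
    using lt p degree_add_eq_left[of "- Polynomial.smult c q" p] by simp
  moreover have "poly.coeff (p - Polynomial.smult c q) d = 1"
    using lt p coeff_eq_0[of "Polynomial.smult c q" d] by (simp del: degree_smult_eq)
  moreover have "period g e (2 * j + 1) (p - Polynomial.smult c q) = 0" if "j < Suc m" for j
  proof -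
    have "period g e (2 * j + 1) (p - Polynomial.smult c q) =
        period g e (2 * j + 1) p - c * period g e (2 * j + 1) q"
      using that Suc.prems by (subst period_diff[OF e]) (auto simp: period_smult)
    then show ?thesis
      using nz p q that by (cases "j = m") (auto simp: c_def)
  qed
  ultimately show ?case unfolding eq by (simp del: gap_poly.simps)
qed

lemma continuous_on_fst_coordinate [continuous_intros]:
  "continuous_on S (\<lambda>z :: (nat \<Rightarrow> real) \<times> real. fst z i)"
  by (rule continuous_on_product_then_coordinatewise[OF continuous_on_fst[OF continuous_on_id]])

text \<open>The substitution onto the fixed interval \<open>[0, pi]\<close> moves the dependence on
  \<open>e\<close> from the domain of integration into an integrand that is jointly continuous in
  \<open>e\<close> and \<open>\<phi>\<close>.\<close>

lemma continuous_on_period: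
  assumes k: "k < 2 * g + 1"
    and p: "continuous_on (end_tuples g \<times> UNIV) (\<lambda>(e, x). poly (p e) x)"
  shows "continuous_on (end_tuples g) (\<lambda>e. period g e k (p e))"
proof -
  have "continuous_on (end_tuples g \<times> cbox 0 pi)
     (\<lambda>(e, \<phi>). poly (p e) (cheb_node (e k) (e (Suc k)) \<phi>) /
        sqrt (rest g e k (cheb_node (e k) (e (Suc k)) \<phi>)))"
  proof -
    have node: "continuous_on (end_tuples g \<times> cbox 0 pi)
        (\<lambda>z. cheb_node (fst z k) (fst z (Suc k)) (snd z))"
      by (intro continuous_on_cheb_node continuous_on_fst_coordinate continuous_on_snd continuous_on_id)
    have "continuous_on (end_tuples g \<times> cbox 0 pi)
        (\<lambda>z. (\<lambda>(e, x). poly (p e) x) (fst z, cheb_node (fst z k) (fst z (Suc k)) (snd z)))"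
      by (rule continuous_on_compose2[OF p], intro continuous_on_Pair continuous_on_fst continuous_on_id node) auto
    moreover have "continuous_on (end_tuples g \<times> cbox 0 pi)
        (\<lambda>z. sqrt (rest g (fst z) k (cheb_node (fst z k) (fst z (Suc k)) (snd z))))"
      unfolding rest_def by (intro continuous_on_real_sqrt continuous_on_prod continuous_on_rabs
        continuous_on_diff continuous_on_fst_coordinate node)
    moreover have "sqrt (rest g (fst z) k (cheb_node (fst z k) (fst z (Suc k)) (snd z))) \<noteq> 0"
      if "z \<in> end_tuples g \<times> cbox 0 pi" for z
    proof -
      have "fst z k \<le> fst z (Suc k)" using that k by (auto simp: end_tuples_def less_imp_le)
      then show ?thesis
        using rest_pos[of "fst z" g k] that k by (auto simp: cheb_node_bounds less_le)
    qed
    ultimately show ?thesis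
      unfolding case_prod_unfold by (intro continuous_on_divide) auto
  qed
  from integral_continuous_on_param[OF this] show ?thesis
    by (simp add: period_def cheb_int_def)
qed

lemma continuous_on_gap_poly:
  "m \<le> g \<Longrightarrow> m \<le> d \<Longrightarrow>
    continuous_on (end_tuples g \<times> UNIV) (\<lambda>(e, x). poly (gap_poly g e m d) x)"
proof (induction m arbitrary: d)
  case 0
  then show ?case by (simp add: case_prod_unfold poly_monom) (intro continuous_intros)
next
  case (Suc m)
  have P: "continuous_on (end_tuples g \<times> UNIV) (\<lambda>(e, x). poly (gap_poly g e m d) x)"
    "continuous_on (end_tuples g \<times> UNIV) (\<lambda>(e, x). poly (gap_poly g e m m) x)"
    using Suc by auto
  have J: "continuous_on (end_tuples g) (\<lambda>e. period g e (2 * m + 1) (gap_poly g e m d))"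
    "continuous_on (end_tuples g) (\<lambda>e. period g e (2 * m + 1) (gap_poly g e m m))"
    using Suc.prems by (auto intro!: continuous_on_period P[unfolded One_nat_def])
  have "period g e (2 * m + 1) (gap_poly g e m m) \<noteq> 0" if "e \<in> end_tuples g" for e
    using period_nonzero[OF that, of m "gap_poly g e m m"] gap_poly_props[OF that, of m m] Suc.prems
    by auto
  then have "continuous_on (end_tuples g) (\<lambda>e. period g e (2 * m + 1) (gap_poly g e m d) /
      period g e (2 * m + 1) (gap_poly g e m m))"
    by (intro continuous_on_divide J) auto
  then have "continuous_on (end_tuples g \<times> UNIV)
      (\<lambda>z. period g (fst z) (2 * m + 1) (gap_poly g (fst z) m d) /
      period g (fst z) (2 * m + 1) (gap_poly g (fst z) m m))"
    by (rule continuous_on_compose2) (auto intro: continuous_on_fst continuous_on_id)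
  then show ?case
    using P unfolding case_prod_unfold
    unfolding gap_poly.simps poly_diff poly_smult by (intro continuous_on_diff continuous_on_mult)
qed

section \<open>Primitives on the upper half plane\<close>

text \<open>The branch of the square root whose cut is the negative imaginary axis, hence continuous
  on the whole closed upper half plane.\<close>

definition up_sqrt :: "complex \<Rightarrow> complex" where
  "up_sqrt w = cis (pi / 4) * csqrt (- \<i> * w)"

lemma up_sqrt_square [simp]: "(up_sqrt w)\<^sup>2 = w"
  by (simp add: up_sqrt_def power_mult_distrib cis_mult power2_eq_square[of "cis _"])

lemma up_sqrt_eq_0_iff [simp]: "up_sqrt w = 0 \<longleftrightarrow> w = 0"
  by (metis up_sqrt_square zero_power2 power_eq_0_iff)

lemma up_sqrt_of_real:
  "0 \<le> x \<Longrightarrow> up_sqrt (of_real x) = of_real (sqrt x)"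
  "x \<le> 0 \<Longrightarrow> up_sqrt (of_real x) = \<i> * of_real (sqrt (- x))"
proof -
  assume x: "0 \<le> x"
  have "csqrt (- \<i> * of_real x) = cis (- pi / 4) * of_real (sqrt x)"
  proof (rule csqrt_unique)
    have "(cis (- pi / 4) * of_real (sqrt x))\<^sup>2 = cis (- pi / 4) * cis (- pi / 4) * of_real ((sqrt x)\<^sup>2)"
      by (simp only: power2_eq_square of_real_mult mult_ac)
    also have "\<dots> = - \<i> * of_real x"
      using x by (simp add: cis_mult)
    finally show "(cis (- pi / 4) * of_real (sqrt x))\<^sup>2 = - \<i> * of_real x" .
    show "0 < Re (cis (- pi / 4) * of_real (sqrt x)) \<or>
      Re (cis (- pi / 4) * of_real (sqrt x)) = 0 \<and> 0 \<le> Im (cis (- pi / 4) * of_real (sqrt x))"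
      using x by (cases "x = 0") (auto simp: cos_45)
  qed
  then show "up_sqrt (of_real x) = of_real (sqrt x)"
    by (simp add: up_sqrt_def mult.assoc[symmetric] cis_mult)
next
  assume x: "x \<le> 0"
  have "csqrt (- \<i> * of_real x) = cis (pi / 4) * of_real (sqrt (- x))"
  proof (rule csqrt_unique)
    have "(cis (pi / 4) * of_real (sqrt (- x)))\<^sup>2 = cis (pi / 4) * cis (pi / 4) * of_real ((sqrt (- x))\<^sup>2)"
      by (simp only: power2_eq_square of_real_mult mult_ac)
    also have "\<dots> = - \<i> * of_real x"
      using x by (simp add: cis_mult) 
    finally show "(cis (pi / 4) * of_real (sqrt (- x)))\<^sup>2 = - \<i> * of_real x" .
    show "0 < Re (cis (pi / 4) * of_real (sqrt (- x))) \<or>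
      Re (cis (pi / 4) * of_real (sqrt (- x))) = 0 \<and> 0 \<le> Im (cis (pi / 4) * of_real (sqrt (- x)))"
      using x by (cases "x = 0") (auto simp: cos_45)
  qed
  then show "up_sqrt (of_real x) = \<i> * of_real (sqrt (- x))"
    by (simp add: up_sqrt_def mult.assoc[symmetric] cis_mult)
qed

lemma holomorphic_on_up_sqrt:
  assumes "f holomorphic_on S" "\<And>z. z \<in> S \<Longrightarrow> Re (f z) = 0 \<Longrightarrow> 0 < Im (f z)"
  shows "(\<lambda>z. up_sqrt (f z)) holomorphic_on S"
  unfolding up_sqrt_def
  by (intro holomorphic_intros assms) (use assms(2) in \<open>force simp: complex_nonpos_Reals_iff\<close>)

text \<open>A product of roots rather than a root of the product: each factor stays away from its
  cut when \<open>z\<close> is in the upper half plane, whereas the product of the factors may wind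
  around 0.\<close>

definition end_root :: "real set \<Rightarrow> complex \<Rightarrow> complex" where
  "end_root E z = (\<Prod>e\<in>E. up_sqrt (z - of_real e))"

lemma end_root_square: "(end_root E z)\<^sup>2 = (\<Prod>e\<in>E. z - of_real e)"
  by (simp add: end_root_def prod_power_distrib)

lemma holomorphic_on_poly [holomorphic_intros]: "poly p holomorphic_on S"
  unfolding holomorphic_on_def field_differentiable_def
  by (meson poly_DERIV has_field_derivative_at_within)

lemma end_root_nonzero: "finite E \<Longrightarrow> z \<notin> of_real ` E \<Longrightarrow> end_root E z \<noteq> 0"
  by (auto simp: end_root_def)

lemma holomorphic_on_end_root_quotient:
  assumes "finite E" and S: "\<And>z e. z \<in> S \<Longrightarrow> e \<in> E \<Longrightarrow> Re z = e \<Longrightarrow> 0 < Im z"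
  shows "(\<lambda>z. poly p z / end_root E z) holomorphic_on S"
proof -
  have "end_root E z \<noteq> 0" if "z \<in> S" for z
    using S[OF that] by (intro end_root_nonzero assms) force
  then show ?thesis
    unfolding end_root_def
    by (intro holomorphic_intros holomorphic_on_up_sqrt) (use S in force)+
qed

lemma lagrange_interpolation:
  fixes q :: "'a::field poly"
  assumes "finite E" "degree q < card E"
  shows "poly q z = (\<Sum>e\<in>E. poly q e * (\<Prod>e'\<in>E - {e}. (z - e') / (e - e')))"
proof -
  define l where "l e = (\<Prod>e'\<in>E - {e}. Polynomial.smult (1 / (e - e')) [:- e', 1:])" for e
  have l: "poly (l e) z = (\<Prod>e'\<in>E - {e}. (z - e') / (e - e'))" for e z
    by (simp add: l_def poly_prod diff_divide_distrib)
  have "q = (\<Sum>e\<in>E. Polynomial.smult (poly q e) (l e))"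
  proof (rule poly_eqI_degree)
    show "degree q < card E" by fact
    have "degree (l e) \<le> card (E - {e})" for e
    proof -
      have "degree (l e) \<le> (\<Sum>e'\<in>E - {e}. degree (Polynomial.smult (1 / (e - e')) [:- e', 1:]))"
        unfolding l_def using degree_prod_sum_le[of "E - {e}" "\<lambda>e'. Polynomial.smult (1 / (e - e')) [:- e', 1:]"]
          assms(1) by (simp only: o_def finite_Diff)
      also have "\<dots> \<le> (\<Sum>e'\<in>E - {e}. 1)"
        by (intro sum_mono order.trans[OF degree_smult_le]) simp
      finally show ?thesis by simp
    qed
    then have "degree (Polynomial.smult (poly q e) (l e)) \<le> card E - 1" if "e \<in> E" for e
      using that assms by (intro order.trans[OF degree_smult_le]) (metis card_Diff_singleton)
    then have "degree (\<Sum>e\<in>E. Polynomial.smult (poly q e) (l e)) \<le> card E - 1"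
      using assms by (intro degree_sum_le) auto
    then show "degree (\<Sum>e\<in>E. Polynomial.smult (poly q e) (l e)) < card E"
      using assms by linarith
    fix x assume x: "x \<in> E"
    have "poly (l e) x = (if e = x then 1 else 0)" if "e \<in> E" for e
      unfolding l using x that assms(1) by (auto intro!: prod.neutral)
    then have "(\<Sum>e\<in>E. poly q e * poly (l e) x) = (\<Sum>e\<in>E. if e = x then poly q x else 0)"
      by (intro sum.cong) auto
    then show "poly q x = poly (\<Sum>e\<in>E. Polynomial.smult (poly q e) (l e)) x"
      using x assms(1) by (simp add: poly_sum)
  qed
  then have "poly q z = poly (\<Sum>e\<in>E. Polynomial.smult (poly q e) (l e)) z" by simp
  then show ?thesis by (simp add: poly_sum l)
qed

text \<open>The bound comes from the partial fraction expansion of the square of the quotient.\<close>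

lemma end_root_quotient_bound:
  assumes E: "finite E" and deg: "2 * degree p < card E"
  obtains C where "0 \<le> C" "\<And>z. 0 < Im z \<Longrightarrow> norm (poly p z / end_root E z) \<le> C / sqrt (Im z)"
proof -
  define E' where "E' = (of_real ` E :: complex set)"
  define A where "A e = norm (poly (p ^ 2) e / (\<Prod>e'\<in>E' - {e}. (e - e')))" for e
  have fin: "finite E'" and card: "card E' = card E"
    using E by (auto simp: E'_def card_image inj_on_def)
  have "norm (poly p z / end_root E z) \<le> sqrt (\<Sum>e\<in>E'. A e) / sqrt (Im z)" if z: "0 < Im z" for z
  proof -
    have zE: "z - e \<noteq> 0" "Im z \<le> norm (z - e)" if "e \<in> E'" for e
      using that z abs_Im_le_cmod[of "z - e"] by (auto simp: E'_def)
    have "poly (p ^ 2) z = (\<Sum>e\<in>E'. poly (p ^ 2) e * (\<Prod>e'\<in>E' - {e}. (z - e') / (e - e')))"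
      using deg card order.strict_trans1[OF degree_power_le[of p 2]] by (intro lagrange_interpolation fin) simp
    also have "\<dots> / (\<Prod>e\<in>E'. z - e) =
        (\<Sum>e\<in>E'. poly (p ^ 2) e / (\<Prod>e'\<in>E' - {e}. (e - e')) / (z - e))"
      unfolding sum_divide_distrib
    proof (intro sum.cong refl)
      fix e assume e: "e \<in> E'"
      have "(\<Prod>e\<in>E'. z - e) = (z - e) * (\<Prod>e'\<in>E' - {e}. z - e')"
        using e fin by (rule prod.remove[rotated])
      moreover have "(\<Prod>e'\<in>E' - {e}. z - e') \<noteq> 0"
        using fin zE by auto
      ultimately show "poly (p ^ 2) e * (\<Prod>e'\<in>E' - {e}. (z - e') / (e - e')) / (\<Prod>e\<in>E'. z - e) =
        poly (p ^ 2) e / (\<Prod>e'\<in>E' - {e}. (e - e')) / (z - e)"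
        using zE(1)[OF e] by (simp only: prod_dividef) (simp add: divide_simps)
    qed
    finally have "norm (poly (p ^ 2) z / (\<Prod>e\<in>E'. z - e)) \<le> (\<Sum>e\<in>E'. A e / norm (z - e))"
      by (auto simp: A_def norm_divide norm_mult intro!: order.trans[OF norm_sum] sum_mono)
    also have "\<dots> \<le> (\<Sum>e\<in>E'. A e / Im z)"
      using z zE by (intro sum_mono divide_left_mono) (auto simp: A_def)
    also have "(poly (p ^ 2) z / (\<Prod>e\<in>E'. z - e)) = (poly p z / end_root E z)\<^sup>2"
      by (simp add: power_divide end_root_square E'_def prod.reindex inj_on_def)
    finally have "(norm (poly p z / end_root E z))\<^sup>2 \<le> (\<Sum>e\<in>E'. A e) / Im z"
      by (simp add: norm_power sum_divide_distrib)
    from real_le_rsqrt[OF this] show ?thesis by (simp add: real_sqrt_divide)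
  qed
  moreover have "0 \<le> sqrt (\<Sum>e\<in>E'. A e)" by (auto simp: A_def intro!: sum_nonneg)
  ultimately show ?thesis using that by blast
qed

text \<open>The bound \<open>C / sqrt t\<close> is integrable at 0 with primitive
  \<open>2 * C * sqrt t\<close>, so a vertical segment costs little even when it starts close to the
  real axis.\<close>

lemma primitive_vertical_bound:
  assumes G: "\<And>z. 0 < Im z \<Longrightarrow> (G has_field_derivative W z) (at z)"
    and W: "\<And>z. 0 < Im z \<Longrightarrow> norm (W z) \<le> C / sqrt (Im z)" and "0 \<le> C" "0 < Im z" "0 < h"
  shows "norm (G (z + \<i> * of_real h) - G z) \<le> 2 * C * sqrt h"
proof -
  have "norm (G (z + \<i> * of_real h) - G (z + \<i> * of_real 0)) \<le> 2 * C * sqrt h - 2 * C * sqrt 0"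
  proof (rule differentiable_bound_general[OF \<open>0 < h\<close>])
    show "((\<lambda>t. G (z + \<i> * of_real t)) has_vector_derivative \<i> * W (z + \<i> * of_real t)) (at t)"
      if "0 < t" for t
    proof -
      have "((\<lambda>t. z + \<i> * of_real t) has_vector_derivative \<i>) (at t)"
      proof -
        have "((\<lambda>t. z + \<i> * of_real t) has_vector_derivative 0 + \<i> * of_real 1) (at t)"
          by (intro has_vector_derivative_add has_vector_derivative_const
              has_vector_derivative_mult_right has_vector_derivative_of_real DERIV_ident)
        then show ?thesis by simp
      qed
      from field_vector_diff_chain_at[OF this G] show ?thesis
        using that assms by (simp add: o_def)
    qed
    show "((\<lambda>t. 2 * C * sqrt t) has_vector_derivative C / sqrt t) (at t)" if "0 < t" for t
      using that unfolding has_real_derivative_iff_has_vector_derivative[symmetric]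
      by (auto intro!: derivative_eq_intros simp: field_simps)
    show "continuous_on {0..h} (\<lambda>t. G (z + \<i> * of_real t))"
    proof (rule continuous_on_compose2[of "{z. 0 < Im z}" G])
      show "continuous_on {z. 0 < Im z} G"
        using G by (auto intro!: continuous_at_imp_continuous_on dest: DERIV_isCont)
    qed (use assms in \<open>auto intro!: continuous_intros\<close>)
    show "norm (\<i> * W (z + \<i> * of_real t)) \<le> C / sqrt t" if "0 < t" for t
    proof -
      have "norm (\<i> * W (z + \<i> * of_real t)) \<le> C / sqrt (Im z + t)"
        using W[of "z + \<i> * of_real t"] that assms by (simp add: norm_mult)
      also have "\<dots> \<le> C / sqrt t"
        using assms that by (intro divide_left_mono) auto
      finally show ?thesis .
    qed
  qed (auto intro!: continuous_intros)
  then show ?thesis by simp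
qed

text \<open>The path goes up by \<open>h = norm (z - w)\<close>, across, and down again. The
  vertical parts cost \<open>2 * C * sqrt h\<close> each; at height at least \<open>h\<close> the
  derivative is at most \<open>C / sqrt h\<close>, so the crossing costs \<open>C * sqrt h\<close>.
  This gives 2 + 1 + 2 = 5.\<close>

lemma primitive_holder:
  assumes G: "\<And>z. 0 < Im z \<Longrightarrow> (G has_field_derivative W z) (at z)"
    and W: "\<And>z. 0 < Im z \<Longrightarrow> norm (W z) \<le> C / sqrt (Im z)" and C: "0 \<le> C"
    and z: "0 < Im z" and w: "0 < Im w"
  shows "norm (G z - G w) \<le> 5 * C * sqrt (norm (z - w))"
proof (cases "z = w")
  case False
  define h where "h = norm (z - w)"
  have h: "0 < h" using False by (simp add: h_def)
  have "norm (G (z + \<i> * of_real h) - G (w + \<i> * of_real h)) \<le>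
      C / sqrt h * norm ((z + \<i> * of_real h) - (w + \<i> * of_real h))"
  proof (rule field_differentiable_bound[of "{x. h \<le> Im x}"])
    show "convex {x. h \<le> Im x}" by (rule convex_halfspace_Im_ge)
    fix x assume x: "x \<in> {x. h \<le> Im x}"
    then show "(G has_field_derivative W x) (at x within {x. h \<le> Im x})"
      using h by (intro has_field_derivative_at_within[OF G]) auto
    have "norm (W x) \<le> C / sqrt (Im x)" using x h by (intro W) auto
    also have "\<dots> \<le> C / sqrt h" using x h C by (intro divide_left_mono) auto
    finally show "norm (W x) \<le> C / sqrt h" .
  qed (use z w h in auto)
  also have "\<dots> = C * sqrt h"
    using h real_div_sqrt[of h] by (simp add: h_def[symmetric]) (metis times_divide_eq_right)
  finally have "norm (G (z + \<i> * of_real h) - G (w + \<i> * of_real h)) \<le> C * sqrt h" .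
  moreover have "norm (G (z + \<i> * of_real h) - G z) \<le> 2 * C * sqrt h"
    "norm (G (w + \<i> * of_real h) - G w) \<le> 2 * C * sqrt h"
    using primitive_vertical_bound[of G W C z h] primitive_vertical_bound[of G W C w h] G W C z w h by blast+
  moreover have "norm (G z - G w) \<le> norm (G (z + \<i> * of_real h) - G (w + \<i> * of_real h)) +
     norm (G (z + \<i> * of_real h) - G z) + norm (G (w + \<i> * of_real h) - G w)"
  proof -
    have eq: "G z - G w = ((G (z + \<i> * of_real h) - G (w + \<i> * of_real h)) -
      (G (z + \<i> * of_real h) - G z)) + (G (w + \<i> * of_real h) - G w)" by simp
    show ?thesis
      unfolding eq by (intro order.trans[OF norm_triangle_ineq] add_mono norm_triangle_ineq4 order.refl)
  qed
  ultimately show ?thesis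
    unfolding h_def[symmetric] by linarith
qed auto

lemma closure_upper_halfplane: "closure {z. 0 < Im z} = {z. 0 \<le> Im z}"
proof -
  have "closure {z. \<i> \<bullet> z > 0} = {z. \<i> \<bullet> z \<ge> 0}" by (rule closure_halfspace_gt) simp
  then show ?thesis by (simp add: inner_complex_def)
qed

text \<open>The Hoelder estimate makes a primitive uniformly continuous on the open half plane, so
  it extends continuously to the closure, including the ends where \<open>W\<close> is
  singular.\<close>

lemma primitive_extends_to_boundary:
  assumes hol: "W holomorphic_on {z. 0 < Im z}" and C: "0 \<le> C"
    and W: "\<And>z. 0 < Im z \<Longrightarrow> norm (W z) \<le> C / sqrt (Im z)"
  obtains G where "continuous_on {z. 0 \<le> Im z} G"
    "\<And>z. 0 < Im z \<Longrightarrow> (G has_field_derivative W z) (at z)"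
proof -
  have op: "open {z. 0 < Im z}" by (rule open_halfspace_Im_gt)
  obtain G0 where G0: "\<And>z. z \<in> {z. 0 < Im z} \<Longrightarrow> (G0 has_field_derivative W z) (at z within {z. 0 < Im z})"
    using holomorphic_convex_primitive'[OF convex_halfspace_Im_gt op hol] by blast
  then have G0: "(G0 has_field_derivative W z) (at z)" if "0 < Im z" for z
    using that op by (metis at_within_open mem_Collect_eq)
  have "uniformly_continuous_on {z. 0 < Im z} G0"
    unfolding uniformly_continuous_on_def
  proof (intro allI impI)
    fix \<epsilon> :: real assume \<epsilon>: "0 < \<epsilon>"
    \<comment> \<open>Inverts the modulus \<open>5 * C * sqrt d\<close>; the summand 1 makes the
      inequality strict and covers \<open>C = 0\<close>.\<close>
    define d where "d = (\<epsilon> / (5 * C + 1))\<^sup>2"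
    have d: "0 < d" "sqrt d = \<epsilon> / (5 * C + 1)" using \<epsilon> C by (auto simp: d_def)
    have "dist (G0 w) (G0 z) < \<epsilon>" if "0 < Im z" "0 < Im w" "dist w z < d" for z w
    proof -
      have "dist (G0 w) (G0 z) \<le> 5 * C * sqrt (norm (w - z))"
        unfolding dist_norm using that by (intro primitive_holder[OF G0 W C])
      also have "\<dots> \<le> 5 * C * sqrt d"
        using that C by (intro mult_left_mono real_sqrt_le_mono) (auto simp: dist_norm)
      also have "\<dots> = \<epsilon> * (5 * C / (5 * C + 1))" using d by simp
      also have "\<dots> < \<epsilon> * 1" using \<epsilon> C by (intro mult_strict_left_mono) auto
      finally show ?thesis by simp
    qed
    then show "\<exists>d>0. \<forall>x\<in>{z. 0 < Im z}. \<forall>x'\<in>{z. 0 < Im z}. dist x' x < d \<longrightarrow> dist (G0 x') (G0 x) < \<epsilon>"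
      using d by auto
  qed
  then obtain G where G: "uniformly_continuous_on (closure {z. 0 < Im z}) G"
      "\<And>z. z \<in> {z. 0 < Im z} \<Longrightarrow> G0 z = G z"
    using uniformly_continuous_on_extension_on_closure[of "{z. 0 < Im z}" G0 thesis] by metis
  have "(G has_field_derivative W z) (at z)" if "0 < Im z" for z
    using has_field_derivative_transform_within_open[OF G0[OF that] op] G(2) that by auto
  then show ?thesis
    using that G(1) uniformly_continuous_imp_continuous by (auto simp: closure_upper_halfplane)
qed

text \<open>Near \<open>x\<close> the function \<open>W\<close> is holomorphic across the axis and
  has a primitive \<open>F\<close> on a full disc. \<open>G - F\<close> is constant on the upper
  half disc and, by continuity of \<open>G\<close>, on the real diameter, so \<open>G\<close>
  inherits the derivative of \<open>F\<close> along the axis.\<close>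

lemma primitive_boundary_derivative:
  assumes cont: "continuous_on {z. 0 \<le> Im z} G"
    and G: "\<And>z. 0 < Im z \<Longrightarrow> (G has_field_derivative W z) (at z)"
    and hol: "W holomorphic_on ball (of_real x) \<rho>" and "0 < \<rho>"
  shows "((\<lambda>t. G (of_real t)) has_vector_derivative W (of_real x)) (at x)"
proof -
  let ?B = "ball (of_real x) \<rho> :: complex set"
  obtain F where F: "\<And>z. z \<in> ?B \<Longrightarrow> (F has_field_derivative W z) (at z within ?B)"
    using holomorphic_convex_primitive'[OF convex_ball open_ball hol] by auto
  then have F: "(F has_field_derivative W z) (at z)" if "z \<in> ?B" for z
    using F[OF that] at_within_open[OF that open_ball] by simp
  have "\<exists>c. \<forall>z\<in>?B \<inter> {z. 0 < Im z}. G z - F z = c"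
  proof (rule has_field_derivative_zero_constant)
    show "((\<lambda>z. G z - F z) has_field_derivative 0) (at z within ?B \<inter> {z. 0 < Im z})"
      if "z \<in> ?B \<inter> {z. 0 < Im z}" for z
      using has_field_derivative_at_within[OF DERIV_diff[OF G F, of z]] that by simp
  qed (intro convex_Int convex_ball convex_halfspace_Im_gt)
  then obtain c where c: "\<And>z. z \<in> ?B \<Longrightarrow> 0 < Im z \<Longrightarrow> G z - F z = c" by auto
  have "G (of_real t) = F (of_real t) + c" if t: "\<bar>t - x\<bar> < \<rho>" for t
  proof -
    have tB: "of_real t \<in> ?B" using t by (simp add: dist_real_def abs_minus_commute flip: of_real_diff)
    have seq: "(\<lambda>n. of_real t + \<i> * of_real (inverse (real (Suc n)))) \<longlonglongrightarrow> of_real t + \<i> * of_real 0"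
      by (intro tendsto_intros LIMSEQ_inverse_real_of_nat)
    then have seq: "(\<lambda>n. of_real t + \<i> * of_real (inverse (real (Suc n)))) \<longlonglongrightarrow> complex_of_real t"
      by simp
    have "(\<lambda>n. G (of_real t + \<i> * of_real (inverse (real (Suc n))))) \<longlonglongrightarrow> G (of_real t)"
      by (rule continuous_on_tendsto_compose[OF cont seq]) (auto simp del: of_real_inverse of_real_of_nat_eq)
    moreover have "(\<lambda>n. F (of_real t + \<i> * of_real (inverse (real (Suc n))))) \<longlonglongrightarrow> F (of_real t)"
      using DERIV_isCont[OF F[OF tB]] seq by (rule isCont_tendsto_compose)
    ultimately have "(\<lambda>n. G (of_real t + \<i> * of_real (inverse (real (Suc n)))) -
        F (of_real t + \<i> * of_real (inverse (real (Suc n))))) \<longlonglongrightarrow> G (of_real t) - F (of_real t)"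
      by (rule tendsto_diff)
    moreover have "\<forall>\<^sub>F n in sequentially. G (of_real t + \<i> * of_real (inverse (real (Suc n)))) -
        F (of_real t + \<i> * of_real (inverse (real (Suc n)))) = c"
    proof -
      have "\<forall>\<^sub>F n in sequentially. of_real t + \<i> * of_real (inverse (real (Suc n))) \<in> ?B"
        using seq tB by (rule topological_tendstoD[OF _ open_ball])
      then show ?thesis by eventually_elim (rule c, auto simp del: of_real_inverse of_real_of_nat_eq)
    qed
    ultimately have "G (of_real t) - F (of_real t) = c"
      by (rule LIMSEQ_unique[OF _ tendsto_eventually])
    then show ?thesis by (simp add: algebra_simps)
  qed
  moreover have "((\<lambda>t. F (of_real t) + c) has_vector_derivative W (of_real x)) (at x)"
    using has_vector_derivative_add[OF has_vector_derivative_real_field[OF F[of "of_real x"]]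
        has_vector_derivative_const[of c]] \<open>0 < \<rho>\<close> by simp
  ultimately show ?thesis
    by (rule_tac has_vector_derivative_transform_within_open[of "\<lambda>t. F (of_real t) + c" _ _ "{x - \<rho><..<x + \<rho>}"])
       (use \<open>0 < \<rho>\<close> in auto)
qed

section \<open>Boundary values of the root of f on the real axis\<close>

definition end_set :: "nat \<Rightarrow> (nat \<Rightarrow> real) \<Rightarrow> real set" where
  "end_set g e = e ` {..<2 * g + 2}"

lemma finite_end_set [simp]: "finite (end_set g e)"
  by (simp add: end_set_def)

lemma inj_on_end_tuple: "e \<in> end_tuples g \<Longrightarrow> inj_on e {..<2 * g + 2}"
  by (rule linorder_inj_onI') (auto dest: end_tuples_less)

lemma card_end_set: "e \<in> end_tuples g \<Longrightarrow> card (end_set g e) = 2 * g + 2"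
  using card_image[OF inj_on_end_tuple, of e g] by (simp only: end_set_def card_lessThan)

lemma prod_end_set:
  "e \<in> end_tuples g \<Longrightarrow> (\<Prod>x\<in>end_set g e. f x) = (\<Prod>i<2 * g + 2. f (e i))"
  unfolding end_set_def by (simp only: prod.reindex[OF inj_on_end_tuple] o_def)

lemma end_root_of_real:
  assumes "finite E"
  shows "end_root E (of_real x) = \<i> ^ card {e \<in> E. x < e} * of_real (sqrt (\<Prod>e\<in>E. \<bar>x - e\<bar>))"
  using assms
proof (induction E rule: finite_induct)
  case empty
  then show ?case by (simp add: end_root_def)
next
  case (insert e E)
  have eq: "end_root (insert e E) (of_real x) = up_sqrt (of_real (x - e)) * end_root E (of_real x)"
    using insert by (simp add: end_root_def)
  show ?case
  proof (cases "x < e")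
    case True
    have "{e' \<in> insert e E. x < e'} = insert e {e' \<in> E. x < e'}" using True by auto
    then have "card {e' \<in> insert e E. x < e'} = Suc (card {e' \<in> E. x < e'})"
      using insert by simp
    then show ?thesis
      using True insert unfolding eq by (simp add: up_sqrt_of_real(2) real_sqrt_mult del: of_real_diff)
  next
    case False
    then have "{e' \<in> insert e E. x < e'} = {e' \<in> E. x < e'}" by auto
    then show ?thesis
      using False insert unfolding eq by (simp add: up_sqrt_of_real(1) real_sqrt_mult del: of_real_diff)
  qed
qed

lemma card_ends_above:
  assumes e: "e \<in> end_tuples g" and "k < 2 * g + 1" "e k < x" "x < e (Suc k)"
  shows "card {y \<in> end_set g e. x < y} = 2 * g + 1 - k"
proof -
  have "{y \<in> end_set g e. x < y} = e ` {Suc k..<2 * g + 2}"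
  proof -
    have "x < e i \<longleftrightarrow> Suc k \<le> i" if "i < 2 * g + 2" for i
      using end_tuples_le[OF e, of "Suc k" i] end_tuples_le[OF e, of i k] assms that
      by (cases "Suc k \<le> i") auto
    then show ?thesis by (auto simp: end_set_def)
  qed
  moreover have "inj_on e {Suc k..<2 * g + 2}"
    by (rule inj_on_subset[OF inj_on_end_tuple[OF e]]) auto
  ultimately show ?thesis by (simp add: card_image)
qed

lemma card_ends_above_right:
  assumes "e \<in> end_tuples g" "e (2 * g + 1) < x" shows "card {y \<in> end_set g e. x < y} = 0"
proof -
  have "e i \<le> e (2 * g + 1)" if "i < 2 * g + 2" for i
    using that by (intro end_tuples_le[OF assms(1)]) auto
  then have "{y \<in> end_set g e. x < y} = {}"
    using assms(2) unfolding end_set_def by fastforce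
  then show ?thesis by (simp only: card.empty)
qed

lemma card_ends_above_left:
  assumes "e \<in> end_tuples g" "x < e 0" shows "card {y \<in> end_set g e. x < y} = 2 * g + 2"
proof -
  have "{y \<in> end_set g e. x < y} = end_set g e"
    using end_tuples_le[OF assms(1), of 0] assms(2) by (force simp: end_set_def)
  then show ?thesis by (simp add: card_end_set assms)
qed

lemma not_in_end_set:
  assumes e: "e \<in> end_tuples g" and "k < 2 * g + 1" "e k < x" "x < e (Suc k)"
  shows "x \<notin> end_set g e"
proof
  assume "x \<in> end_set g e"
  then obtain i where "i < 2 * g + 2" "x = e i" by (auto simp: end_set_def)
  then show False
    using end_tuples_le[OF e, of "Suc k" i] end_tuples_le[OF e, of i k] assms
    by (cases "Suc k \<le> i") auto
qed

definition end_prod :: "nat \<Rightarrow> (nat \<Rightarrow> real) \<Rightarrow> real \<Rightarrow> real" where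
  "end_prod g e x = (\<Prod>i<2 * g + 2. \<bar>x - e i\<bar>)"

lemma prod_abs_end_set:
  "e \<in> end_tuples g \<Longrightarrow> (\<Prod>y\<in>end_set g e. \<bar>x - y\<bar>) = end_prod g e x"
  by (simp only: end_prod_def prod_end_set)

lemma end_prod_rest:
  assumes "k < 2 * g + 1"
  shows "end_prod g e x = \<bar>x - e k\<bar> * \<bar>x - e (Suc k)\<bar> * rest g e k x"
proof -
  have "end_prod g e x = \<bar>x - e k\<bar> * (\<Prod>i\<in>{..<2 * g + 2} - {k}. \<bar>x - e i\<bar>)"
    unfolding end_prod_def using assms by (intro prod.remove) auto
  also have "(\<Prod>i\<in>{..<2 * g + 2} - {k}. \<bar>x - e i\<bar>) =
      \<bar>x - e (Suc k)\<bar> * (\<Prod>i\<in>{..<2 * g + 2} - {k} - {Suc k}. \<bar>x - e i\<bar>)"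
    using assms by (intro prod.remove) auto
  also have "{..<2 * g + 2} - {k} - {Suc k} = {..<2 * g + 2} - {k, Suc k}" by auto
  finally show ?thesis by (simp add: rest_def)
qed

definition cpoly :: "real poly \<Rightarrow> complex poly" where
  "cpoly r = map_poly of_real r"

lemma poly_cpoly_of_real [simp]: "poly (cpoly r) (of_real x) = of_real (poly r x)"
  unfolding cpoly_def by (induction r) (auto simp: map_poly_pCons)

lemma cpoly_mult: "cpoly (p * q) = cpoly p * cpoly q"
  by (intro poly_eqI) (simp add: cpoly_def coeff_map_poly coeff_mult)

lemma poly_cpoly_prod: "poly (cpoly (\<Prod>i\<in>I. [:- c i, 1:])) z = (\<Prod>i\<in>I. z - of_real (c i))"
proof (induction I rule: infinite_finite_induct)
  case (insert i I)
  have "poly (cpoly [:- c i, 1:]) z = z - of_real (c i)"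
    by (simp add: cpoly_def map_poly_pCons)
  then show ?case
    by (simp only: prod.insert[OF insert(1,2)] cpoly_mult poly_mult insert.IH)
qed (auto simp: cpoly_def)

lemma degree_cpoly [simp]: "degree (cpoly r) = degree r"
  by (simp add: cpoly_def degree_map_poly)

text \<open>Primitives of \<open>r dx / \<surd>f\<close> on the closed upper half plane. On the real axis the branch of \<open>\<surd>f\<close> is
  \<open>\<i> ^ m * \<surd>\<bar>f\<bar>\<close>, where \<open>m\<close> counts the ends to the right.\<close>

definition abelian_primitive :: "nat \<Rightarrow> (nat \<Rightarrow> real) \<Rightarrow> real poly \<Rightarrow> (complex \<Rightarrow> complex) \<Rightarrow> bool" where
  "abelian_primitive g e r G \<longleftrightarrow> continuous_on {z. 0 \<le> Im z} G \<and>
     (\<forall>z. 0 < Im z \<longrightarrow> (G has_field_derivative poly (cpoly r) z / end_root (end_set g e) z) (at z)) \<and>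
     (\<forall>x. x \<notin> end_set g e \<longrightarrow> ((\<lambda>t. \<i> ^ card {y \<in> end_set g e. x < y} * G (of_real t))
        has_vector_derivative of_real (poly r x / sqrt (end_prod g e x))) (at x))"

text \<open>\<open>degree r \<le> g\<close> means \<open>2 * degree r < 2 * g + 2\<close>, the
  condition under which \<open>r\<^sup>2 / f\<close> has a partial fraction expansion without
  polynomial part. Avoiding the finitely many ends by a disc gives the derivative at the remaining
  real points.\<close>

lemma abelian_primitive_exists:
  assumes e: "e \<in> end_tuples g" and deg: "degree r \<le> g"
  obtains G where "abelian_primitive g e r G"
proof -
  let ?E = "end_set g e"
  let ?W = "\<lambda>z. poly (cpoly r) z / end_root ?E z"
  obtain C where C: "0 \<le> C" "\<And>z. 0 < Im z \<Longrightarrow> norm (?W z) \<le> C / sqrt (Im z)"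
    using end_root_quotient_bound[of ?E "cpoly r"] deg e by (auto simp: card_end_set)
  have "?W holomorphic_on {z. 0 < Im z}"
    by (rule holomorphic_on_end_root_quotient) auto
  from primitive_extends_to_boundary[OF this C] obtain G where
    G: "continuous_on {z. 0 \<le> Im z} G" "\<And>z. 0 < Im z \<Longrightarrow> (G has_field_derivative ?W z) (at z)"
    by blast
  have "((\<lambda>t. \<i> ^ card {y \<in> ?E. x < y} * G (of_real t))
        has_vector_derivative of_real (poly r x / sqrt (end_prod g e x))) (at x)" if x: "x \<notin> ?E" for x
  proof -
    obtain \<rho> where \<rho>: "0 < \<rho>" "\<And>y. y \<in> ?E \<Longrightarrow> \<rho> \<le> dist x y"
      using finite_set_avoid[of ?E x] x by auto metis
    have "?W holomorphic_on ball (of_real x) \<rho>"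
    proof (rule holomorphic_on_end_root_quotient)
      fix z y assume z: "z \<in> ball (complex_of_real x) \<rho>" and y: "y \<in> ?E" "Re z = y"
      have "dist x y \<le> dist (of_real x) z"
        using abs_Re_le_cmod[of "of_real x - z"] y by (simp add: dist_norm)
      then show "0 < Im z" using \<rho>(2)[OF y(1)] z by simp
    qed simp
    from primitive_boundary_derivative[OF G this \<rho>(1)]
    have "((\<lambda>t. G (of_real t)) has_vector_derivative ?W (of_real x)) (at x)" .
    from has_vector_derivative_mult_right[OF this, of "\<i> ^ card {y \<in> ?E. x < y}"]
    show ?thesis by (simp add: end_root_of_real prod_abs_end_set[OF e])
  qed
  then show ?thesis
    using G that unfolding abelian_primitive_def by blast
qed

text \<open>The fundamental theorem along the cosine parametrization. The two factors of |f|
  vanishing at the ends have root \<open>(v - u) / 2 * sin \<phi>\<close>, which cancels the speed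
  of the parametrization. It runs from the right end to the left one, whence the minus
  signs.\<close>

lemma abelian_primitive_increment:
  assumes e: "e \<in> end_tuples g" and k: "k < 2 * g + 1" and G: "abelian_primitive g e r G"
  shows "\<i> ^ (2 * g + 1 - k) * (G (e (Suc k)) - G (e k)) = of_real (period g e k r)"
proof -
  let ?u = "e k" and ?v = "e (Suc k)" and ?m = "2 * g + 1 - k"
  have uv: "?u < ?v" using e k by (auto simp: end_tuples_def)
  let ?x = "cheb_node ?u ?v"
  let ?h = "\<lambda>x. poly r x / sqrt (rest g e k x)"
  have cont: "continuous_on {z. 0 \<le> Im z} G" using G by (simp add: abelian_primitive_def)
  have "((\<lambda>\<phi>. complex_of_real (- ?h (?x \<phi>))) has_integral
      \<i> ^ ?m * G (of_real (?x pi)) - \<i> ^ ?m * G (of_real (?x 0))) {0..pi}"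
  proof (rule fundamental_theorem_of_calculus_interior)
    show "continuous_on {0..pi} (\<lambda>\<phi>. \<i> ^ ?m * G (of_real (?x \<phi>)))"
      by (intro continuous_on_mult continuous_on_const continuous_on_compose2[OF cont]
          continuous_on_of_real continuous_on_cheb_node continuous_on_id) auto
    fix \<phi> assume \<phi>: "\<phi> \<in> {0<..<pi}"
    have x: "?u < ?x \<phi>" "?x \<phi> < ?v" using cheb_node_interior[OF uv] \<phi> by auto
    have c: "card {y \<in> end_set g e. ?x \<phi> < y} = ?m" by (rule card_ends_above[OF e k x])
    have dG: "((\<lambda>t. \<i> ^ ?m * G (of_real t)) has_vector_derivative
        of_real (poly r (?x \<phi>) / sqrt (end_prod g e (?x \<phi>)))) (at (?x \<phi>))"
      using G not_in_end_set[OF e k x] unfolding abelian_primitive_def c[symmetric] by blast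
    have dx: "(?x has_vector_derivative - ((?v - ?u) / 2 * sin \<phi>)) (at \<phi>)"
      unfolding cheb_node_def[abs_def] has_real_derivative_iff_has_vector_derivative[symmetric]
      by (auto intro!: derivative_eq_intros)
    have "((\<lambda>\<phi>. \<i> ^ ?m * G (of_real (?x \<phi>))) has_vector_derivative
       (- ((?v - ?u) / 2 * sin \<phi>)) *\<^sub>R complex_of_real (poly r (?x \<phi>) / sqrt (end_prod g e (?x \<phi>)))) (at \<phi>)"
      using vector_diff_chain_at[OF dx dG] by (simp only: o_def)
    moreover have "(- ((?v - ?u) / 2 * sin \<phi>)) * (poly r (?x \<phi>) / sqrt (end_prod g e (?x \<phi>))) = - ?h (?x \<phi>)"
    proof -
      have s: "0 < (?v - ?u) / 2 * sin \<phi>" using uv \<phi> by (simp add: sin_gt_zero)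
      have "(?x \<phi> - ?u) * (?v - ?x \<phi>) = ((?v - ?u) / 2)\<^sup>2 * (1 - (cos \<phi>)\<^sup>2)"
        by (simp add: cheb_node_def power2_eq_square field_simps)
      also have "\<dots> = ((?v - ?u) / 2 * sin \<phi>)\<^sup>2" by (simp only: sin_squared_eq power_mult_distrib)
      finally have "\<bar>?x \<phi> - ?u\<bar> * \<bar>?x \<phi> - ?v\<bar> = ((?v - ?u) / 2 * sin \<phi>)\<^sup>2" using x by simp
      then have sq: "sqrt (end_prod g e (?x \<phi>)) = (?v - ?u) / 2 * sin \<phi> * sqrt (rest g e k (?x \<phi>))"
        unfolding end_prod_rest[OF k] real_sqrt_mult[of _ "rest _ _ _ _"] using s by (simp add: real_sqrt_unique)
      have "- a * (p / (a * b)) = - (p / b)" if "0 < a" for a b p :: real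
        using that by simp
      then show ?thesis unfolding sq using s by (simp only:)
    qed
    ultimately show "((\<lambda>\<phi>. \<i> ^ ?m * G (of_real (?x \<phi>))) has_vector_derivative
        complex_of_real (- ?h (?x \<phi>))) (at \<phi>)"
      by (simp only: scaleR_conv_of_real of_real_mult[symmetric])
  qed simp
  moreover have "((\<lambda>\<phi>. complex_of_real (- ?h (?x \<phi>))) has_integral of_real (- period g e k r)) {0..pi}"
  proof -
    have "((\<lambda>\<phi>. ?h (?x \<phi>)) has_integral period g e k r) {0..pi}"
      unfolding period_def cheb_int_def
      by (intro integrable_integral integrable_continuous_real continuous_on_comp_cheb_node
          period_integrand_continuous e k less_imp_le uv)
    then show ?thesis by (intro has_integral_of_real has_integral_neg)
  qed
  ultimately have "\<i> ^ ?m * G (of_real (?x pi)) - \<i> ^ ?m * G (of_real (?x 0)) = of_real (- period g e k r)"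
    by (rule has_integral_unique)
  then show ?thesis by (simp add: algebra_simps)
qed

lemma constant_phase:
  fixes F :: "real \<Rightarrow> complex"
  assumes "continuous_on {u..v} F"
    and "\<And>x. u < x \<Longrightarrow> x < v \<Longrightarrow> (F has_vector_derivative of_real (D x)) (at x)"
    and "u \<le> x" "x \<le> y" "y \<le> v"
  shows "Im (F y) = Im (F x)"
proof (cases "x = y")
  case False
  have "((\<lambda>t. Im (F t)) has_real_derivative 0) (at t)" if "x < t" "t < y" for t
  proof -
    have "((\<lambda>t. Im (F t)) has_vector_derivative Im (of_real (D t))) (at t)"
      using bounded_linear.has_vector_derivative[OF bounded_linear_Im assms(2)] that assms by simp
    then show ?thesis by (simp add: has_real_derivative_iff_has_vector_derivative)
  qed
  moreover have "continuous_on {x..y} (\<lambda>t. Im (F t))"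
    using assms by (intro continuous_intros continuous_on_subset[OF assms(1)]) auto
  ultimately show ?thesis
    using False assms DERIV_isconst_end[of x y "\<lambda>t. Im (F t)"] by simp
qed simp

section \<open>Band measures\<close>

text \<open>\<open>- \<i> * w\<close> has positive real part, so its principal root has argument
  strictly between -pi/4 and pi/4; rotation by pi/4 leads into the open first quadrant.\<close>

lemma up_sqrt_quadrant:
  assumes "0 < Im w" shows "0 < Re (up_sqrt w)" "0 < Im (up_sqrt w)"
proof -
  let ?v = "csqrt (- \<i> * w)"
  have "0 < Re (?v\<^sup>2)" using assms by simp
  then have "(Im ?v)\<^sup>2 < (Re ?v)\<^sup>2" by (simp only: Re_power2) 
  moreover have "0 \<le> Re ?v" by (rule Re_csqrt)
  ultimately have "\<bar>Im ?v\<bar> < Re ?v" using power2_less_imp_less[of "\<bar>Im ?v\<bar>" "Re ?v"] by simp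
  moreover have "Re (cis (pi / 4) * v) = sqrt 2 / 2 * (Re v - Im v)"
    "Im (cis (pi / 4) * v) = sqrt 2 / 2 * (Re v + Im v)" for v
    by (simp_all add: cos_45 sin_45 algebra_simps)
  ultimately show "0 < Re (up_sqrt w)" "0 < Im (up_sqrt w)"
    unfolding up_sqrt_def by (simp_all only:) (auto simp: abs_less_iff)
qed

text \<open>A quotient \<open>q\<close> of two numbers in the open first quadrant has positive real
  part, so \<open>norm (q + 1) \<ge> 1\<close> and
  \<open>norm (q - 1) \<le> norm (q\<^sup>2 - 1)\<close>, where the roots have disappeared.\<close>

lemma up_sqrt_quotient_near_1:
  assumes "0 < Im z" shows "norm (up_sqrt (z - of_real e) / up_sqrt z - 1) \<le> \<bar>e\<bar> / norm z"
proof -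
  let ?q = "up_sqrt (z - of_real e) / up_sqrt z"
  have z: "z \<noteq> 0" using assms by auto
  have "0 < Re ?q"
    using up_sqrt_quadrant[of "z - of_real e"] up_sqrt_quadrant[of z] assms
    by (simp add: Re_divide add_pos_pos zero_less_divide_iff sum_power2_gt_zero_iff)
  then have "1 \<le> norm (?q + 1)" using complex_Re_le_cmod[of "?q + 1"] by simp
  moreover have "norm (?q - 1) * norm (?q + 1) = norm (?q\<^sup>2 - 1)"
    by (simp add: norm_mult[symmetric] power2_eq_square algebra_simps)
  moreover have "?q\<^sup>2 - 1 = - of_real e / z"
    using z by (simp add: power_divide field_simps)
  ultimately have "norm (?q - 1) * norm (?q + 1) = \<bar>e\<bar> / norm z"
    by (simp add: norm_divide)
  then show ?thesis
    using mult_left_mono[OF \<open>1 \<le> norm (?q + 1)\<close>, of "norm (?q - 1)"] by simp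
qed

text \<open>The relation \<open>f z = 1 + O(1 / z)\<close>, uniformly in the open upper half plane.
  The rate makes the difference between the differential and \<open>dz / z\<close> of order
  \<open>1 / z\<^sup>2\<close>, hence negligible on large paths.\<close>

definition near_one :: "(complex \<Rightarrow> complex) \<Rightarrow> bool" where
  "near_one f \<longleftrightarrow> (\<exists>C R. 0 \<le> C \<and> 0 < R \<and> (\<forall>z. 0 < Im z \<longrightarrow> R \<le> norm z \<longrightarrow> norm (f z - 1) \<le> C / norm z))"

lemma near_one_mult:
  assumes "near_one f" "near_one h" shows "near_one (\<lambda>z. f z * h z)"
proof -
  obtain C R C' R' where f: "0 \<le> C" "0 < R" "\<And>z. 0 < Im z \<Longrightarrow> R \<le> norm z \<Longrightarrow> norm (f z - 1) \<le> C / norm z"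
    and h: "0 \<le> C'" "0 < R'" "\<And>z. 0 < Im z \<Longrightarrow> R' \<le> norm z \<Longrightarrow> norm (h z - 1) \<le> C' / norm z"
    using assms unfolding near_one_def by blast
  have "norm (f z * h z - 1) \<le> (C + C * C' / R' + C') / norm z" if z: "0 < Im z" "max R R' \<le> norm z" for z
  proof -
    have nz: "0 < norm z" using z f by auto
    have 1: "norm (f z - 1) \<le> C / norm z" "norm (h z - 1) \<le> C' / norm z" using f h z by auto
    have 2: "C' / norm z \<le> C' / R'" using h z nz by (intro divide_left_mono) auto
    have "f z * h z - 1 = (f z - 1) * (h z - 1) + (f z - 1) + (h z - 1)" by (simp add: algebra_simps)
    then have "norm (f z * h z - 1) \<le> norm (f z - 1) * norm (h z - 1) + norm (f z - 1) + norm (h z - 1)"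
      by (metis norm_mult norm_triangle_le norm_triangle_ineq add_mono order_refl)
    also have "\<dots> \<le> C / norm z * (C' / R') + C / norm z + C' / norm z"
      using 1 2 f(1) nz by (intro add_mono mult_mono) auto
    also have "\<dots> = (C + C * C' / R' + C') / norm z" by (simp add: add_divide_distrib)
    finally show ?thesis .
  qed
  then show ?thesis
    unfolding near_one_def using f h by (intro exI[of _ "C + C * C' / R' + C'"] exI[of _ "max R R'"]) auto
qed

lemma near_one_inverse:
  assumes "near_one f" shows "near_one (\<lambda>z. inverse (f z))"
proof -
  obtain C R where f: "0 \<le> C" "0 < R" "\<And>z. 0 < Im z \<Longrightarrow> R \<le> norm z \<Longrightarrow> norm (f z - 1) \<le> C / norm z"
    using assms unfolding near_one_def by blast
  have "norm (inverse (f z) - 1) \<le> 2 * C / norm z" if z: "0 < Im z" "max R (2 * C) \<le> norm z" for z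
  proof -
    have nz: "0 < norm z" using z f by auto
    have 1: "norm (f z - 1) \<le> C / norm z" using f z by auto
    also have "\<dots> \<le> 1 / 2" using z nz by (simp add: field_simps)
    finally have "1 / 2 \<le> norm (f z)" using norm_triangle_ineq2[of 1 "1 - f z"] by (simp add: norm_minus_commute)
    moreover from this have "f z \<noteq> 0" by auto
    ultimately have "norm (inverse (f z) - 1) = norm (f z - 1) / norm (f z)"
      by (simp add: norm_divide[symmetric] norm_minus_commute field_simps)
    also have "\<dots> \<le> (C / norm z) / (1 / 2)"
      using 1 \<open>1 / 2 \<le> norm (f z)\<close> f nz by (intro frac_le) auto
    finally show ?thesis by (simp add: mult.commute)
  qed
  then show ?thesis
    unfolding near_one_def using f by (intro exI[of _ "2 * C"] exI[of _ "max R (2 * C)"]) auto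
qed

lemma near_one_prod:
  "(\<And>i. i \<in> I \<Longrightarrow> near_one (f i)) \<Longrightarrow> near_one (\<lambda>z. \<Prod>i\<in>I. f i z)"
proof (induction I rule: infinite_finite_induct)
  case (insert i I)
  then show ?case using near_one_mult[of "f i" "\<lambda>z. \<Prod>i\<in>I. f i z"] by simp
qed (auto simp: near_one_def intro!: exI[of _ 0] exI[of _ 1])

text \<open>A monic numerator of degree \<open>g\<close> against \<open>2 * g + 2\<close> square
  roots, worth \<open>z ^ (g + 1)\<close>, leaves \<open>dz / z\<close> with coefficient 1.\<close>

lemma abelian_differential_asymptotics:
  assumes e: "e \<in> end_tuples g" and r: "r = (\<Prod>j<g. [:- c j, 1:])"
  shows "near_one (\<lambda>z. z * (poly (cpoly r) z / end_root (end_set g e) z))"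
proof -
  have "near_one (\<lambda>z. up_sqrt (z - of_real x) / up_sqrt z)" for x
    unfolding near_one_def using up_sqrt_quotient_near_1[of _ x]
    by (intro exI[of _ "\<bar>x\<bar>"] exI[of _ 1]) auto
  then have "near_one (\<lambda>z. inverse (\<Prod>x\<in>end_set g e. up_sqrt (z - of_real x) / up_sqrt z))"
    by (intro near_one_inverse near_one_prod)
  moreover have "near_one (\<lambda>z. \<Prod>j<g. 1 - of_real (c j) / z)"
  proof (intro near_one_prod)
    show "near_one (\<lambda>z. 1 - of_real (c j) / z)" for j
      unfolding near_one_def by (intro exI[of _ "\<bar>c j\<bar>"] exI[of _ 1]) (auto simp: norm_divide)
  qed
  ultimately have "near_one (\<lambda>z. (\<Prod>j<g. 1 - of_real (c j) / z) *
      inverse (\<Prod>x\<in>end_set g e. up_sqrt (z - of_real x) / up_sqrt z))"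
    by (rule near_one_mult[rotated])
  moreover have "(\<Prod>j<g. 1 - of_real (c j) / z) *
      inverse (\<Prod>x\<in>end_set g e. up_sqrt (z - of_real x) / up_sqrt z) =
      z * (poly (cpoly r) z / end_root (end_set g e) z)" if "0 < Im z" for z
  proof -
    have z: "z \<noteq> 0" using that by auto
    have "poly (cpoly r) z = (\<Prod>j<g. z - of_real (c j))"
      unfolding r by (rule poly_cpoly_prod)
    also have "\<dots> = (\<Prod>j<g. z * (1 - of_real (c j) / z))"
      using z by (simp add: right_diff_distrib)
    also have "\<dots> = z ^ g * (\<Prod>j<g. 1 - of_real (c j) / z)" by (simp add: prod.distrib)
    finally have 1: "poly (cpoly r) z = z ^ g * (\<Prod>j<g. 1 - of_real (c j) / z)" .
    have "(\<Prod>x\<in>end_set g e. up_sqrt (z - of_real x) / up_sqrt z) = end_root (end_set g e) z / up_sqrt z ^ (2 * g + 2)"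
      by (simp only: prod_dividef prod_constant card_end_set[OF e] end_root_def)
    also have "up_sqrt z ^ (2 * g + 2) = z ^ Suc g"
    proof -
      have "up_sqrt z ^ (2 * g + 2) = ((up_sqrt z)\<^sup>2) ^ Suc g"
        by (simp only: power_mult[symmetric]) simp
      then show ?thesis by (simp only: up_sqrt_square)
    qed
    finally show ?thesis using z unfolding 1 by simp
  qed
  ultimately show ?thesis
    unfolding near_one_def by metis
qed

lemma boundary_norm_bound:
  assumes "continuous_on S D" and S: "\<And>\<delta>. 0 \<le> \<delta> \<Longrightarrow> of_real x + \<i> * of_real \<delta> \<in> S"
    and "\<And>\<delta>. 0 < \<delta> \<Longrightarrow> \<delta> \<le> 1 \<Longrightarrow> norm (a - D (of_real x + \<i> * of_real \<delta>)) \<le> B"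
  shows "norm (a - D (of_real x)) \<le> B"
proof -
  have "(\<lambda>n. of_real x + \<i> * of_real (inverse (real (Suc n)))) \<longlonglongrightarrow> of_real x + \<i> * of_real 0"
    by (intro tendsto_intros LIMSEQ_inverse_real_of_nat)
  then have "(\<lambda>n. D (of_real x + \<i> * of_real (inverse (real (Suc n))))) \<longlonglongrightarrow> D (of_real x + \<i> * of_real 0)"
    by (rule continuous_on_tendsto_compose[OF assms(1)]) (use S[of 0] S in \<open>auto simp del: of_real_inverse of_real_of_nat_eq intro!: always_eventually\<close>)
  then have "(\<lambda>n. norm (a - D (of_real x + \<i> * of_real (inverse (real (Suc n)))))) \<longlonglongrightarrow> norm (a - D (of_real x))"
    by (intro tendsto_intros) simp
  then show ?thesis
    by (rule Lim_bounded[where M = 0]) (auto simp del: of_real_inverse of_real_of_nat_eq intro!: assms(3) inverse_le_1_iff[THEN iffD2])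
qed

text \<open>Three sides of a rectangle join \<open>- R\<close> to \<open>R\<close> through height
  \<open>R\<close>. Their total length is \<open>4 * R\<close> and the derivative is at most
  \<open>C / R\<^sup>2\<close> there.\<close>

lemma increment_across_infinity:
  assumes cont: "continuous_on {z. 0 \<le> Im z \<and> R0 \<le> norm z} D"
    and D: "\<And>z. 0 < Im z \<Longrightarrow> R0 \<le> norm z \<Longrightarrow> (D has_field_derivative D' z) (at z)"
    and D': "\<And>z. 0 < Im z \<Longrightarrow> R0 \<le> norm z \<Longrightarrow> norm (D' z) \<le> C / (norm z)\<^sup>2" and "0 \<le> C" "0 < R0"
  shows "((\<lambda>R. D (of_real R) - D (of_real (- R))) \<longlongrightarrow> 0) at_top"
proof -
  have bound: "norm (D p - D q) \<le> C / R\<^sup>2 * norm (p - q)"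
    if "convex S" "p \<in> S" "q \<in> S" "R0 \<le> R" and S: "\<And>z. z \<in> S \<Longrightarrow> 0 < Im z \<and> R \<le> norm z" for S R p q
  proof (rule field_differentiable_bound[OF \<open>convex S\<close>])
    fix z assume z: "z \<in> S"
    have z': "0 < Im z" "R0 \<le> norm z" "R \<le> norm z" using S[OF z] \<open>R0 \<le> R\<close> by linarith+
    show "(D has_field_derivative D' z) (at z within S)"
      by (intro has_field_derivative_at_within[OF D] z')
    have "norm (D' z) \<le> C / (norm z)\<^sup>2" by (intro D' z')
    also have "\<dots> \<le> C / R\<^sup>2"
      using z' \<open>R0 \<le> R\<close> assms(4,5) by (intro divide_left_mono power_mono mult_pos_pos zero_less_power) linarith+
    finally show "norm (D' z) \<le> C / R\<^sup>2" .
  qed (use that in auto)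
  have main: "norm (D (of_real R) - D (of_real (- R))) \<le> 4 * C / R" if R: "max R0 1 \<le> R" for R
  proof -
    have pos: "0 < R" using R assms by simp
    have side: "norm (D (of_real x + \<i> * of_real R) - D (of_real x)) \<le> C / R"
      if x: "x = R \<or> x = - R" for x
    proof (rule boundary_norm_bound[OF cont])
      show "of_real x + \<i> * of_real \<delta> \<in> {z. 0 \<le> Im z \<and> R0 \<le> norm z}" if "0 \<le> \<delta>" for \<delta>
        using abs_Re_le_cmod[of "of_real x + \<i> * of_real \<delta>"] that x R pos by auto
    next
      fix \<delta> :: real assume \<delta>: "0 < \<delta>" "\<delta> \<le> 1"
      let ?p = "of_real x + \<i> * of_real (R :: real) :: complex" and ?q = "of_real x + \<i> * of_real \<delta> :: complex"
      \<comment> \<open>A quarter plane contains the vertical side, is convex, and keeps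
        \<open>norm z \<ge> R\<close>. The derivative is controlled for \<open>0 < Im z\<close>
        only, so the foot of the side is reached as a limit
        \<open>\<delta> \<rightarrow> 0\<close>.\<close>
      define S where "S = (if x = R then {z. R \<le> Re z} else {z. Re z \<le> - R}) \<inter> {z. 0 < Im z}"
      have "norm (D ?p - D ?q) \<le> C / R\<^sup>2 * norm (?p - ?q)"
      proof (rule bound[of S])
        show "convex S"
          unfolding S_def by (auto intro!: convex_Int convex_halfspace_Re_ge convex_halfspace_Re_le convex_halfspace_Im_gt)
        show "?p \<in> S" "?q \<in> S" using x pos \<delta> by (auto simp: S_def)
        show "0 < Im z \<and> R \<le> norm z" if "z \<in> S" for z
          using that abs_Re_le_cmod[of z] by (auto simp: S_def split: if_splits)
      qed (use R in simp)
      also have "?p - ?q = \<i> * of_real (R - \<delta>)" by (simp add: algebra_simps)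
      also have "C / R\<^sup>2 * norm (\<i> * of_real (R - \<delta>)) \<le> C / R\<^sup>2 * R"
        unfolding norm_mult norm_of_real using \<open>0 \<le> C\<close> \<delta> R by (intro mult_left_mono) auto
      also have "\<dots> = C / R" using pos by (simp add: power2_eq_square)
      finally show "norm (D ?p - D ?q) \<le> C / R" .
    qed
    have top: "norm (D (of_real R + \<i> * of_real R) - D (of_real (- R) + \<i> * of_real R)) \<le> 2 * C / R"
    proof -
      have "norm (D (of_real R + \<i> * of_real R) - D (of_real (- R) + \<i> * of_real R)) \<le>
         C / R\<^sup>2 * norm ((of_real R + \<i> * of_real R) - (of_real (- R) + \<i> * of_real R) :: complex)"
        by (rule bound[of "{z. R \<le> Im z}"])
           (use pos R in \<open>auto intro: convex_halfspace_Im_ge order.trans[OF _ order.trans[OF abs_ge_self abs_Im_le_cmod]]\<close>)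
      also have "(of_real R + \<i> * of_real R) - (of_real (- R) + \<i> * of_real R) = complex_of_real (2 * R)" by simp
      finally show ?thesis using pos by (simp add: power2_eq_square field_simps)
    qed
    have "D (of_real R) - D (of_real (- R)) =
      (D (of_real R + \<i> * of_real R) - D (of_real (- R) + \<i> * of_real R))
      - (D (of_real R + \<i> * of_real R) - D (of_real R))
      + (D (of_real (- R) + \<i> * of_real R) - D (of_real (- R)))" by simp
    then have "norm (D (of_real R) - D (of_real (- R))) \<le>
       norm (D (of_real R + \<i> * of_real R) - D (of_real (- R) + \<i> * of_real R))
      + norm (D (of_real R + \<i> * of_real R) - D (of_real R))
      + norm (D (of_real (- R) + \<i> * of_real R) - D (of_real (- R)))"
      by (simp only:) (intro order.trans[OF norm_triangle_ineq] add_mono norm_triangle_ineq4 order.refl)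
    also have "\<dots> \<le> 2 * C / R + C / R + C / R"
      using side[of R] side[of "- R"] top by (intro add_mono) auto
    finally show ?thesis by (simp add: field_simps)
  qed
  show ?thesis
  proof (rule Lim_null_comparison)
    show "\<forall>\<^sub>F R in at_top. norm (D (of_real R) - D (of_real (- R))) \<le> 4 * C / R"
      using eventually_ge_at_top[of "max R0 1"] by eventually_elim (rule main)
    show "((\<lambda>R. 4 * C / R) \<longlongrightarrow> 0) at_top"
      by (intro tendsto_divide_0[OF tendsto_const] filterlim_at_top_imp_at_infinity filterlim_ident)
  qed
qed

text \<open>The comparison function \<open>Ln (- \<i> * z)\<close> is a primitive of
  \<open>1 / z\<close> without cut in the upper half plane. Its increment from \<open>- R\<close> to
  \<open>R\<close> is \<open>- \<i> * pi\<close>, the half turn around infinity.\<close>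

lemma abelian_primitive_infinity:
  assumes e: "e \<in> end_tuples g" and r: "r = (\<Prod>j<g. [:- c j, 1:])" and G: "abelian_primitive g e r G"
  shows "((\<lambda>R. G (of_real R) - G (of_real (- R))) \<longlongrightarrow> - \<i> * pi) at_top"
proof -
  let ?W = "\<lambda>z. poly (cpoly r) z / end_root (end_set g e) z"
  obtain C R where CR: "0 \<le> C" "0 < R"
    "\<And>z. 0 < Im z \<Longrightarrow> R \<le> norm z \<Longrightarrow> norm (z * ?W z - 1) \<le> C / norm z"
    using abelian_differential_asymptotics[OF e r] unfolding near_one_def by blast
  let ?D = "\<lambda>z. G z - Ln (- \<i> * z)"
  have notin: "- \<i> * z \<notin> \<real>\<^sub>\<le>\<^sub>0" if "0 \<le> Im z" "z \<noteq> 0" for z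
    using that by (auto simp: complex_nonpos_Reals_iff complex_eq_iff)
  have "((\<lambda>R. ?D (of_real R) - ?D (of_real (- R))) \<longlongrightarrow> 0) at_top"
  proof (rule increment_across_infinity)
    have "continuous_on {z. 0 \<le> Im z} G" using G by (simp add: abelian_primitive_def)
    then show "continuous_on {z. 0 \<le> Im z \<and> R \<le> norm z} ?D"
      using CR(2) by (intro continuous_intros notin) (auto elim: continuous_on_subset)
    fix z assume z: "0 < Im z" "R \<le> norm z"
    then have z0: "z \<noteq> 0" by auto
    have "(G has_field_derivative ?W z) (at z)" using G z by (simp add: abelian_primitive_def)
    moreover have "((\<lambda>z. Ln (- \<i> * z)) has_field_derivative 1 / z) (at z)"
      using notin[of z] z z0 by (auto intro!: derivative_eq_intros simp: field_simps)
    ultimately show "(?D has_field_derivative ?W z - 1 / z) (at z)" by (rule DERIV_diff)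
    have "norm (?W z - 1 / z) = norm (z * ?W z - 1) / norm z"
      using z0 by (simp add: norm_divide[symmetric] diff_divide_distrib)
    also have "\<dots> \<le> (C / norm z) / norm z" using CR(3)[OF z] by (intro divide_right_mono) auto
    finally show "norm (?W z - 1 / z) \<le> C / (norm z)\<^sup>2" by (simp add: power2_eq_square)
  qed (use CR in auto)
  then have "((\<lambda>R. ?D (of_real R) - ?D (of_real (- R)) + - \<i> * pi) \<longlongrightarrow> 0 + - \<i> * pi) at_top"
    by (intro tendsto_intros)
  moreover have "\<forall>\<^sub>F R in at_top. ?D (of_real R) - ?D (of_real (- R)) + - \<i> * pi = G (of_real R) - G (of_real (- R))"
    using eventually_gt_at_top[of 0]
  proof eventually_elim
    case (elim R)
    have "Ln (of_real R * - \<i>) = ln R + Ln (- \<i>)"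
      using elim Ln_times_of_real[of R "- \<i>"] by (simp add: Ln_of_real)
    moreover have "Ln (of_real R * \<i>) = ln R + Ln \<i>"
      using elim Ln_times_of_real[of R \<i>] by (simp add: Ln_of_real)
    ultimately show ?case by (simp add: mult.commute)
  qed
  ultimately show ?thesis by (simp add: Lim_transform_eventually)
qed

text \<open>Between consecutive ends \<open>G\<close> moves along a line: horizontal when
  \<open>m\<close> is even, vertical when \<open>m\<close> is odd.\<close>

lemma abelian_primitive_phase:
  assumes G: "abelian_primitive g e r G" and xy: "u \<le> x" "x \<le> y" "y \<le> v"
    and m: "\<And>t. u < t \<Longrightarrow> t < v \<Longrightarrow> t \<notin> end_set g e \<and> card {y \<in> end_set g e. t < y} = m"
  shows "Im (\<i> ^ m * G (of_real y)) = Im (\<i> ^ m * G (of_real x))"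
proof (rule constant_phase[OF _ _ xy])
  have "continuous_on {z. 0 \<le> Im z} G" using G by (simp add: abelian_primitive_def)
  then show "continuous_on {u..v} (\<lambda>t. \<i> ^ m * G (of_real t))"
    by (intro continuous_on_mult continuous_on_const) 
       (rule continuous_on_compose2, auto intro!: continuous_intros)
  show "((\<lambda>t. \<i> ^ m * G (of_real t)) has_vector_derivative of_real (poly r t / sqrt (end_prod g e t))) (at t)"
    if "u < t" "t < v" for t
    using G m[OF that] unfolding abelian_primitive_def by blast
qed

lemma i_power_even: "\<i> ^ (2 * n) = (- 1) ^ n"
  by (simp add: power_mult)

text \<open>On the two outer rays \<open>G\<close> moves horizontally, so the imaginary part of the
  increment between the outermost ends already equals its limit at infinity.\<close>

lemma abelian_primitive_total:
  assumes e: "e \<in> end_tuples g" and r: "r = (\<Prod>j<g. [:- c j, 1:])" and G: "abelian_primitive g e r G"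
  shows "Im (G (e (2 * g + 1)) - G (e 0)) = - pi"
proof -
  have "((\<lambda>R. Im (G (of_real R) - G (of_real (- R)))) \<longlongrightarrow> Im (- \<i> * pi)) at_top"
    by (intro tendsto_Im abelian_primitive_infinity[OF assms])
  moreover have "\<forall>\<^sub>F R in at_top. Im (G (of_real R) - G (of_real (- R))) = Im (G (e (2 * g + 1)) - G (e 0))"
    using eventually_ge_at_top[of "max (e (2 * g + 1)) (- e 0)"]
  proof eventually_elim
    case (elim R)
    have "Im (\<i> ^ 0 * G R) = Im (\<i> ^ 0 * G (e (2 * g + 1)))"
    proof (rule abelian_primitive_phase[OF G order.refl _ order.refl])
      show "t \<notin> end_set g e \<and> card {y \<in> end_set g e. t < y} = 0" if "e (2 * g + 1) < t" for t
      proof -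
        have "e i \<le> e (2 * g + 1)" if "i < 2 * g + 2" for i
          using that by (intro end_tuples_le[OF e]) auto
        then have "t \<notin> end_set g e" using that unfolding end_set_def by fastforce
        then show ?thesis using card_ends_above_right[OF e that] by simp
      qed
    qed (use elim in auto)
    moreover have "Im (\<i> ^ (2 * g + 2) * G (e 0)) = Im (\<i> ^ (2 * g + 2) * G (of_real (- R)))"
    proof (rule abelian_primitive_phase[OF G order.refl _ order.refl])
      show "t \<notin> end_set g e \<and> card {y \<in> end_set g e. t < y} = 2 * g + 2" if "t < e 0" for t
      proof -
        have "e 0 \<le> e i" if "i < 2 * g + 2" for i
          using that by (intro end_tuples_le[OF e]) auto
        then have "t \<notin> end_set g e" using that unfolding end_set_def by fastforce
        then show ?thesis using card_ends_above_left[OF e that] by simp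
      qed
    qed (use elim in auto)
    moreover have "\<i> ^ (2 * g + 2) = 1 \<or> \<i> ^ (2 * g + 2) = - 1"
      using i_power_even[of "g + 1"] by (cases "even g") simp_all
    ultimately show ?case by auto
  qed
  ultimately have "((\<lambda>R::real. Im (G (e (2 * g + 1)) - G (e 0))) \<longlongrightarrow> Im (- \<i> * pi)) at_top"
    by (simp add: Lim_transform_eventually)
  then show ?thesis by (simp add: tendsto_const_iff)
qed

text \<open>The normalized \<open>r\<close> of the overview. Its roots, one in each gap, are the
  critical points of the Green function of the complement of the bands with pole at
  infinity.\<close>

definition band_poly :: "nat \<Rightarrow> (nat \<Rightarrow> real) \<Rightarrow> real poly" where
  "band_poly g e = gap_poly g e g g"

text \<open>The harmonic measure of \<open>[e (2 j), e (2 j + 1)]\<close> seen from infinity; the sign is that of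
  \<open>band_poly g e\<close> on this band.\<close>

definition band_measure :: "nat \<Rightarrow> (nat \<Rightarrow> real) \<Rightarrow> nat \<Rightarrow> real" where
  "band_measure g e j = (- 1) ^ (g - j) * period g e (2 * j) (band_poly g e) / pi"

lemma band_poly_props:
  assumes "e \<in> end_tuples g"
  shows "degree (band_poly g e) = g" "lead_coeff (band_poly g e) = 1"
    "\<And>j. j < g \<Longrightarrow> period g e (2 * j + 1) (band_poly g e) = 0"
  using gap_poly_props[OF assms order.refl order.refl] by (auto simp: band_poly_def)

lemma band_poly_roots:
  assumes "e \<in> end_tuples g"
  obtains c where "\<And>j. j < g \<Longrightarrow> e (2 * j + 1) < c j \<and> c j < e (2 * j + 2)"
    "band_poly g e = (\<Prod>j<g. [:- c j, 1:])"
  using poly_roots_in_gaps[OF assms order.refl] band_poly_props[OF assms] by blast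

lemma gap_increment:
  assumes e: "e \<in> end_tuples g" and G: "abelian_primitive g e (band_poly g e) G" and j: "j < g"
  shows "G (of_real (e (Suc (2 * j + 1)))) - G (of_real (e (2 * j + 1))) = 0"
  using abelian_primitive_increment[OF e _ G, of "2 * j + 1"] band_poly_props(3)[OF e j] j by simp

lemma band_increment:
  assumes e: "e \<in> end_tuples g" and G: "abelian_primitive g e (band_poly g e) G" and j: "j \<le> g"
  shows "G (of_real (e (Suc (2 * j)))) - G (of_real (e (2 * j))) = - \<i> * of_real (pi * band_measure g e j)"
proof -
  define d where "d = G (of_real (e (Suc (2 * j)))) - G (of_real (e (2 * j)))"
  have p: "\<i> ^ (2 * g + 1 - 2 * j) = \<i> * (- 1) ^ (g - j)"
    using j i_power_even[of "g - j"] by (simp add: Suc_diff_le flip: diff_mult_distrib2)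
  have per: "period g e (2 * j) (band_poly g e) = (- 1) ^ (g - j) * pi * band_measure g e j"
    by (cases "even (g - j)") (simp_all add: band_measure_def)
  have "\<i> * (- 1) ^ (g - j) * d = (- 1) ^ (g - j) * of_real (pi * band_measure g e j)"
    using abelian_primitive_increment[OF e _ G, of "2 * j"] j unfolding p per d_def[symmetric] by simp
  then have *: "\<i> * d = of_real (pi * band_measure g e j)"
    by (cases "even (g - j)") simp_all
  show ?thesis
    unfolding d_def[symmetric] *[symmetric] by (simp add: mult.assoc[symmetric])
qed

lemma sum_even_odd:
  fixes f :: "nat \<Rightarrow> 'a::comm_monoid_add"
  shows "(\<Sum>k<2 * n + 1. f k) = (\<Sum>j\<le>n. f (2 * j)) + (\<Sum>j<n. f (2 * j + 1))"
  by (induction n) (simp_all add: ac_simps)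

text \<open>The increments of \<open>G\<close> over all bands and gaps telescope to the total
  increment, of imaginary part \<open>- pi\<close>; the gaps contribute 0 by the
  normalization.\<close>

lemma band_measure_sum:
  assumes e: "e \<in> end_tuples g" shows "(\<Sum>j\<le>g. band_measure g e j) = 1"
proof -
  let ?r = "band_poly g e"
  obtain c where c: "?r = (\<Prod>j<g. [:- c j, 1:])" using band_poly_roots[OF e] by blast
  obtain G where G: "abelian_primitive g e ?r G"
    using abelian_primitive_exists[OF e, of ?r] band_poly_props[OF e] by auto
  have gap: "Im (G (e (Suc (2 * j + 1))) - G (e (2 * j + 1))) = 0" if "j < g" for j
    using gap_increment[OF e G that] by simp
  have band: "Im (G (e (Suc (2 * j))) - G (e (2 * j))) = - pi * band_measure g e j" if "j \<le> g" for j
    using band_increment[OF e G that] by simp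
  have "- pi = Im (\<Sum>k<2 * g + 1. G (e (Suc k)) - G (e k))"
    using abelian_primitive_total[OF e c G] by (subst sum_lessThan_telescope) simp
  also have "\<dots> = (\<Sum>k<2 * g + 1. Im (G (e (Suc k)) - G (e k)))" by (rule Im_sum)
  also have "\<dots> = (\<Sum>j\<le>g. - pi * band_measure g e j)"
    unfolding sum_even_odd using gap band by simp
  also have "\<dots> = - pi * (\<Sum>j\<le>g. band_measure g e j)" by (rule sum_distrib_left[symmetric])
  finally show ?thesis by simp
qed

text \<open>To the right of \<open>x\<close> lie exactly the \<open>g - j\<close> roots in the gaps
  after band \<open>j\<close>. The bounds on \<open>x\<close> are conditional so that the first and
  the last case include the outer rays, where the sign is needed as well.\<close>

lemma band_poly_sign:
  assumes e: "e \<in> end_tuples g" and j: "j \<le> g" and x: "0 < j \<Longrightarrow> e (2 * j) \<le> x" "j < g \<Longrightarrow> x \<le> e (2 * j + 1)"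
  shows "0 < (- 1) ^ (g - j) * poly (band_poly g e) x"
proof -
  obtain c where c: "\<And>i. i < g \<Longrightarrow> e (2 * i + 1) < c i \<and> c i < e (2 * i + 2)"
    "band_poly g e = (\<Prod>j<g. [:- c j, 1:])" using band_poly_roots[OF e] by blast
  have "poly (band_poly g e) x = (\<Prod>i\<in>{..<j} \<union> {j..<g}. x - c i)"
    unfolding c(2) using j by (simp add: poly_prod ivl_disj_un_one)
  also have "\<dots> = (\<Prod>i<j. x - c i) * (\<Prod>i\<in>{j..<g}. x - c i)"
    by (rule prod.union_disjoint) auto
  also have "(\<Prod>i\<in>{j..<g}. x - c i) = (\<Prod>i\<in>{j..<g}. - 1 * (c i - x))" by simp
  also have "\<dots> = (- 1) ^ (g - j) * (\<Prod>i\<in>{j..<g}. c i - x)"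
    by (simp only: prod.distrib prod_constant card_atLeastLessThan)
  finally have "(- 1) ^ (g - j) * poly (band_poly g e) x = (\<Prod>i<j. x - c i) * (\<Prod>i\<in>{j..<g}. c i - x)"
    by (cases "even (g - j)") simp_all
  moreover have "0 < (\<Prod>i<j. x - c i)"
  proof (rule prod_pos)
    fix i assume "i \<in> {..<j}"
    then show "0 < x - c i"
      using c(1)[of i] j x end_tuples_le[OF e, of "2 * i + 2" "2 * j"] by fastforce
  qed
  moreover have "0 < (\<Prod>i\<in>{j..<g}. c i - x)"
  proof (rule prod_pos)
    fix i assume "i \<in> {j..<g}"
    then show "0 < c i - x"
      using c(1)[of i] j x end_tuples_le[OF e, of "2 * j + 1" "2 * i + 1"] by fastforce
  qed
  ultimately show ?thesis by simp
qed

lemma band_measure_eq: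
  assumes e: "e \<in> end_tuples g" and j: "j \<le> g"
  shows "band_measure g e j = cheb_int (e (2 * j)) (e (2 * j + 1))
    (\<lambda>x. \<bar>poly (band_poly g e) x\<bar> / sqrt (rest g e (2 * j) x)) / pi"
proof -
  have "e (2 * j) \<le> e (2 * j + 1)" using j by (intro end_tuples_le[OF e]) auto
  moreover have "\<bar>poly (band_poly g e) x\<bar> = (- 1) ^ (g - j) * poly (band_poly g e) x"
    if "e (2 * j) \<le> x" "x \<le> e (2 * j + 1)" for x
  proof -
    have "\<bar>poly (band_poly g e) x\<bar> = \<bar>(- 1) ^ (g - j) * poly (band_poly g e) x\<bar>"
      by (simp add: abs_mult power_abs)
    then show ?thesis using band_poly_sign[OF e j that] by simp
  qed
  ultimately have "cheb_int (e (2 * j)) (e (2 * j + 1))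
      (\<lambda>x. \<bar>poly (band_poly g e) x\<bar> / sqrt (rest g e (2 * j) x)) =
    cheb_int (e (2 * j)) (e (2 * j + 1))
      (\<lambda>x. (- 1) ^ (g - j) * (poly (band_poly g e) x / sqrt (rest g e (2 * j) x)))"
    by (intro cheb_int_cong) simp_all
  then show ?thesis unfolding band_measure_def period_def cheb_int_cmult[symmetric] by simp
qed

lemma continuous_on_band_measure:
  assumes "j \<le> g" shows "continuous_on (end_tuples g) (\<lambda>e. band_measure g e j)"
proof -
  have "continuous_on (end_tuples g) (\<lambda>e. period g e (2 * j) (band_poly g e))"
    unfolding band_poly_def
    by (intro continuous_on_period continuous_on_gap_poly) (use assms in auto)
  then show ?thesis unfolding band_measure_def by (intro continuous_intros) auto
qed

section \<open>Monotonicity of the band measures\<close>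

lemma coprime_linear:
  fixes a b :: real assumes "a \<noteq> b" shows "coprime [:- a, 1:] [:- b, 1:]"
proof (rule coprimeI)
  fix d assume "d dvd [:- a, 1:]" "d dvd [:- b, 1:]"
  then have "d dvd [:- a, 1:] - [:- b, 1:]" by (rule dvd_diff)
  moreover have "is_unit ([:- a, 1:] - [:- b, 1:])" using assms by (simp add: is_unit_const_poly_iff dvd_field_iff)
  ultimately show "is_unit d" by (rule dvd_unit_imp_unit)
qed

text \<open>Converts a sign of \<open>N = r\<^sup>2 * (x - l) - s\<^sup>2 * (x - u)\<close>, in the
  notation of the comparison below, into an inequality between the densities of two configurations;
  \<open>R\<close> is their common part of |f|.\<close>

lemma sqrt_quotient_less:
  fixes a b p q R :: real
  assumes "a\<^sup>2 * p < b\<^sup>2 * q" "0 < p" "0 < q" "0 < R"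
  shows "\<bar>a\<bar> / sqrt (R * q) < \<bar>b\<bar> / sqrt (R * p)"
proof -
  have "sqrt (a\<^sup>2 * p) < sqrt (b\<^sup>2 * q)" using assms by simp
  then have "\<bar>a\<bar> * sqrt p < \<bar>b\<bar> * sqrt q" by (simp add: real_sqrt_mult)
  then have "\<bar>a\<bar> / sqrt q < \<bar>b\<bar> / sqrt p" using assms by (simp add: field_simps)
  then have "\<bar>a\<bar> / sqrt q / sqrt R < \<bar>b\<bar> / sqrt p / sqrt R"
    using assms by (intro divide_strict_right_mono) auto
  then show ?thesis by (simp add: real_sqrt_mult mult.commute)
qed

lemma end_prod_pos: "x \<notin> end_set g e \<Longrightarrow> 0 < end_prod g e x"
  unfolding end_prod_def end_set_def by (rule prod_pos) auto

text \<open>Both normalized primitives have the same increment over the interval through infinity.\<close>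

lemma no_domination_at_infinity:
  assumes e: "e \<in> end_tuples g" and e': "e' \<in> end_tuples g" and "e' 0 = e 0" "e' (2 * g + 1) = e (2 * g + 1)"
    and right: "\<And>x. e (2 * g + 1) < x \<Longrightarrow>
      \<bar>poly (band_poly g e') x\<bar> / sqrt (end_prod g e' x) < \<bar>poly (band_poly g e) x\<bar> / sqrt (end_prod g e x)"
    and left: "\<And>x. x < e 0 \<Longrightarrow>
      \<bar>poly (band_poly g e) x\<bar> / sqrt (end_prod g e x) < \<bar>poly (band_poly g e') x\<bar> / sqrt (end_prod g e' x)"
  shows False
proof -
  define w where "w e x = \<bar>poly (band_poly g e) x\<bar> / sqrt (end_prod g e x)" for e x
  have prim: "\<exists>G. continuous_on {z. 0 \<le> Im z} G \<and> Re (G (e (2 * g + 1))) = Re (G (e 0)) \<and>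
      ((\<lambda>R. Re (G (of_real R)) - Re (G (of_real (- R)))) \<longlongrightarrow> 0) at_top \<and>
      (\<forall>x>e (2 * g + 1). ((\<lambda>t. Re (G (of_real t))) has_real_derivative w e x) (at x)) \<and>
      (\<forall>x<e 0. ((\<lambda>t. Re (G (of_real t))) has_real_derivative - w e x) (at x))"
    if e: "e \<in> end_tuples g" for e
  proof -
    let ?r = "band_poly g e"
    obtain c where c: "?r = (\<Prod>j<g. [:- c j, 1:])" using band_poly_roots[OF e] by blast
    obtain G where G: "abelian_primitive g e ?r G"
      using abelian_primitive_exists[OF e, of ?r] band_poly_props[OF e] by auto
    have "Re (G (e (Suc k)) - G (e k)) = 0" if k: "k < 2 * g + 1" for k
    proof (cases "even k")
      case True
      then obtain j where j: "k = 2 * j" by blast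
      then show ?thesis using band_increment[OF e G, of j] k by simp
    next
      case False
      then obtain j where "k = 2 * j + 1" by (elim oddE)
      then show ?thesis using gap_increment[OF e G, of j] k by simp
    qed
    then have "Re (\<Sum>k<2 * g + 1. G (e (Suc k)) - G (e k)) = 0" 
      unfolding Re_sum by (intro sum.neutral) simp
    then have 1: "Re (G (e (2 * g + 1))) = Re (G (e 0))"
      by (subst (asm) sum_lessThan_telescope) simp
    have 2: "((\<lambda>R. Re (G (of_real R)) - Re (G (of_real (- R)))) \<longlongrightarrow> 0) at_top"
      using tendsto_Re[OF abelian_primitive_infinity[OF e c G]] by simp
    have der: "((\<lambda>t. Re (\<i> ^ card {y \<in> end_set g e. x < y} * G (of_real t))) has_real_derivative
        poly ?r x / sqrt (end_prod g e x)) (at x)" if "x \<notin> end_set g e" for x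
    proof -
      have "((\<lambda>t. \<i> ^ card {y \<in> end_set g e. x < y} * G (of_real t)) has_vector_derivative
          of_real (poly ?r x / sqrt (end_prod g e x))) (at x)"
        using G that unfolding abelian_primitive_def by blast
      from bounded_linear.has_vector_derivative[OF bounded_linear_Re this]
      show ?thesis by (simp add: has_real_derivative_iff_has_vector_derivative)
    qed
    have 3: "((\<lambda>t. Re (G (of_real t))) has_real_derivative w e x) (at x)" if x: "e (2 * g + 1) < x" for x
    proof -
      have "e i \<le> e (2 * g + 1)" if "i < 2 * g + 2" for i
        using that by (intro end_tuples_le[OF e]) auto
      from this this[of "2 * g"] have "x \<notin> end_set g e" "e (2 * g) \<le> x"
        using x unfolding end_set_def by fastforce+
      then show ?thesis
        using der[of x] card_ends_above_right[OF e x] band_poly_sign[OF e, of g x] by (simp add: w_def)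
    qed
    have 4: "((\<lambda>t. Re (G (of_real t))) has_real_derivative - w e x) (at x)" if x: "x < e 0" for x
    proof -
      have "e 0 \<le> e i" if "i < 2 * g + 2" for i
        using that by (intro end_tuples_le[OF e]) auto
      then have "x \<notin> end_set g e" "x \<le> e 1" using x unfolding end_set_def by fastforce+
      then have d: "((\<lambda>t. Re (\<i> ^ (2 * g + 2) * G (of_real t))) has_real_derivative
          poly ?r x / sqrt (end_prod g e x)) (at x)" and s: "0 < (- 1) ^ g * poly ?r x"
        using der[of x] card_ends_above_left[OF e x] band_poly_sign[OF e, of 0 x] by simp_all
      \<comment> \<open>Left of all ends the phase is \<open>(- 1) ^ (g + 1)\<close> and
        \<open>r\<close> has the sign \<open>(- 1) ^ g\<close>, so the real part of \<open>G\<close>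
        falls towards the first end.\<close>
      have "\<i> ^ (2 * g + 2) = - ((- 1) ^ g)"
        using i_power_even[of "g + 1"] by simp
      then show ?thesis
        using d s DERIV_minus[OF d] by (cases "even g") (simp_all add: w_def)
    qed
    have "continuous_on {z. 0 \<le> Im z} G" using G by (simp add: abelian_primitive_def)
    then show ?thesis using 1 2 3 4 by blast
  qed
  from prim[OF e] obtain G where
    G: "continuous_on {z. 0 \<le> Im z} G" "Re (G (e (2 * g + 1))) = Re (G (e 0))"
      "((\<lambda>R. Re (G (of_real R)) - Re (G (of_real (- R)))) \<longlongrightarrow> 0) at_top"
      "\<And>x. e (2 * g + 1) < x \<Longrightarrow> ((\<lambda>t. Re (G (of_real t))) has_real_derivative w e x) (at x)"
      "\<And>x. x < e 0 \<Longrightarrow> ((\<lambda>t. Re (G (of_real t))) has_real_derivative - w e x) (at x)" by blast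
  from prim[OF e'] obtain G' where
    G': "continuous_on {z. 0 \<le> Im z} G'" "Re (G' (e (2 * g + 1))) = Re (G' (e 0))"
      "((\<lambda>R. Re (G' (of_real R)) - Re (G' (of_real (- R)))) \<longlongrightarrow> 0) at_top"
      "\<And>x. e (2 * g + 1) < x \<Longrightarrow> ((\<lambda>t. Re (G' (of_real t))) has_real_derivative w e' x) (at x)"
      "\<And>x. x < e 0 \<Longrightarrow> ((\<lambda>t. Re (G' (of_real t))) has_real_derivative - w e' x) (at x)"
    unfolding assms(3,4) by blast
  \<comment> \<open>\<open>p\<close> agrees at the two outermost ends and, by the assumed
    dominations, increases along both outer rays. Hence \<open>p R - p (- R)\<close> is positive and
    increasing for large \<open>R\<close>, although it tends to 0.\<close>
  define p where "p t = Re (G (of_real t)) - Re (G' (of_real t))" for t :: real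
  have "continuous_on UNIV (\<lambda>t. Re (H (complex_of_real t)))" if "continuous_on {z. 0 \<le> Im z} H" for H
    by (intro continuous_intros continuous_on_compose2[OF that]) auto
  then have cont: "continuous_on S p" for S
    unfolding p_def using G(1) G'(1) by (intro continuous_on_subset[of UNIV _ S] continuous_on_diff) auto
  have incr_right: "p x < p y" if "e (2 * g + 1) \<le> x" "x < y" for x y
  proof (rule DERIV_pos_imp_increasing_open[OF that(2) _ cont])
    fix t assume "x < t" "t < y"
    then show "\<exists>d. (p has_real_derivative d) (at t) \<and> 0 < d"
      unfolding p_def using DERIV_diff[OF G(4) G'(4), of t] right[of t] that
      by (intro exI[of _ "w e t - w e' t"]) (auto simp: w_def)
  qed
  have incr_left: "p x < p y" if "y \<le> e 0" "x < y" for x y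
  proof (rule DERIV_pos_imp_increasing_open[OF that(2) _ cont])
    fix t assume "x < t" "t < y"
    then show "\<exists>d. (p has_real_derivative d) (at t) \<and> 0 < d"
      unfolding p_def using DERIV_diff[OF G(5) G'(5), of t] left[of t] that
      by (intro exI[of _ "- w e t - - w e' t"]) (auto simp: w_def)
  qed
  define R1 where "R1 = max \<bar>e 0\<bar> \<bar>e (2 * g + 1)\<bar> + 1"
  have "0 < p R1 - p (- R1)"
  proof -
    have "p (e (2 * g + 1)) < p R1" by (rule incr_right) (auto simp: R1_def)
    moreover have "p (- R1) < p (e 0)" by (rule incr_left) (auto simp: R1_def)
    moreover have "p (e (2 * g + 1)) = p (e 0)" using G(2) G'(2) by (simp add: p_def)
    ultimately show ?thesis by simp
  qed
  moreover have "((\<lambda>R. p R - p (- R)) \<longlongrightarrow> 0) at_top"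
    using tendsto_diff[OF G(3) G'(3)] by (simp add: p_def algebra_simps)
  then have "p R1 - p (- R1) \<le> 0"
  proof (rule tendsto_lowerbound)
    show "\<forall>\<^sub>F R in at_top. p R1 - p (- R1) \<le> p R - p (- R)"
      using eventually_gt_at_top[of R1]
    proof eventually_elim
      case (elim R)
      have "p R1 < p R" by (rule incr_right) (use elim in \<open>auto simp: R1_def\<close>)
      moreover have "p (- R) < p (- R1)" by (rule incr_left) (use elim in \<open>auto simp: R1_def\<close>)
      ultimately show ?case by simp
    qed
  qed simp
  ultimately show False by simp
qed

lemma lowered_end_tuple:
  assumes "e \<in> end_tuples g" "1 \<le> i" "i \<le> g" "e (2 * i - 1) < l" "l \<le> e (2 * i)"
  shows "e(2 * i := l) \<in> end_tuples g"
  unfolding end_tuples_def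
proof (intro CollectI allI impI)
  fix k assume k: "k < 2 * g + 1"
  then have lt: "e k < e (Suc k)" using assms(1) by (simp add: end_tuples_def)
  consider "k = 2 * i" | "Suc k = 2 * i" "k = 2 * i - 1" | "k \<noteq> 2 * i" "Suc k \<noteq> 2 * i" by arith
  then show "(e(2 * i := l)) k < (e(2 * i := l)) (Suc k)"
    by cases (use lt assms in auto)
qed

text \<open>Only one factor of f changes, from \<open>x - u\<close> to \<open>x - l\<close>. Off the
  moved band the two densities therefore compare as the sign of
  \<open>N = r\<^sup>2 * (x - l) - s\<^sup>2 * (x - u)\<close> dictates, with \<open>r\<close> and
  \<open>s\<close> the old and the new band polynomial. The roots of \<open>N\<close> are located so
  that \<open>N = Q * (x - y) * L\<close>, where \<open>Q\<close> collects two roots from each gap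
  away from the moved end, \<open>y < l\<close> lies in the moved gap, and \<open>L\<close> has
  degree at most 1. On the other bands \<open>Q\<close> and \<open>L\<close> are positive, so
  \<open>N\<close> has the sign of \<open>x - y\<close> there. This means a smaller new density on
  either side, since \<open>x - l\<close> and \<open>x - u\<close> change sign together with
  it.\<close>

lemma band_measure_decreasing:
  assumes e: "e \<in> end_tuples g" and i: "1 \<le> i" "i \<le> g" and l: "e (2 * i - 1) < l" "l < e (2 * i)"
    and j: "j \<le> g" "j \<noteq> i"
  shows "band_measure g (e(2 * i := l)) j < band_measure g e j"
proof -
  define e' where "e' = e(2 * i := l)"
  define u where "u = e (2 * i)"
  define r where "r = band_poly g e"
  define s where "s = band_poly g e'"
  have e': "e' \<in> end_tuples g" unfolding e'_def using assms by (intro lowered_end_tuple) auto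
  have lu: "l < u" using l by (simp add: u_def)
  have e'_eq: "e' k = (if k = 2 * i then l else e k)" for k by (simp add: e'_def)
  define A where "A k x = (\<Prod>m\<in>{..<2 * g + 2} - {k, Suc k} - {2 * i}. \<bar>x - e m\<bar>)" for k x
  have rest: "rest g e k x = A k x * \<bar>x - u\<bar>" "rest g e' k x = A k x * \<bar>x - l\<bar>"
    if "k \<noteq> 2 * i" "Suc k \<noteq> 2 * i" for k x
  proof -
    have mem: "2 * i \<in> {..<2 * g + 2} - {k, Suc k}" using that i by auto
    show "rest g e k x = A k x * \<bar>x - u\<bar>"
      unfolding rest_def A_def u_def by (subst prod.remove[OF _ mem]) (simp_all add: mult.commute)
    show "rest g e' k x = A k x * \<bar>x - l\<bar>"
      unfolding rest_def A_def u_def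
      by (subst prod.remove[OF _ mem]) (auto simp: mult.commute e'_eq intro!: prod.cong)
  qed
  have A_nonneg: "0 \<le> A k x" for k x unfolding A_def by (intro prod_nonneg) auto
  define N where "N = r\<^sup>2 * [:- l, 1:] - s\<^sup>2 * [:- u, 1:]"
  have N: "poly N x = (poly r x)\<^sup>2 * (x - l) - (poly s x)\<^sup>2 * (x - u)" for x
    by (simp add: N_def algebra_simps)
  have deg: "degree r = g" "lead_coeff r = 1" "degree s = g" "lead_coeff s = 1"
    using band_poly_props[OF e] band_poly_props[OF e'] by (auto simp: r_def s_def)
  \<comment> \<open>Both products are monic of degree \<open>2 * g + 1\<close>, so their leading
    terms cancel.\<close>
  have degN: "degree N \<le> 2 * g"
  proof -
    have d: "degree (p\<^sup>2 * [:- a, 1:]) = 2 * g + 1" "lead_coeff (p\<^sup>2 * [:- a, 1:]) = 1"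
      if "degree p = g" "lead_coeff p = 1" for p and a :: real
    proof -
      have "p \<noteq> 0" using that by auto
      then show "degree (p\<^sup>2 * [:- a, 1:]) = 2 * g + 1"
        using that by (simp add: degree_mult_eq degree_power_eq del: mult_pCons_right)
      show "lead_coeff (p\<^sup>2 * [:- a, 1:]) = 1"
        using that by (simp add: lead_coeff_mult lead_coeff_power del: mult_pCons_right)
    qed
    have "poly.coeff N k = 0" if "2 * g < k" for k
    proof (cases "k = 2 * g + 1")
      case True
      then show ?thesis using d[OF deg(1,2), of l] d[OF deg(3,4), of u] by (simp add: N_def)
    next
      case False
      then show ?thesis
        using that d(1)[OF deg(1,2), of l] d(1)[OF deg(3,4), of u]
          coeff_eq_0[of "r\<^sup>2 * [:- l, 1:]" k] coeff_eq_0[of "s\<^sup>2 * [:- u, 1:]" k]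
        by (simp add: N_def del: mult_pCons_right)
    qed
    then show ?thesis by (intro degree_le) auto
  qed
  have outside: "k < 2 * g + 1 \<Longrightarrow> k \<noteq> 2 * i \<Longrightarrow> Suc k \<noteq> 2 * i \<Longrightarrow> e k \<le> x \<Longrightarrow> x \<le> e (Suc k) \<Longrightarrow>
      (if Suc k < 2 * i then x < l else u < x)" for k x
  proof -
    assume k: "k < 2 * g + 1" "k \<noteq> 2 * i" "Suc k \<noteq> 2 * i" "e k \<le> x" "x \<le> e (Suc k)"
    show ?thesis
    proof (cases "Suc k < 2 * i")
      case True
      then have "e (Suc k) \<le> e (2 * i - 1)" using i by (intro end_tuples_le[OF e]) auto
      then show ?thesis using True k l by auto
    next
      case False
      then have "e (2 * i) < e k" using i k by (intro end_tuples_less[OF e]) auto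
      then show ?thesis using False k by (simp add: u_def)
    qed
  qed
  \<comment> \<open>Both densities have integral 0 over this gap, hence so has the first minus
    \<open>\<sigma>\<close> times the second, which must vanish somewhere. The choices
    \<open>\<sigma> = 1\<close> and \<open>\<sigma> = - 1\<close> provide two roots of
    \<open>N\<close>.\<close>
  have gap_root: "\<exists>x. e (2 * m + 1) < x \<and> x < e (2 * m + 2) \<and>
      poly r x * sqrt \<bar>x - l\<bar> = \<sigma> * (poly s x * sqrt \<bar>x - u\<bar>)"
    if m: "m < g" "m \<noteq> i - 1" for m \<sigma>
  proof -
    let ?k = "2 * m + 1"
    have k: "?k < 2 * g + 1" "?k \<noteq> 2 * i" "Suc ?k \<noteq> 2 * i" using m i by arith+
    have ends: "e' ?k = e ?k" "e' (Suc ?k) = e (Suc ?k)" using k by (auto simp: e'_eq)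
    have less: "e ?k < e (Suc ?k)" using e k by (auto simp: end_tuples_def)
    let ?h = "\<lambda>x. poly r x / sqrt (rest g e ?k x)" and ?h' = "\<lambda>x. poly s x / sqrt (rest g e' ?k x)"
    have c: "continuous_on {e ?k..e (Suc ?k)} ?h" "continuous_on {e ?k..e (Suc ?k)} ?h'"
      using period_integrand_continuous[OF e k(1), of r] period_integrand_continuous[OF e' k(1), of s]
      unfolding ends by auto
    have "cheb_int (e ?k) (e (Suc ?k)) (\<lambda>x. ?h x - \<sigma> * ?h' x) = period g e ?k r - \<sigma> * period g e' ?k s"
      using cheb_int_diff[OF less_imp_le[OF less] c(1) continuous_on_mult_left[OF c(2), of \<sigma>]]
      unfolding period_def ends cheb_int_cmult .
    also have "\<dots> = 0"
      using band_poly_props(3)[OF e m(1)] band_poly_props(3)[OF e' m(1)] by (simp add: r_def s_def)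
    finally obtain x where x: "e ?k < x" "x < e (Suc ?k)" "?h x - \<sigma> * ?h' x = 0"
      using cheb_int_root[OF less continuous_on_diff[OF c(1) continuous_on_mult_left[OF c(2), of \<sigma>]]]
      by blast
    have pos: "0 < rest g e ?k x" "0 < rest g e' ?k x"
      using rest_pos[OF e k(1)] rest_pos[OF e' k(1)] x unfolding ends by auto
    then have pA: "0 < sqrt (A ?k x)" "0 < sqrt \<bar>x - u\<bar>" "0 < sqrt \<bar>x - l\<bar>"
      using A_nonneg[of ?k x] unfolding rest[OF k(2,3)] by (auto simp: zero_less_mult_iff)
    have "poly r x / (sqrt (A ?k x) * sqrt \<bar>x - u\<bar>) = \<sigma> * poly s x / (sqrt (A ?k x) * sqrt \<bar>x - l\<bar>)"
      using x(3) unfolding rest[OF k(2,3)] real_sqrt_mult by simp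
    then have "poly r x * sqrt \<bar>x - l\<bar> = \<sigma> * (poly s x * sqrt \<bar>x - u\<bar>)"
      using pA by (simp add: field_simps)
    then show ?thesis using x by auto
  qed
  have quad: "\<exists>a b. e (2 * m + 1) < a \<and> a < e (2 * m + 2) \<and> e (2 * m + 1) < b \<and> b < e (2 * m + 2) \<and>
      [:- a, 1:] * [:- b, 1:] dvd N" if m: "m < g" "m \<noteq> i - 1" for m
  proof -
    obtain a where a: "e (2 * m + 1) < a" "a < e (2 * m + 2)"
      "poly r a * sqrt \<bar>a - l\<bar> = 1 * (poly s a * sqrt \<bar>a - u\<bar>)" using gap_root[OF m] by blast
    obtain b where b: "e (2 * m + 1) < b" "b < e (2 * m + 2)"
      "poly r b * sqrt \<bar>b - l\<bar> = - 1 * (poly s b * sqrt \<bar>b - u\<bar>)" using gap_root[OF m] by blast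
    have side: "(x < l \<and> x < u) \<or> (l < x \<and> u < x)" if "e (2 * m + 1) < x" "x < e (2 * m + 2)" for x
    proof -
      have "2 * m + 1 \<noteq> 2 * i" "Suc (2 * m + 1) \<noteq> 2 * i" using m i by arith+
      then show ?thesis using outside[of "2 * m + 1" x] that m lu by (auto split: if_splits)
    qed
    have root: "poly N x = 0" if x: "e (2 * m + 1) < x" "x < e (2 * m + 2)"
      and eq: "(poly r x * sqrt \<bar>x - l\<bar>)\<^sup>2 = (poly s x * sqrt \<bar>x - u\<bar>)\<^sup>2" for x
    proof -
      have "(poly r x)\<^sup>2 * \<bar>x - l\<bar> = (poly s x)\<^sup>2 * \<bar>x - u\<bar>"
        using eq by (simp add: power_mult_distrib)
      then show ?thesis using side[OF x] by (auto simp: N algebra_simps)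
    qed
    have "poly N a = 0" by (rule root[OF a(1,2)]) (simp only: a(3) mult_1_left)
    moreover have "poly N b = 0" by (rule root[OF b(1,2)]) (simp only: b(3) power2_minus mult_minus1)
    ultimately have dvd: "[:- a, 1:] dvd N" "[:- b, 1:] dvd N" by (simp_all add: poly_eq_0_iff_dvd)
    have "[:- a, 1:] * [:- b, 1:] dvd N"
    proof (cases "a = b")
      case False
      then show ?thesis using dvd by (intro semiring_gcd_class.divides_mult coprime_linear)
    next
      \<comment> \<open>Both signs at one point force \<open>r\<close> and \<open>s\<close> to
        vanish there, so the point is a double root of \<open>N\<close>.\<close>
      case True
      have "poly r a = 0" "poly s a = 0" using a b side[OF a(1,2)] unfolding True by auto
      then have "[:- a, 1:] dvd r" "[:- a, 1:] dvd s" by (simp_all add: poly_eq_0_iff_dvd)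
      then have "[:- a, 1:]\<^sup>2 dvd r\<^sup>2" "[:- a, 1:]\<^sup>2 dvd s\<^sup>2" by (auto intro: dvd_power_same)
      then have "[:- a, 1:]\<^sup>2 dvd N" unfolding N_def by (intro dvd_diff dvd_mult2)
      then show ?thesis unfolding True[symmetric] power2_eq_square .
    qed
    then show ?thesis using a b by blast
  qed
  then have "\<forall>m\<in>{..<g} - {i - 1}. \<exists>a b. e (2 * m + 1) < a \<and> a < e (2 * m + 2) \<and>
      e (2 * m + 1) < b \<and> b < e (2 * m + 2) \<and> [:- a, 1:] * [:- b, 1:] dvd N" by auto
  then obtain a b where ab: "\<And>m. m \<in> {..<g} - {i - 1} \<Longrightarrow> e (2 * m + 1) < a m \<and> a m < e (2 * m + 2) \<and>
      e (2 * m + 1) < b m \<and> b m < e (2 * m + 2) \<and> [:- a m, 1:] * [:- b m, 1:] dvd N"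
    unfolding bchoice_iff by metis
  define Q where "Q = (\<Prod>m\<in>{..<g} - {i - 1}. [:- a m, 1:] * [:- b m, 1:])"
  have "Q dvd N"
  proof -
    have "(\<Prod>m\<in>M. [:- a m, 1:] * [:- b m, 1:]) dvd N" if "M \<subseteq> {..<g} - {i - 1}" for M
      using finite_subset[OF that finite_Diff[OF finite_lessThan]] that
    proof (induction M rule: finite_induct)
      case (insert m M)
      have "coprime ([:- a m, 1:] * [:- b m, 1:]) (\<Prod>m\<in>M. [:- a m, 1:] * [:- b m, 1:])"
      proof (rule prod_coprime_right)
        fix m' assume m': "m' \<in> M"
        have "m < m' \<or> m' < m" using m' insert by auto
        moreover have "e (2 * x + 2) \<le> e (2 * y + 1)" if "x < y" "y < g" for x y
          using that by (intro end_tuples_le[OF e]) auto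
        ultimately have "{a m, b m} \<inter> {a m', b m'} = {}"
          using ab[of m] ab[of m'] m' insert.prems by fastforce
        then show "coprime ([:- a m, 1:] * [:- b m, 1:]) ([:- a m', 1:] * [:- b m', 1:])"
          by (auto simp: coprime_mult_left_iff coprime_mult_right_iff simp del: mult_pCons_right mult_pCons_left
              intro!: coprime_linear)
      qed
      then show ?case
        using insert ab[of m] by (auto simp: simp del: mult_pCons_right mult_pCons_left intro!: semiring_gcd_class.divides_mult)
    qed simp
    then show ?thesis unfolding Q_def by blast
  qed
  then obtain M where M: "N = Q * M" by blast
  have Q_pos: "0 < poly Q x" if x: "\<And>m. m \<in> {..<g} - {i - 1} \<Longrightarrow> x \<le> e (2 * m + 1) \<or> e (2 * m + 2) \<le> x" for x
    unfolding Q_def poly_prod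
  proof (rule prod_pos)
    fix m assume m: "m \<in> {..<g} - {i - 1}"
    have "(x < a m \<and> x < b m) \<or> (a m < x \<and> b m < x)" using x[OF m] ab[OF m] by auto
    then have "0 < (x - a m) * (x - b m)" by (auto simp: zero_less_mult_iff)
    then show "0 < poly ([:- a m, 1:] * [:- b m, 1:]) x"
      by (simp add: algebra_simps)
  qed
  have N_eq: "poly N x = poly Q x * poly M x" for x by (simp add: M)
  have "0 < (- 1) ^ (g - i) * poly s l" "0 < (- 1) ^ (g - i) * poly r u"
    using band_poly_sign[OF e', of i l] band_poly_sign[OF e, of i u] i lu
      end_tuples_less[OF e, of "2 * i" "2 * i + 1"] unfolding r_def s_def by (auto simp: e'_eq u_def)
  then have "poly s l \<noteq> 0" "poly r u \<noteq> 0" by auto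
  then have N_lu: "0 < poly N l" "0 < poly N u" using lu by (simp_all add: N mult_pos_neg)
  have "period g e' (2 * (i - 1) + 1) s = 0" unfolding s_def by (rule band_poly_props(3)[OF e']) (use i in simp)
  moreover have k: "2 * (i - 1) + 1 = 2 * i - 1" "Suc (2 * i - 1) = 2 * i" "2 * i - 1 \<noteq> 2 * i" using i by simp_all
  ultimately have per: "period g e' (2 * i - 1) s = 0" by (simp only:)
  \<comment> \<open>In the shortened gap the normalization of \<open>s\<close> yields a zero
    \<open>x0 < l\<close>, where \<open>N\<close> is at most 0. As \<open>N\<close> equals
    \<open>s\<^sup>2 * (u - l) > 0\<close> at \<open>l\<close>, it has a root \<open>y\<close> in
    between.\<close>
  obtain x0 where x0: "e (2 * i - 1) < x0" "x0 < l" "poly s x0 = 0"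
  proof (rule period_root[OF e' _ per])
    fix x assume "e' (2 * i - 1) < x" "x < e' (Suc (2 * i - 1))" "poly s x = 0"
    then show thesis by (intro that[of x]) (simp_all only: k e'_eq if_True if_False refl)
  qed (use i in simp)
  have "poly N x0 \<le> 0" using x0 by (simp add: N mult_nonneg_nonpos)
  then obtain y where y: "x0 \<le> y" "y < l" "poly N y = 0"
    using poly_IVT_pos[OF x0(2), of N] N_lu x0(2) by (metis less_eq_real_def)
  have near: "0 < poly Q x" if "e (2 * i - 1) \<le> x" "x \<le> u" for x
  proof (rule Q_pos)
    fix m assume m: "m \<in> {..<g} - {i - 1}"
    show "x \<le> e (2 * m + 1) \<or> e (2 * m + 2) \<le> x"
    proof (cases "m < i - 1")
      case True
      then have "e (2 * m + 2) \<le> e (2 * i - 1)" using i by (intro end_tuples_le[OF e]) auto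
      then show ?thesis using that by simp
    next
      case False
      then have "e (2 * i) \<le> e (2 * m + 1)" using m i by (intro end_tuples_le[OF e]) auto
      then show ?thesis using that by (simp add: u_def)
    qed
  qed
  have "poly M y = 0" using y(3) near[of y] x0 y lu by (auto simp: N_eq)
  then obtain L where L: "M = [:- y, 1:] * L" by (auto simp: poly_eq_0_iff_dvd)
  \<comment> \<open>\<open>2 * g\<close> bounds the degree of \<open>N\<close>;
    \<open>2 * (g - 1)\<close> is used up by \<open>Q\<close> and 1 by \<open>y\<close>.\<close>
  have "degree L \<le> 1"
  proof -
    have "N \<noteq> 0" using N_lu by auto
    then have nz: "Q \<noteq> 0" "L \<noteq> 0" by (auto simp: M L)
    have "degree Q = (\<Sum>m\<in>{..<g} - {i - 1}. degree ([:- a m, 1:] * [:- b m, 1:]))"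
      unfolding Q_def by (rule degree_prod_eq_sum_degree) (auto simp del: mult_pCons_right mult_pCons_left)
    also have "\<dots> = 2 * (g - 1)" using i by (simp add: degree_mult_eq del: mult_pCons_right mult_pCons_left)
    finally have "degree N = 2 * (g - 1) + 1 + degree L"
      using nz unfolding M L by (simp add: degree_mult_eq del: mult_pCons_right mult_pCons_left)
    then show ?thesis using degN i by simp
  qed
  then have L_eq: "L = [:poly.coeff L 0, poly.coeff L 1:]"
    by (intro poly_eqI) (auto simp: coeff_pCons coeff_eq_0 split: nat.split)
  define \<alpha> \<beta> where "\<alpha> = poly.coeff L 0" and "\<beta> = poly.coeff L 1"
  have pL: "poly L x = \<alpha> + \<beta> * x" for x by (subst L_eq) (simp add: \<alpha>_def \<beta>_def)
  have N_fact: "poly N x = poly Q x * ((x - y) * (\<alpha> + \<beta> * x))" for x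
    unfolding N_eq L by (simp add: pL algebra_simps)
  have Ll: "0 < \<alpha> + \<beta> * l"
  proof -
    have "0 < poly Q l * ((l - y) * (\<alpha> + \<beta> * l))" using N_lu N_fact by simp
    then show ?thesis using near[of l] y l lu by (simp add: zero_less_mult_iff)
  qed
  define B where "B x = (\<Prod>m\<in>{..<2 * g + 2} - {2 * i}. \<bar>x - e m\<bar>)" for x
  have B: "end_prod g e x = B x * \<bar>x - u\<bar>" "end_prod g e' x = B x * \<bar>x - l\<bar>" for x
  proof -
    have mem: "2 * i \<in> {..<2 * g + 2}" using i by auto
    show "end_prod g e x = B x * \<bar>x - u\<bar>"
      unfolding end_prod_def B_def u_def by (subst prod.remove[OF _ mem]) (simp_all add: mult.commute)
    show "end_prod g e' x = B x * \<bar>x - l\<bar>"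
      unfolding end_prod_def B_def u_def
      by (subst prod.remove[OF _ mem]) (auto simp: mult.commute e'_eq intro!: prod.cong)
  qed
  have first_last: "e' 0 = e 0" "e' (2 * g + 1) = e (2 * g + 1)" using i by (auto simp: e'_eq)
  have e_lu: "e 0 < l" "u < e (2 * g + 1)" "e 0 < y" "y < e (2 * g + 1)"
  proof -
    have "e 0 \<le> e (2 * i - 1)" by (rule end_tuples_le[OF e]) (use i in auto)
    moreover have "u < e (2 * g + 1)" unfolding u_def by (rule end_tuples_less[OF e]) (use i in auto)
    ultimately show "e 0 < l" "u < e (2 * g + 1)" "e 0 < y" "y < e (2 * g + 1)"
      using l(1) x0 y lu by linarith+
  qed
  have far: "0 < poly Q x" "0 < B x" if "x < e 0 \<or> e (2 * g + 1) < x" for x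
  proof -
    have *: "e 0 \<le> e m" "e m \<le> e (2 * g + 1)" if "m < 2 * g + 2" for m
      using that end_tuples_le[OF e, of 0 m] end_tuples_le[OF e, of m "2 * g + 1"] by auto
    show "0 < poly Q x"
    proof (rule Q_pos)
      fix m assume "m \<in> {..<g} - {i - 1}"
      then have "e 0 \<le> e (2 * m + 1)" "e (2 * m + 2) \<le> e (2 * g + 1)" by (intro *; simp)+
      then show "x \<le> e (2 * m + 1) \<or> e (2 * m + 2) \<le> x" using that by linarith
    qed
    show "0 < B x"
      unfolding B_def
    proof (rule prod_pos)
      fix m assume "m \<in> {..<2 * g + 2} - {2 * i}"
      then have "e 0 \<le> e m" "e m \<le> e (2 * g + 1)" by (intro *; simp)+
      then show "0 < \<bar>x - e m\<bar>" using that by linarith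
    qed
  qed
  \<comment> \<open>The linear factor is positive at \<open>l\<close>. If it failed to be positive
    between the outermost ends, it would have opposite signs on the two outer rays, as
    \<open>x - y\<close> has, so \<open>N\<close> would have equal signs there. Since
    \<open>x - l\<close> and \<open>x - u\<close> are negative on the left ray, equal signs of
    \<open>N\<close> mean that one density dominates on the right and the other on the left, which
    is impossible.\<close>
  have L_pos: "0 < \<alpha> + \<beta> * x" if x: "e 0 \<le> x" "x \<le> e (2 * g + 1)" for x
  proof (rule ccontr)
    assume neg: "\<not> 0 < \<alpha> + \<beta> * x"
    show False
    proof (cases "l < x")
      case True
      have "\<beta> * (x - l) < 0" using neg Ll by (simp add: algebra_simps)
      then have \<beta>: "\<beta> < 0" using True by (simp add: mult_less_0_iff)
      have Nr: "poly N t < 0" if "e (2 * g + 1) < t" for t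
      proof -
        have "\<alpha> + \<beta> * t < 0" using neg mult_strict_left_mono_neg[OF order.strict_trans1[OF x(2) that] \<beta>] by linarith
        then show ?thesis using far[of t] that e_lu by (simp add: N_fact mult_pos_neg)
      qed
      have Nl: "poly N t < 0" if "t < e 0" for t
      proof -
        have "0 < \<alpha> + \<beta> * t" using Ll mult_strict_left_mono_neg[OF order.strict_trans[OF that e_lu(1)] \<beta>] by linarith
        then show ?thesis using far[of t] that e_lu by (simp add: N_fact mult_pos_neg mult_neg_pos)
      qed
      show False
      proof (rule no_domination_at_infinity[OF e' e])
        fix t assume t: "e' (2 * g + 1) < t"
        show "\<bar>poly (band_poly g e) t\<bar> / sqrt (end_prod g e t) < \<bar>poly (band_poly g e') t\<bar> / sqrt (end_prod g e' t)"
          unfolding B r_def[symmetric] s_def[symmetric]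
          using Nr[of t] t first_last e_lu lu far[of t] by (intro sqrt_quotient_less) (auto simp: N)
      next
        fix t assume t: "t < e' 0"
        show "\<bar>poly (band_poly g e') t\<bar> / sqrt (end_prod g e' t) < \<bar>poly (band_poly g e) t\<bar> / sqrt (end_prod g e t)"
          unfolding B r_def[symmetric] s_def[symmetric]
          using Nl[of t] t first_last e_lu lu far[of t] by (intro sqrt_quotient_less) (auto simp: N algebra_simps)
      qed (rule first_last[symmetric])+
    next
      case False
      then have xl: "x < l" using neg Ll by (cases "x = l") auto
      have "0 < \<beta> * (l - x)" using neg Ll by (simp add: algebra_simps)
      then have \<beta>: "0 < \<beta>" using xl by (simp add: zero_less_mult_iff)
      have Nr: "0 < poly N t" if "e (2 * g + 1) < t" for t
      proof -
        have "0 < \<alpha> + \<beta> * t" using Ll mult_strict_left_mono[OF order.strict_trans[OF order.strict_trans[OF lu e_lu(2)] that] \<beta>] by linarith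
        then show ?thesis using far[of t] that e_lu by (simp add: N_fact)
      qed
      have Nl: "0 < poly N t" if "t < e 0" for t
      proof -
        have "\<alpha> + \<beta> * t < 0" using neg mult_strict_left_mono[OF order.strict_trans2[OF that x(1)] \<beta>] by linarith
        then show ?thesis using far[of t] that e_lu by (simp add: N_fact mult_neg_neg)
      qed
      show False
      proof (rule no_domination_at_infinity[OF e e' first_last])
        fix t assume t: "e (2 * g + 1) < t"
        show "\<bar>poly (band_poly g e') t\<bar> / sqrt (end_prod g e' t) < \<bar>poly (band_poly g e) t\<bar> / sqrt (end_prod g e t)"
          unfolding B r_def[symmetric] s_def[symmetric]
          using Nr[of t] t e_lu lu far[of t] by (intro sqrt_quotient_less) (auto simp: N)
      next
        fix t assume t: "t < e 0"
        show "\<bar>poly (band_poly g e) t\<bar> / sqrt (end_prod g e t) < \<bar>poly (band_poly g e') t\<bar> / sqrt (end_prod g e' t)"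
          unfolding B r_def[symmetric] s_def[symmetric]
          using Nl[of t] t e_lu lu far[of t] by (intro sqrt_quotient_less) (auto simp: N algebra_simps)
      qed
    qed
  qed
  have k: "2 * j < 2 * g + 1" "2 * j \<noteq> 2 * i" "Suc (2 * j) \<noteq> 2 * i" using j by (simp, simp, presburger)
  have less: "e (2 * j) < e (Suc (2 * j))" using e k by (auto simp: end_tuples_def)
  have ends: "e' (2 * j) = e (2 * j)" "e' (Suc (2 * j)) = e (Suc (2 * j))" using k by (auto simp: e'_eq)
  have key: "(poly s x)\<^sup>2 * \<bar>x - u\<bar> < (poly r x)\<^sup>2 * \<bar>x - l\<bar>"
    if x: "e (2 * j) < x" "x < e (Suc (2 * j))" for x
  proof -
    have "0 < poly Q x"
    proof (rule Q_pos)
      fix m assume m: "m \<in> {..<g} - {i - 1}"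
      show "x \<le> e (2 * m + 1) \<or> e (2 * m + 2) \<le> x"
      proof (cases "m < j")
        case True
        then have "e (2 * m + 2) \<le> e (2 * j)" using j by (intro end_tuples_le[OF e]) auto
        then show ?thesis using x by simp
      next
        case False
        then have "e (Suc (2 * j)) \<le> e (2 * m + 1)" using m by (intro end_tuples_le[OF e]) auto
        then show ?thesis using x by simp
      qed
    qed
    moreover have "0 < \<alpha> + \<beta> * x"
      using x end_tuples_le[OF e, of 0 "2 * j"] end_tuples_le[OF e, of "Suc (2 * j)" "2 * g + 1"] j
      by (intro L_pos) auto
    ultimately have NQ: "0 < poly Q x * (\<alpha> + \<beta> * x)" "poly N x = poly Q x * (\<alpha> + \<beta> * x) * (x - y)"
      by (simp_all add: N_fact)
    show ?thesis
    proof (cases "i < j")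
      case True
      then have "e (2 * i) < e (2 * j)" using j by (intro end_tuples_less[OF e]) auto
      then have "u < x" "y < x" using x y lu by (auto simp: u_def)
      then have "0 < poly N x" using NQ by simp
      then show ?thesis using \<open>u < x\<close> lu by (simp add: N)
    next
      case False
      then have "e (Suc (2 * j)) \<le> e (2 * i - 1)" using j i by (intro end_tuples_le[OF e]) auto
      then have "x < y" "x < l" using x x0 y by auto
      then have "poly N x < 0" using NQ by (simp add: mult_pos_neg)
      then show ?thesis using \<open>x < l\<close> lu by (simp add: N algebra_simps)
    qed
  qed
  have "cheb_int (e (2 * j)) (e (Suc (2 * j))) (\<lambda>x. \<bar>poly s x\<bar> / sqrt (rest g e' (2 * j) x))
      < cheb_int (e (2 * j)) (e (Suc (2 * j))) (\<lambda>x. \<bar>poly r x\<bar> / sqrt (rest g e (2 * j) x))"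
  proof (rule cheb_int_less[OF less])
    have "rest g e (2 * j) x \<noteq> 0" "rest g e' (2 * j) x \<noteq> 0"
      if "x \<in> {e (2 * j)..e (Suc (2 * j))}" for x
      using rest_pos[OF e k(1), of x] rest_pos[OF e' k(1), of x] that ends by auto
    then show "continuous_on {e (2 * j)..e (Suc (2 * j))} (\<lambda>x. \<bar>poly s x\<bar> / sqrt (rest g e' (2 * j) x))"
      "continuous_on {e (2 * j)..e (Suc (2 * j))} (\<lambda>x. \<bar>poly r x\<bar> / sqrt (rest g e (2 * j) x))"
      by (auto intro!: continuous_on_divide continuous_on_rabs continuous_on_real_sqrt continuous_on_rest
          continuous_on_poly continuous_on_id)
    fix x assume x: "e (2 * j) < x" "x < e (Suc (2 * j))"
    have "0 < A (2 * j) x" "0 < \<bar>x - u\<bar>" "0 < \<bar>x - l\<bar>"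
      using rest_pos[OF e k(1), of x] rest_pos[OF e' k(1), of x] x ends A_nonneg[of "2 * j" x]
      unfolding rest[OF k(2,3)] by (auto simp: zero_less_mult_iff)
    then show "\<bar>poly s x\<bar> / sqrt (rest g e' (2 * j) x) < \<bar>poly r x\<bar> / sqrt (rest g e (2 * j) x)"
      unfolding rest[OF k(2,3)] using key[OF x] by (intro sqrt_quotient_less)
  qed
  then have "band_measure g e' j < band_measure g e j"
    unfolding band_measure_eq[OF e j(1)] band_measure_eq[OF e' j(1)] r_def s_def Suc_eq_plus1 ends[unfolded Suc_eq_plus1]
    by (simp add: divide_strict_right_mono)
  then show ?thesis by (simp add: e'_def)
qed

section \<open>Rational band measures\<close>

text \<open>The ends are lowered one at a time through the hybrids \<open>h m\<close>, which take
  \<open>e'\<close> up to index \<open>2 * m\<close> and \<open>e\<close> beyond. Band 0 is singled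
  out because its own left end never moves, so every single step decreases its measure or leaves it
  unchanged.\<close>

lemma band_measure_mono:
  assumes e: "e \<in> end_tuples g" and e': "\<And>i. 1 \<le> i \<Longrightarrow> i \<le> g \<Longrightarrow> e (2 * i - 1) < e' (2 * i) \<and> e' (2 * i) \<le> e (2 * i)"
    and same: "\<And>k. k \<notin> (*) 2 ` {1..g} \<Longrightarrow> e' k = e k"
  shows "e' \<in> end_tuples g" "band_measure g e' 0 \<le> band_measure g e 0"
proof -
  define h where "h m k = (if k \<le> 2 * m then e' k else e k)" for m k :: nat
  have "m \<le> g \<Longrightarrow> h m \<in> end_tuples g \<and> band_measure g (h m) 0 \<le> band_measure g e 0" for m
  proof (induction m)
    case 0
    have "0 \<notin> (*) 2 ` {1..g}" by auto
    then have "h 0 = e" using same[of 0] by (auto simp: h_def fun_eq_iff)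
    then show ?case using e by simp
  next
    case (Suc m)
    then have IH: "h m \<in> end_tuples g" "band_measure g (h m) 0 \<le> band_measure g e 0" by auto
    have eq: "h (Suc m) = (h m)(2 * Suc m := e' (2 * Suc m))"
    proof
      fix k
      have "k = 2 * m + 1 \<Longrightarrow> k \<notin> (*) 2 ` {1..g}" by auto presburger
      then show "h (Suc m) k = ((h m)(2 * Suc m := e' (2 * Suc m))) k"
        using same[of k] by (cases "k = 2 * m + 1"; cases "k = 2 * m + 2"; cases "k \<le> 2 * m") (auto simp: h_def)
    qed
    have b: "h m (2 * Suc m - 1) < e' (2 * Suc m)" "e' (2 * Suc m) \<le> h m (2 * Suc m)"
      using e'[of "Suc m"] Suc.prems by (auto simp: h_def)
    have "h (Suc m) \<in> end_tuples g"
      unfolding eq using IH(1) b Suc.prems by (intro lowered_end_tuple) auto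
    moreover have "band_measure g (h (Suc m)) 0 \<le> band_measure g (h m) 0"
    proof (cases "e' (2 * Suc m) = h m (2 * Suc m)")
      case True
      then show ?thesis unfolding eq by (simp only: fun_upd_triv)
    next
      case False
      then show ?thesis unfolding eq
        using band_measure_decreasing[OF IH(1), of "Suc m" "e' (2 * Suc m)" 0] b Suc.prems by simp
    qed
    ultimately show ?case using IH by simp
  qed
  moreover have "h g = e'"
  proof
    fix k
    have "\<not> k \<le> 2 * g \<Longrightarrow> k \<notin> (*) 2 ` {1..g}" by auto
    then show "h g k = e' k" using same[of k] by (auto simp: h_def)
  qed
  ultimately show "e' \<in> end_tuples g" "band_measure g e' 0 \<le> band_measure g e 0" by (metis order.refl)+
qed

text \<open>The tuple is found by minimizing the sum of the left ends subject to \<open>band_measure g e' j \<le> q j\<close>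
  with rational bounds \<open>q j\<close> slightly above the given measures: by monotonicity a
  minimizer in the interior of the box must attain all the bounds.\<close>

lemma rational_band_measures_dense:
  assumes g: "0 < g" and e: "e \<in> end_tuples g" and "0 < \<epsilon>0"
  obtains e' where "e' \<in> end_tuples g" "\<And>k. \<bar>e' k - e k\<bar> \<le> \<epsilon>0" "\<And>k. k \<notin> (*) 2 ` {1..g} \<Longrightarrow> e' k = e k"
    "\<And>j. j \<le> g \<Longrightarrow> band_measure g e' j \<in> \<rat>"
proof -
  \<comment> \<open>At most half of every gap, so that all left ends may drop by
    \<open>\<epsilon>\<close> at once without meeting the preceding right end.\<close>
  define \<epsilon> where "\<epsilon> = Min (insert \<epsilon>0 ((\<lambda>i. (e (2 * i) - e (2 * i - 1)) / 2) ` {1..g}))"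
  have lt: "e (2 * i - 1) < e (2 * i)" if "i \<in> {1..g}" for i
    using that by (intro end_tuples_less[OF e]) auto
  have \<epsilon>: "0 < \<epsilon>" "\<epsilon> \<le> \<epsilon>0"
    unfolding \<epsilon>_def using \<open>0 < \<epsilon>0\<close> lt by (subst Min_gr_iff) auto
  have \<epsilon>_small: "e (2 * i - 1) < e (2 * i) - \<epsilon>" if "i \<in> {1..g}" for i
  proof -
    have "\<epsilon> \<le> (e (2 * i) - e (2 * i - 1)) / 2" unfolding \<epsilon>_def using that by (intro Min_le) auto
    then show ?thesis using lt[OF that] \<open>0 < \<epsilon>\<close> by (simp add: field_simps)
  qed
  let ?I = "(*) 2 ` {1..g}"
  \<comment> \<open>A box in the full space of sequences: the coordinates that must not move get
    one-point intervals, and the product is compact by Tychonoff.\<close>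
  define S where "S k = {e k - (if k \<in> ?I then \<epsilon> else 0)..e k}" for k
  define K where "K = Pi\<^sub>E UNIV S"
  have K: "e' \<in> K \<longleftrightarrow> (\<forall>k. e' k \<in> S k)" for e' by (auto simp: K_def PiE_iff)
  have K_ends: "e' \<in> end_tuples g" "\<And>k. k \<notin> ?I \<Longrightarrow> e' k = e k" if "e' \<in> K" for e'
  proof -
    show same: "e' k = e k" if "k \<notin> ?I" for k
    proof -
      have "e' k \<in> S k" using \<open>e' \<in> K\<close> K by blast
      then show ?thesis unfolding S_def if_not_P[OF that] by simp
    qed
    show "e' \<in> end_tuples g"
    proof (rule band_measure_mono(1)[OF e _ same])
      fix i assume i: "1 \<le> i" "i \<le> g"
      then have "2 * i \<in> ?I" by auto
      moreover have "e' (2 * i) \<in> S (2 * i)" using \<open>e' \<in> K\<close> K by blast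
      ultimately have "e' (2 * i) \<in> {e (2 * i) - \<epsilon>..e (2 * i)}" unfolding S_def by (simp only: if_True)
      then show "e (2 * i - 1) < e' (2 * i) \<and> e' (2 * i) \<le> e (2 * i)" using \<epsilon>_small[of i] i by auto
    qed
  qed
  have "compact K"
  proof -
    have "compactin (product_topology (\<lambda>i. euclidean) UNIV) K"
      unfolding K_def by (subst compactin_PiE) (auto simp: S_def)
    then show ?thesis by (simp add: euclidean_product_topology)
  qed
  have cont: "continuous_on K (\<lambda>e. band_measure g e j)" if "j \<le> g" for j
    by (rule continuous_on_subset[OF continuous_on_band_measure[OF that]]) (use K_ends in blast)
  define low where "low i = e(2 * i := e (2 * i) - \<epsilon>)" for i
  \<comment> \<open>The least loss of band 0 when a single left end drops to the bottom of the box.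
    The bounds \<open>q j\<close> exceed the given measures by less than \<open>\<delta> / g\<close>
    each, hence by less than \<open>\<delta>\<close> in total.\<close>
  define \<delta> where "\<delta> = Min ((\<lambda>i. band_measure g e 0 - band_measure g (low i) 0) ` {1..g})"
  have "0 < \<delta>"
    unfolding \<delta>_def low_def using g \<epsilon> \<epsilon>_small
    by (subst Min_gr_iff) (auto intro!: band_measure_decreasing[OF e])
  then have "\<exists>q\<in>\<rat>. band_measure g e j < q \<and> q < band_measure g e j + \<delta> / g" for j
    using g by (intro Rats_dense_in_real) simp
  then obtain q where q: "\<And>j. q j \<in> \<rat>" "\<And>j. band_measure g e j < q j" "\<And>j. q j < band_measure g e j + \<delta> / g"
    by metis
  \<comment> \<open>Total excess over the bounds. The constraints become \<open>F = 0\<close>, a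
    closed condition for one continuous function.\<close>
  define F where "F e' = (\<Sum>j\<in>{1..g}. max 0 (band_measure g e' j - q j))" for e'
  define A where "A = K \<inter> F -` {0}"
  have A: "e' \<in> A \<longleftrightarrow> e' \<in> K \<and> (\<forall>j\<in>{1..g}. band_measure g e' j \<le> q j)" for e'
  proof -
    have "max 0 (x - y) = 0 \<longleftrightarrow> x \<le> y" for x y :: real by auto
    then show ?thesis unfolding A_def F_def by (simp add: sum_nonneg_eq_0_iff)
  qed
  have "continuous_on K F"
    unfolding F_def by (intro continuous_on_sum continuous_on_max continuous_on_const continuous_on_diff cont) auto
  then have "compact A"
    unfolding A_def by (intro closedin_compact[OF \<open>compact K\<close>] continuous_closedin_preimage) auto
  moreover have "e \<in> A"
  proof -
    have "e k \<in> S k" for k using \<epsilon>(1) by (cases "k \<in> ?I") (simp_all add: S_def)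
    then show ?thesis using q(2) by (simp add: A K less_imp_le)
  qed
  moreover have "continuous_on A (\<lambda>e'. \<Sum>i\<in>{1..g}. e' (2 * i))"
    by (intro continuous_on_sum continuous_on_product_then_coordinatewise[OF continuous_on_id])
  ultimately obtain k where k: "k \<in> A" "\<And>e'. e' \<in> A \<Longrightarrow> (\<Sum>i\<in>{1..g}. k (2 * i)) \<le> (\<Sum>i\<in>{1..g}. e' (2 * i))"
    using continuous_attains_inf[of A "\<lambda>e'. \<Sum>i\<in>{1..g}. e' (2 * i)"] by blast
  have kK: "k \<in> K" and kq: "\<And>j. j \<in> {1..g} \<Longrightarrow> band_measure g k j \<le> q j" using k(1) by (auto simp: A)
  have k_ends: "k \<in> end_tuples g" by (rule K_ends(1)[OF kK])
  have k_box: "e (2 * i) - \<epsilon> \<le> k (2 * i)" "k (2 * i) \<le> e (2 * i)" if "i \<in> {1..g}" for i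
  proof -
    have "2 * i \<in> ?I" using that by auto
    moreover have "k (2 * i) \<in> S (2 * i)" using kK K by blast
    ultimately have "k (2 * i) \<in> {e (2 * i) - \<epsilon>..e (2 * i)}" unfolding S_def by (simp only: if_True)
    then show "e (2 * i) - \<epsilon> \<le> k (2 * i)" "k (2 * i) \<le> e (2 * i)" by auto
  qed
  have sum1: "(\<Sum>j\<in>{1..g}. band_measure g x j) = 1 - band_measure g x 0" if "x \<in> end_tuples g" for x
    using band_measure_sum[OF that] by (simp add: sum.atMost_shift sum.shift_bounds_Suc_ivl atLeast1_atMost_eq_remove0 sum_diff1)
  \<comment> \<open>With an end at the bottom of the box band 0 has lost at least
    \<open>\<delta>\<close>. The other bands must gain that amount, more than the bounds
    \<open>q j\<close> permit.\<close>
  have interior: "e (2 * i) - \<epsilon> < k (2 * i)" if i: "i \<in> {1..g}" for i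
  proof (rule ccontr)
    assume "\<not> ?thesis"
    then have ki: "k (2 * i) = e (2 * i) - \<epsilon>" using k_box[OF i] by simp
    have low_ends: "low i \<in> end_tuples g"
      unfolding low_def using i \<epsilon>_small[OF i] \<epsilon> by (intro lowered_end_tuple[OF e]) auto
    have "band_measure g k 0 \<le> band_measure g (low i) 0"
    proof (rule band_measure_mono(2)[OF low_ends])
      fix m assume m: "1 \<le> m" "m \<le> g"
      have "2 * m - 1 \<noteq> 2 * i" using m by presburger
      then show "low i (2 * m - 1) < k (2 * m) \<and> k (2 * m) \<le> low i (2 * m)"
        using m \<epsilon>_small[of m] k_box[of m] ki by (auto simp: low_def)
    next
      fix m assume "m \<notin> ?I"
      then show "k m = low i m" using K_ends(2)[OF kK, of m] i by (auto simp: low_def)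
    qed
    moreover have "\<delta> \<le> band_measure g e 0 - band_measure g (low i) 0"
      unfolding \<delta>_def using i by (intro Min_le) auto
    ultimately have "1 - band_measure g e 0 + \<delta> \<le> (\<Sum>j\<in>{1..g}. band_measure g k j)"
      using sum1[OF k_ends] by simp
    also have "\<dots> \<le> (\<Sum>j\<in>{1..g}. q j)" using kq by (rule sum_mono)
    also have "\<dots> < (\<Sum>j\<in>{1..g}. band_measure g e j + \<delta> / g)"
      using q(3) g by (intro sum_strict_mono) auto
    also have "\<dots> = 1 - band_measure g e 0 + \<delta>" using g sum1[OF e] by (simp add: sum.distrib)
    finally show False by simp
  qed
  \<comment> \<open>If bound \<open>j\<close> were slack, end \<open>2 * j\<close> could drop a
    little: band \<open>j\<close> stays within its bound by continuity, the other measures decrease,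
    and the sum of the left ends becomes smaller.\<close>
  have attained: "band_measure g k j = q j" if j: "j \<in> {1..g}" for j
  proof (rule ccontr)
    assume "band_measure g k j \<noteq> q j"
    then have less: "band_measure g k j < q j" using kq[OF j] by simp
    define v where "v t = k(2 * j := k (2 * j) - t)" for t
    define \<tau> where "\<tau> = k (2 * j) - (e (2 * j) - \<epsilon>)"
    have \<tau>: "0 < \<tau>" using interior[OF j] by (simp add: \<tau>_def)
    have vK: "v t \<in> K" if "t \<in> {0..\<tau>}" for t
    proof -
      have "v t m \<in> S m" for m
      proof (cases "m = 2 * j")
        case True
        have "2 * j \<in> ?I" using j by blast
        then have "S (2 * j) = {e (2 * j) - \<epsilon>..e (2 * j)}" unfolding S_def by (simp only: if_True)
        then show ?thesis using that k_box[OF j] True by (simp add: v_def \<tau>_def)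
      next
        case False
        have "k m \<in> S m" using kK K by blast
        then show ?thesis using False by (simp add: v_def)
      qed
      then show ?thesis by (simp add: K)
    qed
    have "continuous_on {0..\<tau>} v"
      unfolding v_def fun_upd_def
    proof (rule continuous_on_coordinatewise_then_product)
      show "continuous_on {0..\<tau>} (\<lambda>t. if i = 2 * j then k (2 * j) - t else k i)" for i
        by (cases "i = 2 * j") (auto intro!: continuous_intros)
    qed
    then have cv: "continuous_on {0..\<tau>} (\<lambda>t. band_measure g (v t) j)"
      using j vK by (intro continuous_on_compose2[OF cont]) auto
    have v0: "v 0 = k" by (simp add: v_def)
    \<comment> \<open>Either the step down to the bottom of the box respects the bound, or the
      measure meets \<open>q j\<close> on the way; slackness at \<open>t = 0\<close> keeps that
      \<open>t\<close> positive.\<close>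
    obtain t where t: "0 < t" "t \<le> \<tau>" "band_measure g (v t) j \<le> q j"
    proof (cases "band_measure g (v \<tau>) j \<le> q j")
      case True
      then show ?thesis using that \<tau> by blast
    next
      case False
      then obtain t where "0 \<le> t" "t \<le> \<tau>" "band_measure g (v t) j = q j"
        using IVT'[of "\<lambda>t. band_measure g (v t) j" 0 "q j" \<tau>] cv less v0 \<tau> by auto
      then show ?thesis using that[of t] less v0 by (cases "t = 0") auto
    qed
    have "v t \<in> A"
      unfolding A
    proof (intro conjI ballI)
      show "v t \<in> K" using vK t by simp
      fix j' assume j': "j' \<in> {1..g}"
      show "band_measure g (v t) j' \<le> q j'"
      proof (cases "j' = j")
        case False
        have "2 * j - 1 \<notin> ?I" using j by auto presburger
        then have "k (2 * j - 1) < k (2 * j) - t"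
          using K_ends(2)[OF kK, of "2 * j - 1"] \<epsilon>_small[OF j] t by (simp add: \<tau>_def)
        then have "band_measure g (v t) j' < band_measure g k j'"
          unfolding v_def using False j j' t by (intro band_measure_decreasing[OF k_ends]) auto
        then show ?thesis using kq[OF j'] by simp
      qed (use t in simp)
    qed
    from k(2)[OF this] have "(\<Sum>i\<in>{1..g}. k (2 * i)) \<le> (\<Sum>i\<in>{1..g}. v t (2 * i))" .
    moreover have "(\<Sum>i\<in>{1..g}. v t (2 * i)) < (\<Sum>i\<in>{1..g}. k (2 * i))"
      by (rule sum_strict_mono_ex1) (use j t in \<open>auto simp: v_def\<close>)
    ultimately show False by simp
  qed
  show ?thesis
  proof (rule that[OF k_ends])
    show "\<bar>k m - e m\<bar> \<le> \<epsilon>0" for m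
    proof -
      have "k m \<in> S m" using kK K by blast
      then show ?thesis using \<epsilon> by (auto simp: S_def split: if_splits)
    qed
    show "k m = e m" if "m \<notin> ?I" for m using K_ends(2)[OF kK that] .
    fix j assume j: "j \<le> g"
    show "band_measure g k j \<in> \<rat>"
    proof (cases "j = 0")
      case True
      have "band_measure g k 0 = 1 - (\<Sum>j\<in>{1..g}. q j)"
        using sum1[OF k_ends] attained by simp
      then show ?thesis using True q(1) by (simp add: Rats_sum)
    next
      case False
      then show ?thesis using attained[of j] q(1) j by simp
    qed
  qed
qed

section \<open>Pell equations\<close>

lemma prod_linear_dvd:
  fixes p :: "real poly"
  assumes "finite J" "inj_on c J" "\<And>j. j \<in> J \<Longrightarrow> poly p (c j) = 0"
  shows "(\<Prod>j\<in>J. [:- c j, 1:]) dvd p"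
  using assms
proof (induction J rule: finite_induct)
  case (insert i J)
  have "coprime [:- c i, 1:] (\<Prod>j\<in>J. [:- c j, 1:])"
    by (rule prod_coprime_right, rule coprime_linear) (use insert.prems(1) insert.hyps(2) in \<open>auto simp: inj_on_def\<close>)
  then have "[:- c i, 1:] * (\<Prod>j\<in>J. [:- c j, 1:]) dvd p"
    using insert by (intro semiring_gcd_class.divides_mult) (auto simp: poly_eq_0_iff_dvd)
  then show ?case unfolding prod.insert[OF insert.hyps] .
qed simp

lemma common_denominator:
  assumes "finite J" "\<And>j. j \<in> J \<Longrightarrow> (x j :: real) \<in> \<rat>"
  obtains n :: nat where "0 < n" "\<And>j. j \<in> J \<Longrightarrow> real n * x j \<in> \<int>"
proof -
  have "\<forall>j\<in>J. \<exists>d::nat. 0 < d \<and> real d * x j \<in> \<int>"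
  proof
    fix j assume "j \<in> J"
    then obtain a and b :: nat where "b \<noteq> 0" "x j = real_of_int a / real b"
      using assms(2) unfolding Rats_eq_int_div_nat by blast
    then show "\<exists>d::nat. 0 < d \<and> real d * x j \<in> \<int>" by (intro exI[of _ b]) auto
  qed
  then obtain d where d: "\<And>j. j \<in> J \<Longrightarrow> 0 < d j \<and> real (d j) * x j \<in> \<int>" unfolding bchoice_iff by blast
  show ?thesis
  proof (rule that)
    show "0 < (\<Prod>j\<in>J. d j)" using d by (intro prod_pos) auto
    fix j assume j: "j \<in> J"
    have "real (\<Prod>j\<in>J. d j) * x j = real (\<Prod>j\<in>J - {j}. d j) * (real (d j) * x j)"
      using j assms(1) by (subst prod.remove[of J j]) auto
    then show "real (\<Prod>j\<in>J. d j) * x j \<in> \<int>" using d[OF j] by (simp only: Ints_mult Ints_of_nat)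
  qed
qed

text \<open>\<open>cosh\<close> is real on both axes, and a translation by
  \<open>\<i> * pi * m\<close> only multiplies it by \<open>cos (pi * m)\<close>, a sign.\<close>

lemma cosh_real:
  fixes w :: complex
  assumes "Im w = 0 \<or> Re w = 0" shows "cosh (w + \<i> * of_real pi * of_int m) \<in> \<real>"
proof -
  have "\<i> * (w + \<i> * of_real pi * of_int m) = \<i> * w - of_real (pi * of_int m)" by (simp add: algebra_simps)
  then have "cosh (w + \<i> * of_real pi * of_int m) =
      cos (\<i> * w) * of_real (cos (pi * of_int m)) + sin (\<i> * w) * of_real (sin (pi * of_int m))"
    unfolding cosh_conv_cos by (simp only: cos_diff cos_of_real sin_of_real)
  also have "sin (pi * of_int m) = 0" by (simp add: mult.commute sin_zero_iff_int2) 
  finally have eq: "cosh (w + \<i> * of_real pi * of_int m) = cos (\<i> * w) * of_real (cos (pi * of_int m))" by simp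
  have "cos (\<i> * w) \<in> \<real>"
  proof (cases "Im w = 0")
    case True
    then have "w = of_real (Re w)" by (simp add: complex_eq_iff)
    then have "cos (\<i> * w) = of_real (cosh (Re w))" proof -
      have "cos (\<i> * complex_of_real t) = of_real (cosh t)" for t
        unfolding cosh_conv_cos[symmetric] cosh_def
        by (simp add: scaleR_conv_of_real exp_of_real flip: of_real_minus)
      then show ?thesis using \<open>w = _\<close> by metis
    qed
    then show ?thesis by simp
  next
    case False
    then have "\<i> * w = of_real (- Im w)" using assms by (simp add: complex_eq_iff)
    then have "cos (\<i> * w) = of_real (cos (- Im w))" by (simp only: cos_of_real)
    then show ?thesis by simp
  qed
  then show ?thesis unfolding eq by simp
qed

lemma norm_cosh_le: "norm (cosh w) \<le> exp (norm w)" for w :: complex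
proof -
  have "norm (cosh w) = norm (exp w + exp (- w)) / 2" by (simp add: cosh_def scaleR_conv_of_real norm_mult)
  also have "\<dots> \<le> (norm (exp w) + norm (exp (- w))) / 2" by (intro divide_right_mono norm_triangle_ineq) simp
  also have "\<dots> \<le> (exp (norm w) + exp (norm (- w))) / 2" by (intro divide_right_mono add_mono norm_exp) simp
  finally show ?thesis by simp
qed

text \<open>Liouville gives a complex polynomial. As its values on the real axis are real, the real
  parts of the Taylor coefficients reproduce them.\<close>

lemma entire_polynomial_real:
  assumes hol: "f holomorphic_on UNIV" and bound: "\<And>z. R \<le> norm z \<Longrightarrow> norm (f z) \<le> B * norm z ^ N"
    and real: "\<And>x. f (of_real x) \<in> \<real>"
  obtains A :: "real poly" where "\<And>x. f (of_real x) = of_real (poly A x)"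
proof -
  define a where "a k = (deriv ^^ k) f 0 / fact k" for k
  define A where "A = (\<Sum>k\<le>N. Polynomial.monom (Re (a k)) k)"
  have "f (of_real x) = of_real (poly A x)" for x
  proof -
    have "f (of_real x) = (\<Sum>k\<le>N. a k * of_real x ^ k)"
      unfolding a_def by (rule Liouville_polynomial[OF hol bound])
    then have "Re (f (of_real x)) = (\<Sum>k\<le>N. Re (a k * of_real (x ^ k)))" by simp
    also have "\<dots> = poly A x" by (simp add: A_def poly_sum poly_monom)
    finally show ?thesis using real[of x] by (metis of_real_Re)
  qed
  then show ?thesis using that by blast
qed

text \<open>The differential is of order \<open>1 / norm z\<close>, so integration along the ray
  from radius \<open>R\<close> out to \<open>z\<close> gives logarithmic growth. This is what turns
  \<open>cosh (n * G)\<close> into a function of polynomial growth.\<close>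

lemma abelian_primitive_growth:
  assumes e: "e \<in> end_tuples g" and r: "r = (\<Prod>j<g. [:- c j, 1:])" and G: "abelian_primitive g e r G"
  obtains C0 R C1 where "0 \<le> C0" "1 \<le> R"
    "\<And>z. 0 < Im z \<Longrightarrow> R \<le> norm z \<Longrightarrow> norm (G z) \<le> C1 + C0 * ln (norm z)"
proof -
  let ?W = "\<lambda>z. poly (cpoly r) z / end_root (end_set g e) z"
  obtain C R' where CR: "0 \<le> C" "0 < R'"
    "\<And>z. 0 < Im z \<Longrightarrow> R' \<le> norm z \<Longrightarrow> norm (z * ?W z - 1) \<le> C / norm z"
    using abelian_differential_asymptotics[OF e r] unfolding near_one_def by blast
  define R where "R = max R' 1"
  have R: "1 \<le> R" "R' \<le> R" by (auto simp: R_def)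
  have W: "norm (?W z) \<le> (1 + C) / norm z" if z: "0 < Im z" "R \<le> norm z" for z
  proof -
    have "norm (z * ?W z) \<le> norm (z * ?W z - 1) + norm (1::complex)"
      using norm_triangle_ineq[of "z * ?W z - 1" 1] by simp
    also have "\<dots> \<le> C / norm z + 1" using CR(3)[of z] z R by simp
    also have "\<dots> \<le> C + 1" using z R CR(1) by (simp add: divide_le_eq mult_le_cancel_left1)
    finally have "norm (?W z) * norm z \<le> 1 + C"
      unfolding norm_mult mult.commute[of "norm z"] by linarith
    moreover have "0 < norm z" using z R by linarith
    ultimately show ?thesis by (simp only: pos_le_divide_eq)
  qed
  have cont: "continuous_on {z. 0 \<le> Im z} G" using G by (simp add: abelian_primitive_def)
  have "compact (cball 0 R \<inter> {z. 0 \<le> Im z})"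
    by (intro compact_Int_closed compact_cball closed_halfspace_Im_ge)
  then have "compact (G ` (cball 0 R \<inter> {z. 0 \<le> Im z}))"
    by (intro compact_continuous_image continuous_on_subset[OF cont]) auto
  from compact_imp_bounded[OF this] obtain C1
    where "\<forall>w\<in>G ` (cball 0 R \<inter> {z. 0 \<le> Im z}). norm w \<le> C1" unfolding bounded_iff by blast
  then have C1: "\<And>z. norm z \<le> R \<Longrightarrow> 0 \<le> Im z \<Longrightarrow> norm (G z) \<le> C1" by auto
  have "norm (G z) \<le> C1 + (1 + C) * ln (norm z)" if z: "0 < Im z" "R \<le> norm z" for z
  proof -
    define u where "u = z / of_real (norm z)"
    have z0: "0 < norm z" using z R by linarith
    have u: "norm u = 1" "0 < Im u" using z z0 by (auto simp: u_def norm_divide)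
    have GR: "norm (G (of_real R * u)) \<le> C1" using u R by (intro C1) (auto simp: norm_mult)
    have "norm (G z - G (of_real R * u)) \<le> (1 + C) * ln (norm z) - (1 + C) * ln R"
    proof (cases "norm z = R")
      case True
      then show ?thesis using z0 by (simp add: u_def)
    next
      case False
      then have less: "R < norm z" using z by simp
      have "norm (G (of_real (norm z) * u) - G (of_real R * u)) \<le> (1 + C) * ln (norm z) - (1 + C) * ln R"
      proof (rule differentiable_bound_general[OF less])
        show "continuous_on {R..norm z} (\<lambda>t. G (of_real t * u))"
          using u R by (intro continuous_on_compose2[OF cont] continuous_intros) auto
        show "continuous_on {R..norm z} (\<lambda>t. (1 + C) * ln t)"
          using R by (intro continuous_intros) auto
        fix t assume t: "R < t" "t < norm z"
        have tz: "0 < Im (of_real t * u)" "R \<le> norm (of_real t * u)" "norm (of_real t * u) = t"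
          using t u R by (auto simp: norm_mult)
        have "((\<lambda>t. of_real t * u) has_vector_derivative of_real 1 * u) (at t)"
          by (intro has_vector_derivative_mult_left has_vector_derivative_of_real DERIV_ident)
        moreover have "(G has_field_derivative ?W (of_real t * u)) (at (of_real t * u))"
          using G tz by (simp add: abelian_primitive_def)
        ultimately show "((\<lambda>t. G (of_real t * u)) has_vector_derivative of_real 1 * u * ?W (of_real t * u)) (at t)"
          using field_vector_diff_chain_at[of "\<lambda>t. of_real t * u" _ t G] by (simp only: o_def)
        show "((\<lambda>t. (1 + C) * ln t) has_vector_derivative (1 + C) / t) (at t)"
          unfolding has_real_derivative_iff_has_vector_derivative[symmetric]
          using t R by (auto intro!: derivative_eq_intros simp: field_simps)
        show "norm (of_real 1 * u * ?W (of_real t * u)) \<le> (1 + C) / t"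
          using W[OF tz(1,2)] t R unfolding tz(3) norm_mult u(1) by simp
      qed
      then show ?thesis using z0 by (simp add: u_def)
    qed
    also have "\<dots> \<le> (1 + C) * ln (norm z)" using R CR(1) by simp
    finally have "norm (G z - G (of_real R * u)) \<le> (1 + C) * ln (norm z)" .
    moreover have "norm (G z) \<le> norm (G z - G (of_real R * u)) + norm (G (of_real R * u))"
      using norm_triangle_ineq[of "G z - G (of_real R * u)" "G (of_real R * u)"] by simp
    ultimately show ?thesis using GR by linarith
  qed
  then show ?thesis using that[of "1 + C" R C1] CR(1) R by auto
qed

lemma end_tuple_interval:
  fixes e :: "nat \<Rightarrow> real"
  assumes "0 < n" "e 0 \<le> x" "x \<le> e n" shows "\<exists>k<n. e k \<le> x \<and> x \<le> e (Suc k)"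
  using assms
proof (induction n)
  case (Suc n)
  show ?case
  proof (cases "e n \<le> x")
    case True
    then show ?thesis using Suc.prems by auto
  next
    case False
    then have "n \<noteq> 0" using Suc.prems by (metis)
    then show ?thesis using Suc False by (auto intro: less_SucI)
  qed
qed simp

definition end_poly :: "nat \<Rightarrow> (nat \<Rightarrow> real) \<Rightarrow> real poly" where
  "end_poly g e = (\<Prod>i<2 * g + 2. [:- e i, 1:])"

text \<open>At every end \<open>n * (G - c)\<close> lies in \<open>\<i> * pi\<close> times the
  integers: gaps contribute 0, and bands contribute \<open>- \<i> * pi\<close> times an integer.
  From an end onward \<open>G\<close> moves horizontally or vertically, and \<open>cosh\<close> is
  real on both lines through such a lattice point.\<close>

lemma cosh_primitive_real:
  assumes e: "e \<in> end_tuples g" and G: "abelian_primitive g e (band_poly g e) G"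
    and n: "\<And>j. j \<le> g \<Longrightarrow> real n * band_measure g e j \<in> \<int>"
  shows "cosh (of_nat n * (G (of_real x) - G (of_real (e (2 * g + 1))))) \<in> \<real>"
proof -
  let ?r = "band_poly g e" and ?c = "G (of_real (e (2 * g + 1)))"
  have step: "\<exists>m::int. of_nat n * (G (of_real (e (Suc k))) - G (of_real (e k))) = \<i> * of_real pi * of_int m"
    if k: "k < 2 * g + 1" for k
  proof (cases "even k")
    case True
    then obtain j where j: "k = 2 * j" by blast
    obtain m where m: "real n * band_measure g e j = of_int m" using n[of j] k j by (auto elim: Ints_cases)
    have "G (of_real (e (Suc k))) - G (of_real (e k)) = - \<i> * of_real (pi * band_measure g e j)"
      unfolding j by (rule band_increment[OF e G]) (use j k in simp)
    then have "of_nat n * (G (of_real (e (Suc k))) - G (of_real (e k))) =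
        - \<i> * of_real pi * of_real (real n * band_measure g e j)" by simp
    then show ?thesis unfolding m by (intro exI[of _ "- m"]) simp
  next
    case False
    then obtain j where "k = 2 * j + 1" by (elim oddE)
    then have "G (of_real (e (Suc k))) - G (of_real (e k)) = 0"
      using gap_increment[OF e G, of j] k by simp
    then show ?thesis by (intro exI[of _ 0]) simp
  qed
  have lattice: "\<exists>m::int. of_nat n * (G (of_real (e (2 * g + 1 - i))) - ?c) = \<i> * of_real pi * of_int m"
    if "i \<le> 2 * g + 1" for i
    using that
  proof (induction i)
    case 0
    show ?case by (intro exI[of _ 0]) simp
  next
    case (Suc i)
    let ?k = "2 * g + 1 - Suc i"
    have k: "?k < 2 * g + 1" "Suc ?k = 2 * g + 1 - i" using Suc.prems by simp_all
    obtain m where m: "of_nat n * (G (of_real (e (Suc ?k))) - ?c) = \<i> * of_real pi * of_int m"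
      using Suc unfolding k(2) by auto
    obtain m' where m': "of_nat n * (G (of_real (e (Suc ?k))) - G (of_real (e ?k))) = \<i> * of_real pi * of_int m'"
      using step[OF k(1)] by blast
    have "of_nat n * (G (of_real (e ?k)) - ?c) = of_nat n * (G (of_real (e (Suc ?k))) - ?c)
        - of_nat n * (G (of_real (e (Suc ?k))) - G (of_real (e ?k)))" by (simp only: right_diff_distrib) simp
    also have "\<dots> = \<i> * of_real pi * of_int (m - m')" unfolding m m' by (simp add: right_diff_distrib)
    finally show ?case by blast
  qed
  have lattice: "\<exists>m::int. of_nat n * (G (of_real (e k)) - ?c) = \<i> * of_real pi * of_int m"
    if "k \<le> 2 * g + 1" for k
    using lattice[of "2 * g + 1 - k"] that by simp
  have axis: "Im w = 0 \<or> Re w = 0" if "Im (\<i> ^ m * w) = 0" for m w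
  proof -
    have "\<i> ^ m = 1 \<or> \<i> ^ m = - 1 \<or> \<i> ^ m = \<i> \<or> \<i> ^ m = - \<i>"
    proof (cases "even m")
      case True
      then obtain l where "m = 2 * l" by blast
      then show ?thesis using i_power_even[of l] by (cases "even l") auto
    next
      case False
      then obtain l where "m = 2 * l + 1" by (elim oddE)
      then show ?thesis using i_power_even[of l] by (cases "even l") auto
    qed
    then show ?thesis using that by auto
  qed
  have final: ?thesis if k: "k \<le> 2 * g + 1" and m: "Im (\<i> ^ m * G (of_real x)) = Im (\<i> ^ m * G (of_real (e k)))" for k m
  proof -
    obtain l where l: "of_nat n * (G (of_real (e k)) - ?c) = \<i> * of_real pi * of_int l" using lattice[OF k] by blast
    have "Im (\<i> ^ m * (G (of_real x) - G (of_real (e k)))) = 0" using m by (simp only: right_diff_distrib minus_complex.sel)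
    from axis[OF this] have "Im (of_nat n * (G (of_real x) - G (of_real (e k)))) = 0 \<or>
        Re (of_nat n * (G (of_real x) - G (of_real (e k)))) = 0"
      by (auto simp del: minus_complex.sel)
    from cosh_real[OF this, of l] show ?thesis unfolding l[symmetric] by (simp add: algebra_simps)
  qed
  have ends: "e 0 \<le> e i" "e i \<le> e (2 * g + 1)" if "i < 2 * g + 2" for i
    using that by (intro end_tuples_le[OF e]; simp)+
  consider "x \<le> e 0" | "e (2 * g + 1) \<le> x" | "e 0 \<le> x" "x \<le> e (2 * g + 1)" by linarith
  then show ?thesis
  proof cases
    case 1
    show ?thesis
    proof (rule final[of 0 "2 * g + 2"])
      show "Im (\<i> ^ (2 * g + 2) * G (of_real x)) = Im (\<i> ^ (2 * g + 2) * G (of_real (e 0)))"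
      proof (rule abelian_primitive_phase[OF G order.refl 1 order.refl, symmetric])
        fix t assume "t < e 0"
        then show "t \<notin> end_set g e \<and> card {y \<in> end_set g e. t < y} = 2 * g + 2"
          using card_ends_above_left[OF e] ends unfolding end_set_def by fastforce
      qed
    qed simp
  next
    case 2
    show ?thesis
    proof (rule final[of "2 * g + 1" 0])
      show "Im (\<i> ^ 0 * G (of_real x)) = Im (\<i> ^ 0 * G (of_real (e (2 * g + 1))))"
      proof (rule abelian_primitive_phase[OF G order.refl 2 order.refl])
        fix t assume "e (2 * g + 1) < t"
        then show "t \<notin> end_set g e \<and> card {y \<in> end_set g e. t < y} = 0"
          using card_ends_above_right[OF e] ends unfolding end_set_def by fastforce
      qed
    qed simp
  next
    case 3
    then obtain k where k: "k < 2 * g + 1" "e k \<le> x" "x \<le> e (Suc k)"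
      using end_tuple_interval[of "2 * g + 1" e x] by auto
    show ?thesis
    proof (rule final[of k "2 * g + 1 - k"])
      show "Im (\<i> ^ (2 * g + 1 - k) * G (of_real x)) = Im (\<i> ^ (2 * g + 1 - k) * G (of_real (e k)))"
        by (rule abelian_primitive_phase[OF G order.refl k(2,3)])
           (use not_in_end_set[OF e k(1)] card_ends_above[OF e k(1)] in blast)
    qed (use k in simp)
  qed
qed

lemma poly_end_poly: "poly (end_poly g e) x = (\<Prod>i<2 * g + 2. x - e i)"
  unfolding end_poly_def poly_prod by (rule prod.cong) simp_all

text \<open>The differential equation for \<open>A\<close> is an identity of polynomials, so it
  suffices to check it right of all ends, where the root of f is positive and \<open>A\<close>
  equals \<open>cosh h\<close> with the real function \<open>h\<close>.\<close>

lemma pell_solution: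
  assumes e: "e \<in> end_tuples g" and rat: "\<And>j. j \<le> g \<Longrightarrow> band_measure g e j \<in> \<rat>"
  obtains A B :: "real poly" where "B \<noteq> 0" "A\<^sup>2 - end_poly g e * B\<^sup>2 = 1"
proof -
  let ?r = "band_poly g e" and ?f = "end_poly g e"
  obtain c where c: "\<And>j. j < g \<Longrightarrow> e (2 * j + 1) < c j \<and> c j < e (2 * j + 2)"
    "?r = (\<Prod>j<g. [:- c j, 1:])" using band_poly_roots[OF e] by blast
  obtain G where G: "abelian_primitive g e ?r G"
    using abelian_primitive_exists[OF e, of ?r] band_poly_props[OF e] by auto
  obtain n :: nat where n: "0 < n" "\<And>j. j \<le> g \<Longrightarrow> real n * band_measure g e j \<in> \<int>"
    using common_denominator[of "{..g}" "band_measure g e"] rat by auto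
  define c0 where "c0 = G (of_real (e (2 * g + 1)))"
  define T where "T z = cosh (of_nat n * (G z - c0))" for z
  have contG: "continuous_on {z. 0 \<le> Im z} G" using G by (simp add: abelian_primitive_def)
  have contT: "continuous_on {z. 0 \<le> Im z} T"
    unfolding T_def cosh_conv_cos by (intro continuous_intros contG)
  have holT: "T holomorphic_on {z. 0 < Im z}"
  proof -
    have "G holomorphic_on {z. 0 < Im z}"
      using G unfolding abelian_primitive_def
      by (auto simp: holomorphic_on_open open_halfspace_Im_gt)
    then show ?thesis unfolding T_def cosh_conv_cos by (intro holomorphic_intros)
  qed
  have realT: "T (of_real x) \<in> \<real>" for x
    unfolding T_def c0_def by (rule cosh_primitive_real[OF e G n(2)])
  \<comment> \<open>Schwarz reflection: \<open>T\<close> is continuous up to the real axis and real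
    on it.\<close>
  define f where "f z = (if 0 \<le> Im z then T z else cnj (T (cnj z)))" for z
  have holf: "f holomorphic_on UNIV"
    unfolding f_def
  proof (rule Schwarz_reflection)
    show "T z \<in> \<real>" if "z \<in> \<real>" for z using realT[of "Re z"] that by simp
  qed (simp_all add: holT contT)
  obtain C0 R C1 where CR: "0 \<le> C0" "1 \<le> R"
    "\<And>z. 0 < Im z \<Longrightarrow> R \<le> norm z \<Longrightarrow> norm (G z) \<le> C1 + C0 * ln (norm z)"
  proof (rule abelian_primitive_growth[OF e c(2) G])
    fix C0 R C1
    assume "0 \<le> C0" "1 \<le> R"
      "\<And>z. 0 < Im z \<Longrightarrow> R \<le> norm z \<Longrightarrow> norm (G z) \<le> C1 + C0 * ln (norm z)"
    then show thesis by (rule that)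
  qed
  \<comment> \<open>The exponential turns growth \<open>n * C0 * ln (norm z)\<close> into a power of
    \<open>norm z\<close>; its exponent is rounded up.\<close>
  define N where "N = nat \<lceil>n * C0\<rceil>"
  define B0 where "B0 = exp (n * (C1 + norm c0))"
  have N: "n * C0 \<le> real N" unfolding N_def by linarith
  have bound_interior: "norm (T z) \<le> B0 * norm z ^ N" if z: "0 < Im z" "R \<le> norm z" for z
  proof -
    have ln: "0 \<le> ln (norm z)" using z CR by (intro ln_ge_zero) linarith
    have "norm (of_nat n * (G z - c0)) \<le> n * (C1 + C0 * ln (norm z) + norm c0)"
      unfolding norm_mult norm_of_nat
      using CR(3)[OF z] norm_triangle_ineq4[of "G z" c0] by (intro mult_left_mono) auto
    also have "\<dots> = n * (C1 + norm c0) + (n * C0) * ln (norm z)" by (simp add: algebra_simps)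
    also have "\<dots> \<le> n * (C1 + norm c0) + real N * ln (norm z)"
      using N ln by (intro add_left_mono mult_right_mono)
    finally have "norm (T z) \<le> exp (n * (C1 + norm c0) + real N * ln (norm z))"
      unfolding T_def using norm_cosh_le[of "of_nat n * (G z - c0)"] by (meson exp_le_cancel_iff order.trans)
    moreover have "exp (real N * ln (norm z)) = norm z ^ N"
    proof -
      have "0 < norm z" using z CR(2) by linarith
      then show ?thesis by (simp only: exp_of_nat_mult exp_ln)
    qed
    ultimately show ?thesis by (simp only: exp_add B0_def)
  qed
  have bound_upper: "norm (T z) \<le> B0 * norm z ^ N" if z: "0 \<le> Im z" "R \<le> norm z" for z
  proof (cases "Im z = 0")
    case False
    then show ?thesis using bound_interior z by simp
  next
    case True
    define x where "x = Re z"
    have zx: "z = of_real x" using True by (simp add: x_def complex_eq_iff)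
    \<comment> \<open>The growth bound holds for \<open>0 < Im z\<close> only. After division by
      \<open>z ^ N\<close> it is constant and passes to the limit on the axis.\<close>
    let ?S = "{z. 0 \<le> Im z \<and> R \<le> norm z}" and ?D = "\<lambda>z. T z / z ^ N"
    have "norm (0 - ?D (of_real x)) \<le> B0"
    proof (rule boundary_norm_bound)
      show "continuous_on ?S ?D"
        using CR(2) by (intro continuous_on_divide continuous_on_subset[OF contT] continuous_on_power continuous_on_id) auto
      have ge: "R \<le> norm (of_real x + \<i> * of_real \<delta>)" for \<delta>
        using abs_Re_le_cmod[of "of_real x + \<i> * of_real \<delta>"] z(2) zx by simp
      show "of_real x + \<i> * of_real \<delta> \<in> ?S" if "0 \<le> \<delta>" for \<delta> using that ge by simp
      fix \<delta> :: real assume "0 < \<delta>"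
      then have "norm (T (of_real x + \<i> * of_real \<delta>)) \<le> B0 * norm (of_real x + \<i> * of_real \<delta>) ^ N"
        using ge by (intro bound_interior) auto
      moreover have "0 < norm (of_real x + \<i> * of_real \<delta>)" using ge[of \<delta>] CR(2) by linarith
      ultimately show "norm (0 - ?D (of_real x + \<i> * of_real \<delta>)) \<le> B0"
        by (simp add: norm_divide norm_power pos_divide_le_eq)
    qed
    moreover have "0 < norm (complex_of_real x)" using z(2) CR(2) unfolding zx by linarith
    ultimately show ?thesis unfolding zx by (simp add: norm_divide norm_power pos_divide_le_eq)
  qed
  have fb: "norm (f z) \<le> B0 * norm z ^ N" if "R \<le> norm z" for z
    using bound_upper[of z] bound_upper[of "cnj z"] that by (auto simp: f_def)
  have "f (of_real x) \<in> \<real>" for x using realT by (simp add: f_def)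
  with entire_polynomial_real[OF holf fb] obtain A
    where A: "\<And>x. f (of_real x) = of_real (poly A x)" by metis
  define h where "h x = real n * Re (G (of_real x) - c0)" for x
  have outer: "poly A x = cosh (h x) \<and> poly ?f x = end_prod g e x \<and> 0 < end_prod g e x \<and> 0 < poly ?r x \<and>
      (h has_real_derivative n * (poly ?r x / sqrt (end_prod g e x))) (at x)"
    if x: "e (2 * g + 1) < x" for x
  proof -
    have ends: "e i \<le> e (2 * g + 1)" if "i < 2 * g + 2" for i
      using that by (intro end_tuples_le[OF e]) auto
    have notin: "t \<notin> end_set g e \<and> card {y \<in> end_set g e. t < y} = 0" if "e (2 * g + 1) < t" for t
      using card_ends_above_right[OF e that] ends that unfolding end_set_def by fastforce
    have "Im (\<i> ^ 0 * G (of_real x)) = Im (\<i> ^ 0 * c0)"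
      unfolding c0_def using abelian_primitive_phase[OF G order.refl less_imp_le[OF x] order.refl notin] by simp
    then have "of_nat n * (G (of_real x) - c0) = of_real (h x)"
      by (simp add: h_def complex_eq_iff)
    then have "complex_of_real (poly A x) = cosh (of_real (h x))"
      using A[of x] by (simp add: f_def T_def)
    also have "\<dots> = of_real (cosh (h x))"
      unfolding cosh_def by (simp add: scaleR_conv_of_real exp_of_real flip: of_real_minus)
    finally have 1: "poly A x = cosh (h x)" by (simp only: of_real_eq_iff)
    have 2: "poly ?f x = end_prod g e x"
      unfolding poly_end_poly end_prod_def
    proof (rule prod.cong)
      fix i assume "i \<in> {..<2 * g + 2}"
      then show "x - e i = \<bar>x - e i\<bar>" using ends[of i] x by simp
    qed simp
    have 3: "0 < end_prod g e x" using notin[OF x] by (intro end_prod_pos) simp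
    have "e (2 * g) \<le> x" using ends[of "2 * g"] x by simp
    then have 4: "0 < poly ?r x" using band_poly_sign[OF e, of g x] by simp
    have "((\<lambda>t. \<i> ^ card {y \<in> end_set g e. x < y} * G (of_real t)) has_vector_derivative
        of_real (poly ?r x / sqrt (end_prod g e x))) (at x)"
      using G notin[OF x] unfolding abelian_primitive_def by blast
    then have "((\<lambda>t. G (of_real t)) has_vector_derivative of_real (poly ?r x / sqrt (end_prod g e x))) (at x)"
      using notin[OF x] by simp
    from bounded_linear.has_vector_derivative[OF bounded_linear_Re this]
    have "((\<lambda>t. Re (G (of_real t))) has_real_derivative poly ?r x / sqrt (end_prod g e x)) (at x)"
      by (simp add: has_real_derivative_iff_has_vector_derivative)
    from DERIV_cmult[OF DERIV_diff[OF this DERIV_const[of "Re c0"]], of "real n"]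
    have 5: "(h has_real_derivative n * (poly ?r x / sqrt (end_prod g e x))) (at x)"
      unfolding h_def[abs_def] by simp
    show ?thesis using 1 2 3 4 5 by blast
  qed
  have derA: "poly (pderiv A) x = sinh (h x) * (n * (poly ?r x / sqrt (end_prod g e x)))"
    if x: "e (2 * g + 1) < x" for x
  proof -
    have "((\<lambda>t. cosh (h t)) has_real_derivative sinh (h x) * (n * (poly ?r x / sqrt (end_prod g e x)))) (at x)"
      using outer[OF x] by (intro has_field_derivative_cosh) auto
    moreover have "\<forall>\<^sub>F t in nhds x. cosh (h t) = poly A t"
      using eventually_nhds_in_open[of "{e (2 * g + 1)<..}" x] x
      by (auto elim!: eventually_mono simp: outer)
    ultimately have "((\<lambda>t. poly A t) has_real_derivative sinh (h x) * (n * (poly ?r x / sqrt (end_prod g e x)))) (at x)"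
      by (rule DERIV_cong_ev[OF refl _ refl, THEN iffD1, rotated])
    then show ?thesis using poly_DERIV DERIV_unique by blast
  qed
  have inf: "infinite {e (2 * g + 1)<..}" by (rule infinite_Ioi)
  have poly_eq: "p = q" if "\<And>x. e (2 * g + 1) < x \<Longrightarrow> poly p x = poly q x" for p q :: "real poly"
  proof (rule ccontr)
    assume "p \<noteq> q"
    then have "finite {x. poly (p - q) x = 0}" by (intro poly_roots_finite) simp
    moreover have "{e (2 * g + 1)<..} \<subseteq> {x. poly (p - q) x = 0}" using that by auto
    ultimately show False using inf finite_subset by blast
  qed
  have id: "?f * (pderiv A)\<^sup>2 = [:(real n)\<^sup>2:] * ?r\<^sup>2 * (A\<^sup>2 - 1)"
  proof (rule poly_eq)
    fix x assume x: "e (2 * g + 1) < x"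
    have "(cosh (h x))\<^sup>2 - 1 = (sinh (h x))\<^sup>2" by (simp add: cosh_square_eq)
    then show "poly (?f * (pderiv A)\<^sup>2) x = poly ([:(real n)\<^sup>2:] * ?r\<^sup>2 * (A\<^sup>2 - 1)) x"
      using outer[OF x] derA[OF x] by (simp add: power_mult_distrib power_divide)
  qed
  \<comment> \<open>The roots of \<open>r\<close> are simple and lie inside the gaps, where f does
    not vanish; by the identity \<open>pderiv A\<close> vanishes at each of them.\<close>
  have "?r dvd pderiv A"
    unfolding c(2)
  proof (rule prod_linear_dvd)
    show "inj_on c {..<g}"
    proof (rule linorder_inj_onI')
      fix i j assume ij: "i \<in> {..<g}" "j \<in> {..<g}" "i < j"
      have "e (2 * i + 2) \<le> e (2 * j + 1)" by (rule end_tuples_le[OF e]) (use ij in auto)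
      then show "c i \<noteq> c j" using c(1)[of i] c(1)[of j] ij by auto
    qed
    fix j assume j: "j \<in> {..<g}"
    have "poly ?r (c j) = 0" unfolding c(2) using j by (auto simp: poly_prod)
    then have "poly ?f (c j) * (poly (pderiv A) (c j))\<^sup>2 = 0"
      using arg_cong[OF id, of "\<lambda>p. poly p (c j)"] by simp
    moreover have "c j \<notin> end_set g e"
      using not_in_end_set[OF e, of "2 * j + 1" "c j"] c(1)[of j] j by simp
    then have "poly ?f (c j) \<noteq> 0" unfolding poly_end_poly end_set_def by (subst prod_zero_iff) auto
    ultimately show "poly (pderiv A) (c j) = 0" by simp
  qed simp
  then obtain D where D: "pderiv A = ?r * D" by blast
  have r0: "?r \<noteq> 0" using band_poly_props(2)[OF e] by auto
  have "?r\<^sup>2 * (?f * D\<^sup>2) = ?r\<^sup>2 * ([:(real n)\<^sup>2:] * (A\<^sup>2 - 1))"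
    using id unfolding D by (simp only: power_mult_distrib mult_ac)
  moreover have "?r\<^sup>2 \<noteq> 0" using r0 by simp
  ultimately have fD: "?f * D\<^sup>2 = [:(real n)\<^sup>2:] * (A\<^sup>2 - 1)"
    unfolding mult_cancel_left by blast
  show ?thesis
  proof (rule that)
    let ?B = "[:1 / real n:] * D"
    have "?B\<^sup>2 = [:1 / (real n)\<^sup>2:] * D\<^sup>2"
      unfolding power_mult_distrib by (simp add: power2_eq_square)
    then have "?f * ?B\<^sup>2 = [:1 / (real n)\<^sup>2:] * (?f * D\<^sup>2)" by (simp only: mult_ac)
    also have "\<dots> = A\<^sup>2 - 1" unfolding fD mult.assoc[symmetric] using n(1) by simp
    finally show "A\<^sup>2 - ?f * ?B\<^sup>2 = 1" by simp
    \<comment> \<open>Otherwise \<open>A\<close> is constant, which forces \<open>h\<close> to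
      vanish right of the ends, although its derivative is positive there.\<close>
    have "D \<noteq> 0"
    proof
      assume "D = 0"
      define x where "x = e (2 * g + 1) + 1"
      have "h t = 0" if "e (2 * g + 1) < t" for t
        using derA[OF that] outer[OF that] D \<open>D = 0\<close> n(1) by simp
      then have "\<forall>\<^sub>F t in nhds x. h t = 0"
        using eventually_nhds_in_open[of "{e (2 * g + 1)<..}" x] by (auto elim!: eventually_mono simp: x_def)
      then have "(h has_real_derivative 0) (at x)"
        by (rule DERIV_cong_ev[OF refl _ refl, THEN iffD2, OF _ DERIV_const])
      moreover have x: "e (2 * g + 1) < x" by (simp add: x_def)
      ultimately have "n * (poly ?r x / sqrt (end_prod g e x)) = 0"
        using outer[OF x] DERIV_unique by blast
      then show False using outer[OF x] n(1) by simp
    qed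
    then show "?B \<noteq> 0" using n(1) by simp
  qed
qed

section \<open>The function field and its Laurent expansions at infinity\<close>

text \<open>The variable of the Laurent series stands for \<open>1 / x\<close>, so that
  \<open>fls_subdegree\<close> is the order of vanishing at \<open>x = \<infinity>\<close>.\<close>

definition laurent :: "real poly \<Rightarrow> real fls" where
  "laurent p = poly (map_poly fls_const p) fls_X_inv"

lemma laurent_0 [simp]: "laurent 0 = 0"
  by (simp add: laurent_def)

lemma laurent_pCons: "laurent (pCons a p) = fls_const a + fls_X_inv * laurent p"
  by (simp add: laurent_def map_poly_pCons)

lemma laurent_nth: "fls_nth (laurent p) n = (if n \<le> 0 then poly.coeff p (nat (- n)) else 0)"
proof (induction p arbitrary: n)
  case (pCons a p)
  have "fls_nth (laurent (pCons a p)) n = (if n = 0 then a else 0) + fls_nth (laurent p) (n + 1)"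
    by (simp add: laurent_pCons fls_X_inv_times_conv_shift)
  moreover have "nat (- n) = Suc (nat (- (n + 1)))" if "n < 0" using that by auto
  ultimately show ?case by (cases "n = 0"; cases "n < 0") (auto simp: pCons.IH)
qed simp

lemma laurent_1 [simp]: "laurent 1 = 1"
  by (intro fls_eqI) (simp add: laurent_nth)

lemma laurent_add: "laurent (p + q) = laurent p + laurent q"
  by (intro fls_eqI) (simp add: laurent_nth)

lemma laurent_smult: "laurent (Polynomial.smult a q) = fls_const a * laurent q"
  by (intro fls_eqI) (simp add: laurent_nth)

lemma laurent_mult: "laurent (p * q) = laurent p * laurent q"
proof (induction p)
  case (pCons a p)
  have "laurent (pCons a p * q) = fls_const a * laurent q + fls_X_inv * laurent (p * q)"
    by (simp add: laurent_add laurent_smult laurent_pCons)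
  then show ?case by (simp add: pCons.IH laurent_pCons algebra_simps)
qed simp

lemma laurent_eq_0_iff [simp]: "laurent p = 0 \<longleftrightarrow> p = 0"
proof
  assume "laurent p = 0"
  then have "fls_nth (laurent p) (- int (degree p)) = 0" by simp
  then show "p = 0" by (simp add: laurent_nth)
qed simp

lemma laurent_subdegree: "fls_subdegree (laurent p) = - int (degree p)"
proof (cases "p = 0")
  case False
  show ?thesis
  proof (rule fls_subdegree_eqI)
    show "fls_nth (laurent p) (- int (degree p)) \<noteq> 0" using False by (simp add: laurent_nth)
    show "fls_nth (laurent p) k = 0" if "k < - int (degree p)" for k
      using that by (auto simp: laurent_nth intro!: coeff_eq_0)
  qed
qed simp

definition fract_laurent :: "real poly fract \<Rightarrow> real fls" where
  "fract_laurent u = (THE z. \<exists>p q. q \<noteq> 0 \<and> u = Fraction_Field.Fract p q \<and> z = laurent p / laurent q)"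

lemma fract_laurent_Fract:
  assumes "q \<noteq> 0" shows "fract_laurent (Fraction_Field.Fract p q) = laurent p / laurent q"
  unfolding fract_laurent_def
proof (rule the_equality)
  show "\<exists>p' q'. q' \<noteq> 0 \<and> Fraction_Field.Fract p q = Fraction_Field.Fract p' q' \<and>
      laurent p / laurent q = laurent p' / laurent q'" using assms by blast
next
  fix z assume "\<exists>p' q'. q' \<noteq> 0 \<and> Fraction_Field.Fract p q = Fraction_Field.Fract p' q' \<and> z = laurent p' / laurent q'"
  then obtain p' q' where "q' \<noteq> 0" "Fraction_Field.Fract p q = Fraction_Field.Fract p' q'"
    and z: "z = laurent p' / laurent q'" by blast
  then have "p * q' = p' * q" using assms by (simp add: eq_fract)
  then have "laurent p * laurent q' = laurent p' * laurent q" by (metis laurent_mult)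
  then show "z = laurent p / laurent q" using assms \<open>q' \<noteq> 0\<close> unfolding z by (simp add: frac_eq_eq)
qed

lemma fract_laurent_0 [simp]: "fract_laurent 0 = 0"
  by (simp add: Zero_fract_def fract_laurent_Fract)

lemma fract_laurent_1 [simp]: "fract_laurent 1 = 1"
  by (simp add: One_fract_def fract_laurent_Fract)

lemma fract_laurent_poly: "fract_laurent (Fraction_Field.Fract p 1) = laurent p"
  by (simp add: fract_laurent_Fract)

lemma fract_laurent_add: "fract_laurent (u + v) = fract_laurent u + fract_laurent v"
  by (cases u; cases v) (simp add: fract_laurent_Fract laurent_add laurent_mult add_frac_eq)

lemma fract_laurent_mult: "fract_laurent (u * v) = fract_laurent u * fract_laurent v"
  by (cases u; cases v) (simp add: fract_laurent_Fract laurent_mult)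

lemma fract_laurent_uminus: "fract_laurent (- u) = - fract_laurent u"
  using fract_laurent_add[of u "- u"] by (simp add: eq_neg_iff_add_eq_0 add.commute)

lemma fract_laurent_diff: "fract_laurent (u - v) = fract_laurent u - fract_laurent v"
  using fract_laurent_add[of u "- v"] by (simp add: fract_laurent_uminus)

lemma fract_laurent_eq_0_iff [simp]: "fract_laurent u = 0 \<longleftrightarrow> u = 0"
proof
  assume "fract_laurent u = 0"
  moreover obtain p q where "u = Fraction_Field.Fract p q" "q \<noteq> 0" by (cases u)
  ultimately show "u = 0" by (simp add: fract_laurent_Fract eq_fract Zero_fract_def)
qed simp

text \<open>A Laurent series has finitely many terms up to index \<open>N\<close>. Multiplied by
  \<open>x ^ N\<close> their sum becomes a polynomial in \<open>x\<close>, so \<open>u\<close> is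
  that polynomial over \<open>x ^ N\<close>.\<close>

lemma laurent_truncation:
  obtains u :: "real poly fract" where "\<And>n. n \<le> int N \<Longrightarrow> fls_nth (fract_laurent u) n = fls_nth Z n"
proof -
  define M where "M = nat (int N - fls_subdegree Z)"
  define p where "p = (\<Sum>j\<le>M. Polynomial.monom (fls_nth Z (int N - int j)) j)"
  define u where "u = Fraction_Field.Fract p (Polynomial.monom 1 N)"
  have coeff: "poly.coeff p j = fls_nth Z (int N - int j)" for j
  proof -
    have "poly.coeff p j = (if j \<le> M then fls_nth Z (int N - int j) else 0)"
      by (simp add: p_def coeff_sum if_distrib cong: if_cong)
    moreover have "fls_nth Z (int N - int j) = 0" if "\<not> j \<le> M"
      by (rule fls_eq0_below_subdegree) (use that in \<open>unfold M_def, arith\<close>)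
    ultimately show ?thesis by simp
  qed
  have "laurent (Polynomial.monom 1 N) = fls_shift (int N) 1"
    by (intro fls_eqI) (auto simp: laurent_nth)
  moreover have "fls_shift (int N) (1 :: real fls) \<noteq> 0"
    using fls_X_intpow_nonzero[of "- int N"] by simp
  ultimately have "fract_laurent u * fls_shift (int N) 1 = laurent p"
    by (simp add: u_def fract_laurent_Fract monom_eq_0_iff)
  then have "fls_shift (int N) (fract_laurent u) = laurent p"
    using fls_X_intpow_times_conv_shift(2)[of "fract_laurent u" "- int N"] by simp
  then have nth: "fls_nth (fract_laurent u) n = fls_nth (laurent p) (n - int N)" for n
    by (metis diff_add_cancel fls_shift_nth)
  show ?thesis
    by (rule that[of u]) (auto simp: nth laurent_nth coeff)
qed

section \<open>The quadratic extension and its two embeddings into Laurent series\<close>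

definition hyp_mult :: "real poly \<Rightarrow> hyp_fun \<Rightarrow> hyp_fun \<Rightarrow> hyp_fun" where
  "hyp_mult f h h' = (fst h * fst h' + Fraction_Field.Fract f 1 * (snd h * snd h'), fst h * snd h' + snd h * fst h')"

lemma hyp_field_simps [simp]:
  "carrier (hyp_field f) = UNIV" "h \<otimes>\<^bsub>hyp_field f\<^esub> h' = hyp_mult f h h'" "\<one>\<^bsub>hyp_field f\<^esub> = (1, 0)"
  "\<zero>\<^bsub>hyp_field f\<^esub> = 0" "h \<oplus>\<^bsub>hyp_field f\<^esub> h' = h + h'"
  by (auto simp: hyp_field_def hyp_mult_def case_prod_unfold plus_prod_def zero_prod_def)

text \<open>A root of odd order prevents f from being a square, so the pairs form a field. Even
  degree and leading coefficient 1 make f a square among the real Laurent series at infinity, whence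
  two rational places there.\<close>

locale hyp_curve =
  fixes f :: "real poly" and m :: nat
  assumes monic: "lead_coeff f = 1" and deg: "degree f = 2 * m" and odd_root: "\<exists>a. odd (Polynomial.order a f)"
begin

abbreviation K :: "hyp_fun ring" where "K \<equiv> hyp_field f"

abbreviation F :: "real poly fract" where "F \<equiv> Fraction_Field.Fract f 1"

lemma f_nonzero: "f \<noteq> 0"
  using monic by auto

text \<open>At a root \<open>a\<close> of odd order in f, the order of \<open>p\<^sup>2\<close> is
  even and that of \<open>f * q\<^sup>2\<close> is odd.\<close>

lemma norm_nonzero:
  assumes "u * u = F * (w * w)" shows "u = 0 \<and> w = 0"
proof (rule ccontr)
  assume *: "\<not> ?thesis"
  have F0: "F \<noteq> 0" using f_nonzero by (simp add: Zero_fract_def eq_fract)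
  have w: "w \<noteq> 0" using * assms by auto
  obtain p q where pq: "u / w = Fraction_Field.Fract p q" "q \<noteq> 0" by (cases "u / w")
  have "(u / w) * (u / w) = F" using assms w by (simp add: field_simps)
  then have eq: "p * p = f * (q * q)" using pq by (simp add: eq_fract)
  then have p: "p \<noteq> 0" using pq f_nonzero by auto
  obtain a where a: "odd (Polynomial.order a f)" using odd_root by blast
  have "Polynomial.order a p + Polynomial.order a p = Polynomial.order a f + (Polynomial.order a q + Polynomial.order a q)"
    using arg_cong[OF eq, of "Polynomial.order a"] p pq(2) f_nonzero by (simp add: order_mult)
  then show False using a by presburger
qed

definition hyp_inv :: "hyp_fun \<Rightarrow> hyp_fun" where
  "hyp_inv h = (let N = fst h * fst h - F * (snd h * snd h) in (fst h / N, - snd h / N))"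

lemma hyp_inv: assumes "h \<noteq> 0" shows "hyp_mult f h (hyp_inv h) = (1, 0)"
proof -
  define N where "N = fst h * fst h - F * (snd h * snd h)"
  have "N \<noteq> 0"
  proof
    assume "N = 0"
    then have "fst h * fst h = F * (snd h * snd h)" by (simp only: N_def right_minus_eq)
    then have "fst h = 0" "snd h = 0" using norm_nonzero by blast+
    then show False using assms by (cases h) (simp add: zero_prod_def)
  qed
  have "a * (a / M) + F * (b * (- b / M)) = (a * a - F * (b * b)) / M" for a b M :: "real poly fract"
    by (simp add: diff_divide_distrib)
  then have "fst h * (fst h / N) + F * (snd h * (- snd h / N)) = N / N"
    unfolding N_def by blast
  moreover have "fst h * (- snd h / N) + snd h * (fst h / N) = 0"
    by (simp add: mult.commute)
  ultimately show ?thesis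
    unfolding hyp_mult_def hyp_inv_def N_def[symmetric] Let_def fst_conv snd_conv
    using \<open>N \<noteq> 0\<close> by simp
qed

lemma field_K: "field K"
proof -
  have ag: "abelian_group K"
  proof (rule abelian_groupI)
    show "\<exists>y\<in>carrier K. y \<oplus>\<^bsub>K\<^esub> x = \<zero>\<^bsub>K\<^esub>" for x by (intro bexI[of _ "- x"]) simp_all
  qed (simp_all add: ac_simps)
  have cm: "comm_monoid K"
    by (rule comm_monoidI) (auto simp: hyp_mult_def algebra_simps)
  have "cring K"
    by (rule cringI[OF ag cm]) (auto simp: hyp_mult_def algebra_simps)
  then show ?thesis
  proof (rule cring.cring_fieldI2)
    show "\<exists>b\<in>carrier K. a \<otimes>\<^bsub>K\<^esub> b = \<one>\<^bsub>K\<^esub>" if "a \<noteq> \<zero>\<^bsub>K\<^esub>" for a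
      by (rule bexI[of _ "hyp_inv a"]) (use hyp_inv that in simp_all)
  qed (simp add: zero_prod_def)
qed

text \<open>The Laurent expansion at infinity of the root of f with leading term
  \<open>x ^ m\<close>.\<close>

definition Y :: "real fls" where
  "Y = (SOME z. z * z = laurent f \<and> fls_subdegree z = - int m \<and> fls_nth z (- int m) = 1)"

lemma Y: "Y * Y = laurent f" "fls_subdegree Y = - int m" "fls_nth Y (- int m) = 1"
proof -
  define B where "B = fls_base_factor_to_fps (laurent f)"
  have lf: "laurent f = fls_shift (2 * int m) (fps_to_fls B)"
    using fls_conv_base_factor_to_fps_shift_subdegree[of "laurent f"] deg
    by (simp add: B_def laurent_subdegree)
  have B0: "fps_nth B 0 = 1"
    using arg_cong[OF lf, of "\<lambda>z. fls_nth z (- 2 * int m)"] monic deg by (simp add: laurent_nth nat_mult_distrib)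
  \<comment> \<open>\<open>fps_radical\<close> takes a function supplying roots of the constant
    coefficient. Here that coefficient is 1, and 1 serves as its root.\<close>
  define r :: "nat \<Rightarrow> real \<Rightarrow> real" where "r n x = 1" for n x
  define R where "R = fps_radical r 2 B"
  have R: "R * R = B"
    using power_radical[of B r 1] B0 by (simp add: R_def r_def numeral_2_eq_2 power2_eq_square)
  have R0: "fps_nth R 0 = 1" by (simp add: R_def r_def)
  define z where "z = fls_shift (int m) (fps_to_fls R)"
  have "z * z = laurent f"
    unfolding z_def lf fls_shifted_times_simps by (simp add: R flip: fls_times_fps_to_fls)
  moreover have "fls_nth z (- int m) = 1" by (simp add: z_def R0)
  moreover from this have "fls_subdegree z = - int m"
    by (intro fls_subdegree_eqI) (auto simp: z_def)
  ultimately have "\<exists>z. z * z = laurent f \<and> fls_subdegree z = - int m \<and> fls_nth z (- int m) = 1" by blast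
  from someI_ex[OF this] show "Y * Y = laurent f" "fls_subdegree Y = - int m" "fls_nth Y (- int m) = 1"
    unfolding Y_def by auto
qed

text \<open>Sends \<open>y\<close> to \<open>s * Y\<close>. For \<open>s = 1\<close> and
  \<open>s = - 1\<close> these are the completions of the function field at the two points over
  infinity.\<close>

definition emb :: "real \<Rightarrow> hyp_fun \<Rightarrow> real fls" where
  "emb s h = fract_laurent (fst h) + fls_const s * (fract_laurent (snd h) * Y)"

lemma emb_add: "emb s (h + h') = emb s h + emb s h'"
  by (simp add: emb_def fract_laurent_add algebra_simps)

lemma emb_diff: "emb s (h - h') = emb s h - emb s h'"
  by (simp add: emb_def fract_laurent_diff algebra_simps)

lemma emb_mult: assumes "s * s = 1" shows "emb s (hyp_mult f h h') = emb s h * emb s h'"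
proof -
  have "fls_const s * fls_const s = 1" using assms by simp
  then have 1: "fls_const s * (fls_const s * z) = z" for z :: "real fls" by (simp only: mult.assoc[symmetric] mult_1_left)
  have 2: "Y * (Y * z) = laurent f * z" for z using Y(1) by (simp only: mult.assoc[symmetric])
  show ?thesis
    by (simp add: emb_def hyp_mult_def fract_laurent_add fract_laurent_mult fract_laurent_poly distrib_left distrib_right
        mult.assoc mult.left_commute 1 2 Y(1) del: fls_const_mult_const)
qed

lemma emb_eq_0_iff: assumes "s * s = 1" shows "emb s h = 0 \<longleftrightarrow> h = 0"
proof
  assume 0: "emb s h = 0"
  have "emb s (hyp_mult f h (fst h, - snd h)) = 0" using 0 by (simp add: emb_mult[OF assms])
  moreover have "hyp_mult f h (fst h, - snd h) = (fst h * fst h - F * (snd h * snd h), 0)"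
    by (simp add: hyp_mult_def algebra_simps)
  ultimately have "fst h * fst h - F * (snd h * snd h) = 0" by (simp add: emb_def del: right_minus_eq)
  then have "fst h * fst h = F * (snd h * snd h)" by (simp only: right_minus_eq)
  then have "fst h = 0" "snd h = 0" using norm_nonzero by blast+
  then show "h = 0" by (cases h) (simp add: zero_prod_def)
qed (simp add: emb_def zero_prod_def)

end

section \<open>Places at infinity\<close>

lemma hyp_const_eq: "hyp_const c = (Fraction_Field.Fract [:c:] 1, 0)"
  by (simp add: hyp_const_def)

lemma hyp_const_0_iff: "hyp_const c = 0 \<longleftrightarrow> c = 0"
  by (simp add: hyp_const_def zero_prod_def Zero_fract_def eq_fract)

lemma hyp_mult_fract: "hyp_mult f (u, 0) (u', w') = (u * u', u * w')"
  by (simp add: hyp_mult_def)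

lemma hyp_mult_commute: "hyp_mult f h h' = hyp_mult f h' h"
  by (simp add: hyp_mult_def mult.commute add.commute)

definition xpow :: "nat \<Rightarrow> real poly fract" where
  "xpow n = Fraction_Field.Fract (Polynomial.monom 1 n) 1"

lemma xpow_nonzero [simp]: "xpow n \<noteq> 0"
  by (simp add: xpow_def Zero_fract_def eq_fract monom_eq_0_iff)

lemma xpow_add: "xpow (n + n') = xpow n * xpow n'"
  by (simp add: xpow_def mult_monom)

lemma fract_laurent_xpow: "fls_nth (fract_laurent (xpow n)) k = (if k = - int n then 1 else 0)"
  by (auto simp: xpow_def fract_laurent_poly laurent_nth)

lemma fract_laurent_const: "fract_laurent (Fraction_Field.Fract [:c:] 1) = fls_const c"
  by (simp add: fract_laurent_poly laurent_pCons)

context hyp_curve begin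

lemma mem_maximal_ideal [simp]: "h \<in> maximal_ideal_of K v \<longleftrightarrow> h = 0 \<or> 0 < v h"
  by (auto simp: maximal_ideal_of_def)

lemma mem_valuation_ring [simp]: "h \<in> valuation_ring_of K v \<longleftrightarrow> h = 0 \<or> 0 \<le> v h"
  by (auto simp: valuation_ring_of_def)

lemma hyp_mult_eq_0_iff: "hyp_mult f h h' = 0 \<longleftrightarrow> h = 0 \<or> h' = 0"
proof -
  have "emb 1 (hyp_mult f h h') = 0 \<longleftrightarrow> emb 1 h = 0 \<or> emb 1 h' = 0" by (simp add: emb_mult)
  then show ?thesis by (simp only: emb_eq_0_iff[of 1] mult_1)
qed

lemma hyp_mult_const: "hyp_mult f (hyp_const c) h = (Fraction_Field.Fract [:c:] 1 * fst h, Fraction_Field.Fract [:c:] 1 * snd h)"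
  by (simp add: hyp_mult_def hyp_const_def)

lemma hyp_mult_minus_one: "hyp_mult f (hyp_const (- 1)) h = - h"
proof -
  have "Fraction_Field.Fract [:- 1:] 1 = (- 1 :: real poly fract)"
    by (simp add: One_fract_def one_pCons)
  then show ?thesis by (simp add: hyp_mult_const uminus_prod_def)
qed

lemma places_iff: "v \<in> places K hyp_constants \<longleftrightarrow> v \<in> extensional (UNIV - {0}) \<and> v ` (UNIV - {0}) = UNIV \<and>
    (\<forall>h h'. h \<noteq> 0 \<longrightarrow> h' \<noteq> 0 \<longrightarrow> v (hyp_mult f h h') = v h + v h' \<and>
       (h + h' \<noteq> 0 \<longrightarrow> min (v h) (v h') \<le> v (h + h'))) \<and>
    (\<forall>c. c \<noteq> 0 \<longrightarrow> v (hyp_const c) = 0)"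
proof -
  have "(\<forall>c \<in> hyp_constants - {0}. v c = 0) \<longleftrightarrow> (\<forall>c. c \<noteq> 0 \<longrightarrow> v (hyp_const c) = 0)"
    by (auto simp: hyp_const_0_iff)
  then show ?thesis
    unfolding places_def by (simp add: Ball_def del: split_paired_All)
qed

definition place_at :: "real \<Rightarrow> hyp_fun \<Rightarrow> int" where
  "place_at s = restrict (\<lambda>h. fls_subdegree (emb s h)) (UNIV - {0})"

lemma place_at: "h \<noteq> 0 \<Longrightarrow> place_at s h = fls_subdegree (emb s h)"
  by (simp add: place_at_def)

lemma place_at_in_places:
  assumes s: "s * s = 1" shows "place_at s \<in> places K hyp_constants"
  unfolding places_iff
proof (intro conjI allI impI)
  show "place_at s \<in> extensional (UNIV - {0})" by (simp add: place_at_def)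
  fix h h' :: hyp_fun assume h: "h \<noteq> 0" "h' \<noteq> 0"
  then show "place_at s (hyp_mult f h h') = place_at s h + place_at s h'"
    by (simp add: place_at hyp_mult_eq_0_iff emb_mult[OF s] emb_eq_0_iff[OF s])
  assume "h + h' \<noteq> 0"
  then show "min (place_at s h) (place_at s h') \<le> place_at s (h + h')"
    using h fls_plus_subdegree[of "emb s h" "emb s h'"] emb_eq_0_iff[OF s, of "h + h'"] by (simp add: place_at emb_add)
next
  fix c :: real assume "c \<noteq> 0"
  then have "hyp_const c \<noteq> 0" by (simp add: hyp_const_0_iff)
  then show "place_at s (hyp_const c) = 0"
    by (simp add: place_at emb_def hyp_const_eq fract_laurent_const)
next
  show "place_at s ` (UNIV - {0}) = UNIV"
  proof (intro equalityI subset_UNIV subsetI)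
    fix k :: int
    \<comment> \<open>Surjectivity is witnessed by \<open>x ^ nat (- k) / x ^ nat k\<close>; at most
      one of the two exponents is nonzero, according to the sign of \<open>k\<close>.\<close>
    have "fract_laurent (xpow n) \<noteq> 0" "fls_subdegree (fract_laurent (xpow n)) = - int n" for n
      by (simp, intro fls_subdegree_eqI) (simp_all add: fract_laurent_xpow)
    moreover have "fract_laurent (xpow (nat (- k)) / xpow (nat k)) * fract_laurent (xpow (nat k)) = fract_laurent (xpow (nat (- k)))"
      by (simp flip: fract_laurent_mult)
    then have "fls_subdegree (fract_laurent (xpow (nat (- k)) / xpow (nat k)) * fract_laurent (xpow (nat k))) =
        fls_subdegree (fract_laurent (xpow (nat (- k))))" by (rule arg_cong)
    ultimately have "fls_subdegree (fract_laurent (xpow (nat (- k)) / xpow (nat k))) = k" by (simp split: if_splits)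
    then have "place_at s (xpow (nat (- k)) / xpow (nat k), 0) = k"
      by (simp add: place_at zero_prod_def emb_def)
    moreover have "(xpow (nat (- k)) / xpow (nat k), 0 :: real poly fract) \<noteq> 0" by (simp add: zero_prod_def)
    ultimately show "k \<in> place_at s ` (UNIV - {0})" by (metis DiffI UNIV_I image_eqI singletonD)
  qed
qed

context
  fixes v assumes v: "v \<in> places K hyp_constants"
begin

lemma place_mult: "h \<noteq> 0 \<Longrightarrow> h' \<noteq> 0 \<Longrightarrow> v (hyp_mult f h h') = v h + v h'"
  using v unfolding places_iff by blast

lemma place_add: "h \<noteq> 0 \<Longrightarrow> h' \<noteq> 0 \<Longrightarrow> h + h' \<noteq> 0 \<Longrightarrow> min (v h) (v h') \<le> v (h + h')"
  using v unfolding places_iff by blast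

lemma place_const: "c \<noteq> 0 \<Longrightarrow> v (hyp_const c) = 0"
  using v unfolding places_iff by blast

lemma place_uminus: "v (- h) = v h"
proof (cases "h = 0")
  case False
  then show ?thesis
    using place_mult[of "hyp_const (- 1)" h] place_const[of "- 1"]
    by (simp add: hyp_mult_minus_one hyp_const_0_iff)
qed simp

lemma place_add_eq:
  assumes "h \<noteq> 0" "h' = 0 \<or> v h < v h'" shows "h + h' \<noteq> 0" "v (h + h') = v h"
proof -
  have "h + h' \<noteq> 0 \<and> v (h + h') = v h"
  proof (cases "h' = 0")
    case False
    then have lt: "v h < v h'" using assms by simp
    have nz: "h + h' \<noteq> 0"
    proof
      assume "h + h' = 0"
      then have "h' = - h" by (simp add: eq_neg_iff_add_eq_0 add.commute)
      then show False using lt place_uminus[of h] by simp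
    qed
    have "min (v h) (v h') \<le> v (h + h')" using assms False nz by (intro place_add)
    moreover have "min (v (h + h')) (v (- h')) \<le> v ((h + h') + - h')"
      using assms False nz by (intro place_add) auto
    then have "min (v (h + h')) (v h') \<le> v h" by (simp add: place_uminus)
    ultimately show ?thesis using nz lt by auto
  qed (use assms in simp)
  then show "h + h' \<noteq> 0" "v (h + h') = v h" by auto
qed

lemma maximal_ideal_add:
  assumes "h \<in> maximal_ideal_of K v" "h' \<in> maximal_ideal_of K v" shows "h + h' \<in> maximal_ideal_of K v"
proof (cases "h = 0 \<or> h' = 0 \<or> h + h' = 0")
  case False
  then show ?thesis using place_add[of h h'] assms by auto
qed (use assms in auto)

lemma maximal_ideal_diff:
  "h \<in> maximal_ideal_of K v \<Longrightarrow> h' \<in> maximal_ideal_of K v \<Longrightarrow> h - h' \<in> maximal_ideal_of K v"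
  using maximal_ideal_add[of h "- h'"] place_uminus[of h'] by simp

lemma valuation_ring_add:
  assumes "h \<in> valuation_ring_of K v" "h' \<in> valuation_ring_of K v" shows "h + h' \<in> valuation_ring_of K v"
proof (cases "h = 0 \<or> h' = 0 \<or> h + h' = 0")
  case False
  then show ?thesis using place_add[of h h'] assms by auto
qed (use assms in auto)

lemma valuation_ring_mult:
  assumes "h \<in> valuation_ring_of K v" "h' \<in> valuation_ring_of K v" shows "hyp_mult f h h' \<in> valuation_ring_of K v"
  using assms place_mult[of h h'] by (cases "h = 0 \<or> h' = 0") (auto simp: hyp_mult_eq_0_iff)

lemma maximal_ideal_mult:
  assumes "h \<in> valuation_ring_of K v" "h' \<in> maximal_ideal_of K v" shows "hyp_mult f h h' \<in> maximal_ideal_of K v"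
  using assms place_mult[of h h'] by (cases "h = 0 \<or> h' = 0") (auto simp: hyp_mult_eq_0_iff)

lemma valuation_ring_const: "hyp_const c \<in> valuation_ring_of K v"
  using place_const[of c] by (cases "c = 0") (auto simp: hyp_const_0_iff)

lemma place_const_in_maximal_ideal: "hyp_const c \<in> maximal_ideal_of K v \<Longrightarrow> c = 0"
  using place_const[of c] by (cases "c = 0") (auto simp: hyp_const_0_iff)

lemma place_inv: "h \<noteq> 0 \<Longrightarrow> v (hyp_inv h) = - v h"
proof -
  assume h: "h \<noteq> 0"
  have "(1, 0) = hyp_const 1" by (simp add: hyp_const_def One_fract_def pCons_one)
  then have *: "hyp_mult f h (hyp_inv h) = hyp_const 1" using hyp_inv[OF h] by simp
  then have "hyp_inv h \<noteq> 0" using hyp_mult_eq_0_iff[of h "hyp_inv h"] hyp_const_0_iff[of 1] by auto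
  then show ?thesis using place_mult[OF h, of "hyp_inv h"] * place_const[of 1] by simp
qed

lemma poly_element: "(Fraction_Field.Fract (pCons a p) 1, 0) = hyp_const a + hyp_mult f hyp_x (Fraction_Field.Fract p 1, 0)"
  by (simp add: hyp_const_def hyp_x_def hyp_mult_fract)

lemma place_poly_nonneg:
  assumes "0 \<le> v hyp_x" shows "(Fraction_Field.Fract p 1, 0) \<in> valuation_ring_of K v"
proof (induction p)
  case 0
  then show ?case by (simp add: zero_prod_def Zero_fract_def)
next
  case (pCons a p)
  show ?case unfolding poly_element
    using assms pCons.IH by (intro valuation_ring_add valuation_ring_const valuation_ring_mult) auto
qed

context
  assumes pole: "v hyp_x < 0"
begin

text \<open>At a pole of \<open>x\<close> the term \<open>x * P\<close> has a strictly smaller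
  valuation than the constant, so in Horner form the leading term alone decides.\<close>

lemma place_poly: "p \<noteq> 0 \<Longrightarrow> v (Fraction_Field.Fract p 1, 0) = v hyp_x * int (degree p)"
proof (induction p)
  case (pCons a p)
  have x0: "hyp_x \<noteq> 0" by (simp add: hyp_x_def zero_prod_def Zero_fract_def eq_fract)
  show ?case
  proof (cases "p = 0")
    case True
    then show ?thesis using place_const[of a] pCons by (simp add: hyp_const_def)
  next
    case False
    let ?P = "(Fraction_Field.Fract p 1, 0 :: real poly fract)"
    have P: "?P \<noteq> 0" using False by (simp add: zero_prod_def Zero_fract_def eq_fract)
    have vP: "v (hyp_mult f hyp_x ?P) = v hyp_x * (1 + int (degree p))"
      using place_mult[OF x0 P] pCons.IH[OF False] by (simp add: algebra_simps)
    have "v (hyp_mult f hyp_x ?P) < 0" unfolding vP using pole by (simp add: mult_neg_pos)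
    then have "hyp_const a = 0 \<or> v (hyp_mult f hyp_x ?P) < v (hyp_const a)"
      using place_const[of a] by (cases "a = 0") (auto simp: hyp_const_0_iff)
    then have "v (hyp_mult f hyp_x ?P + hyp_const a) = v (hyp_mult f hyp_x ?P)"
      using P x0 by (intro place_add_eq) (auto simp: hyp_mult_eq_0_iff)
    then show ?thesis using vP False unfolding poly_element by (simp add: add.commute)
  qed
qed simp

lemma place_fract:
  assumes "u \<noteq> 0" shows "v (u, 0) = - v hyp_x * fls_subdegree (fract_laurent u)"
proof -
  obtain p q where pq: "u = Fraction_Field.Fract p q" "q \<noteq> 0" by (cases u)
  have p: "p \<noteq> 0" using assms pq by (auto simp: Zero_fract_def eq_fract)
  have nz: "(u, 0 :: real poly fract) \<noteq> 0" "(Fraction_Field.Fract q 1, 0 :: real poly fract) \<noteq> 0"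
    using assms pq by (simp_all add: zero_prod_def Zero_fract_def eq_fract)
  have "hyp_mult f (u, 0) (Fraction_Field.Fract q 1, 0) = (Fraction_Field.Fract p 1, 0)"
    unfolding hyp_mult_fract pq(1) using pq(2) by (simp add: eq_fract)
  then have A: "v (u, 0) + v hyp_x * int (degree q) = v hyp_x * int (degree p)"
    using place_mult[OF nz] place_poly[OF p] place_poly[OF pq(2)] by simp
  have B: "fls_subdegree (fract_laurent u) = int (degree q) - int (degree p)"
    unfolding pq(1) fract_laurent_Fract[OF pq(2)] using p pq(2) by (simp add: fls_divide_subdegree laurent_subdegree)
  show ?thesis unfolding B using A by (simp add: algebra_simps)
qed

text \<open>If the expansion of \<open>u\<close> begins like \<open>c * x ^ n\<close>, then
  \<open>u / x ^ n\<close> takes the value \<open>c\<close>. This is claimed at every place with a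
  pole at \<open>x\<close>, before such places have been identified.\<close>

lemma leading_quotient:
  assumes "\<And>k. k \<le> - int n \<Longrightarrow> fls_nth (fract_laurent u) k = c * fls_nth (fract_laurent (xpow n)) k"
  shows "(u / xpow n, 0) - hyp_const c \<in> maximal_ideal_of K v"
proof -
  define w where "w = u / xpow n - Fraction_Field.Fract [:c:] 1"
  have eq: "(u / xpow n, 0) - hyp_const c = (w, 0)" by (simp add: w_def hyp_const_def minus_prod_def)
  show ?thesis
  proof (cases "w = 0")
    case False
    have "w * xpow n = u - Fraction_Field.Fract [:c:] 1 * xpow n" by (simp add: w_def field_simps)
    then have *: "fract_laurent w * fract_laurent (xpow n) = fract_laurent u - fls_const c * fract_laurent (xpow n)"
      by (metis fract_laurent_mult fract_laurent_diff fract_laurent_const)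
    have "- int n < fls_subdegree (fract_laurent w * fract_laurent (xpow n))"
    proof -
      have "- int n + 1 \<le> fls_subdegree (fract_laurent w * fract_laurent (xpow n))"
      proof (rule fls_subdegree_geI)
        show "fract_laurent w * fract_laurent (xpow n) \<noteq> 0" using False by simp
        fix k assume "k < - int n + 1"
        then show "fls_nth (fract_laurent w * fract_laurent (xpow n)) k = 0"
          unfolding * using assms[of k] by simp
      qed
      then show ?thesis by simp
    qed
    moreover have "fls_subdegree (fract_laurent (xpow n)) = - int n"
      by (intro fls_subdegree_eqI) (simp_all add: fract_laurent_xpow)
    ultimately have "0 < fls_subdegree (fract_laurent w)" using False by simp
    then show ?thesis unfolding eq using place_fract[OF False] pole by (simp add: mult_neg_pos)
  qed (simp add: eq zero_prod_def)
qed

end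

end

end

context hyp_curve begin

text \<open>The function \<open>y / x ^ m\<close>, whose values 1 and -1 separate the two points
  over infinity.\<close>

abbreviation tau :: hyp_fun where "tau \<equiv> (0, 1 / xpow m)"

text \<open>A place with a pole at \<open>x\<close> is determined by its values on the elements \<open>y - P\<close>, where
  \<open>P\<close> is a truncation of the Laurent series of \<open>y\<close>; those follow from
  \<open>(y - P) (y + P) = f - P\<^sup>2\<close>, as \<open>y + P\<close> does not vanish at the place.\<close>

lemma place_eq_place_at:
  assumes v: "v \<in> places K hyp_constants" and pole: "v hyp_x < 0" and s: "s * s = 1"
    and tau: "tau - hyp_const s \<in> maximal_ideal_of K v"
  shows "v = place_at s"
proof -
  \<comment> \<open>The ramification index of \<open>v\<close> over \<open>x = \<infinity>\<close>.
    It turns out to be 1: all values of \<open>v\<close> are multiples of \<open>e\<close>, and 1 is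
    one of them.\<close>
  define e where "e = - v hyp_x"
  have e: "0 < e" using pole by (simp add: e_def)
  have s0: "s \<noteq> 0" using s by auto
  have vf: "v (u, 0) = e * fls_subdegree (fract_laurent u)" if "u \<noteq> 0" for u
    using place_fract[OF v pole that] by (simp add: e_def)
  define Z where "Z = fls_const s * Y"
  have Z: "fls_nth Z k = (if k = - int m then s else 0)" if "k \<le> - int m" for k
    using that Y(2,3) by (auto simp: Z_def)
  have approx: "\<exists>P. int N < fls_subdegree (emb s (- P, 1)) \<and> v (- P, 1) = e * fls_subdegree (emb s (- P, 1))" for N
  proof -
    obtain P where P: "\<And>k. k \<le> int N \<Longrightarrow> fls_nth (fract_laurent P) k = fls_nth Z k"
      using laurent_truncation[of N Z] by blast
    have nz: "(- P, 1) \<noteq> (0 :: hyp_fun)" "(P, 1) \<noteq> (0 :: hyp_fun)" "(xpow m, 0) \<noteq> (0 :: hyp_fun)"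
      by (simp_all add: zero_prod_def)
    have emb_minus: "emb s (- P, 1) = Z - fract_laurent P" by (simp add: emb_def Z_def fract_laurent_uminus)
    have emb_plus: "emb s (P, 1) = fract_laurent P + Z" by (simp add: emb_def Z_def)
    have "int N + 1 \<le> fls_subdegree (emb s (- P, 1))"
    proof (rule fls_subdegree_geI)
      show "emb s (- P, 1) \<noteq> 0" unfolding emb_eq_0_iff[OF s] by (rule nz(1))
      show "fls_nth (emb s (- P, 1)) n = 0" if "n < int N + 1" for n
        using P[of n] that by (simp add: emb_minus)
    qed
    then have 1: "int N < fls_subdegree (emb s (- P, 1))" by simp
    have sub_plus: "fls_subdegree (emb s (P, 1)) = - int m"
      by (rule fls_subdegree_eqI) (use P Z s0 in \<open>auto simp: emb_plus\<close>)
    have "(P / xpow m, 0) - hyp_const s \<in> maximal_ideal_of K v"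
      by (rule leading_quotient[OF v pole]) (use P Z in \<open>auto simp: fract_laurent_xpow\<close>)
    then have M: "(tau - hyp_const s) + ((P / xpow m, 0) - hyp_const s) \<in> maximal_ideal_of K v"
      by (rule maximal_ideal_add[OF v tau])
    have two: "hyp_const (2 * s) \<noteq> 0" "v (hyp_const (2 * s)) = 0"
      using s0 place_const[OF v, of "2 * s"] by (auto simp: hyp_const_0_iff)
    have "hyp_const (2 * s) = hyp_const s + hyp_const s" by (simp add: hyp_const_def)
    then have split: "(P / xpow m, 1 / xpow m) = hyp_const (2 * s) + ((tau - hyp_const s) + ((P / xpow m, 0) - hyp_const s))"
      by (simp add: algebra_simps)
    have "(P / xpow m, 1 / xpow m) \<noteq> (0 :: hyp_fun)" "v (P / xpow m, 1 / xpow m) = 0"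
      using place_add_eq[OF v two(1), of "(tau - hyp_const s) + ((P / xpow m, 0) - hyp_const s)"] M two(2)
      unfolding split[symmetric] by auto
    moreover have "hyp_mult f (xpow m, 0) (P / xpow m, 1 / xpow m) = (P, 1)" by (simp add: hyp_mult_fract)
    ultimately have "v (P, 1) = v (xpow m, 0)" using place_mult[OF v nz(3)] by (metis add.right_neutral)
    moreover have "fls_subdegree (fract_laurent (xpow m)) = - int m"
      by (intro fls_subdegree_eqI) (simp_all add: fract_laurent_xpow)
    ultimately have v_plus: "v (P, 1) = - e * int m" using vf[of "xpow m"] by simp
    define D where "D = F - P * P"
    have D: "hyp_mult f (- P, 1) (P, 1) = (D, 0)" by (simp add: hyp_mult_def D_def)
    then have "D \<noteq> 0" using hyp_mult_eq_0_iff[of "(- P, 1)" "(P, 1)"] nz by (auto simp: zero_prod_def)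
    have "fract_laurent D = emb s (- P, 1) * emb s (P, 1)"
      unfolding emb_mult[OF s, symmetric] D by (simp add: emb_def)
    then have "fls_subdegree (fract_laurent D) = fls_subdegree (emb s (- P, 1)) - int m"
      using nz emb_eq_0_iff[OF s] sub_plus by simp
    moreover have "v (- P, 1) + v (P, 1) = e * fls_subdegree (fract_laurent D)"
      using place_mult[OF v nz(1,2)] unfolding D vf[OF \<open>D \<noteq> 0\<close>] by simp
    ultimately have "v (- P, 1) + - e * int m = e * (fls_subdegree (emb s (- P, 1)) - int m)"
      unfolding v_plus by simp
    then have "v (- P, 1) = e * fls_subdegree (emb s (- P, 1))" by (simp add: right_diff_distrib)
    then show ?thesis using 1 by blast
  qed
  \<comment> \<open>With \<open>d = w * (y - P)\<close> one has \<open>h = r + d\<close> for a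
    rational function \<open>r\<close>. The approximation \<open>P\<close> is taken so close that
    \<open>d\<close> vanishes to higher order than \<open>h\<close>, so that \<open>r\<close> alone
    determines the valuation.\<close>
  have main: "v h = e * fls_subdegree (emb s h)" if h: "h \<noteq> 0" for h
  proof -
    obtain u w where uw: "h = (u, w)" by (cases h)
    show ?thesis
    proof (cases "w = 0")
      case True
      then show ?thesis using h vf[of u] by (simp add: uw emb_def zero_prod_def)
    next
      case False
      define k where "k = fls_subdegree (emb s h)"
      obtain P where P: "int (nat (k - fls_subdegree (fract_laurent w))) < fls_subdegree (emb s (- P, 1))"
        "v (- P, 1) = e * fls_subdegree (emb s (- P, 1))" using approx by blast
      define d where "d = hyp_mult f (w, 0) (- P, 1)"
      have nz: "(w, 0) \<noteq> (0 :: hyp_fun)" "(- P, 1) \<noteq> (0 :: hyp_fun)" using False by (simp_all add: zero_prod_def)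
      have emb_d: "emb s d = fract_laurent w * emb s (- P, 1)"
        unfolding d_def emb_mult[OF s] by (simp add: emb_def)
      have sub_d: "fls_subdegree (emb s d) = fls_subdegree (fract_laurent w) + fls_subdegree (emb s (- P, 1))"
        unfolding emb_d using False nz(2) emb_eq_0_iff[OF s] by simp
      have kd: "k < fls_subdegree (emb s d)" using P(1) unfolding sub_d by linarith
      have vd: "v d = e * fls_subdegree (emb s d)"
        unfolding d_def place_mult[OF v nz] sub_d[unfolded d_def] vf[OF False] P(2) by (simp add: algebra_simps)
      define r where "r = u + w * P"
      have hd: "(r, 0) = h - d" by (simp add: d_def hyp_mult_fract uw r_def)
      then have "fract_laurent r = emb s h - emb s d" by (metis emb_diff emb_def fst_conv snd_conv fract_laurent_0 mult_zero_left mult_zero_right add.right_neutral)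
      then have sub_r: "fls_subdegree (fract_laurent r) = k" and r0: "fract_laurent r \<noteq> 0"
        using fls_subdegree_diff_eq1[of "emb s h" "emb s d"] kd h emb_eq_0_iff[OF s, of h] unfolding k_def by auto
      then have "r \<noteq> 0" by auto
      then have vr: "v (r, 0) = e * k" using vf sub_r by simp
      have "v (r, 0) < v d" unfolding vr vd using e kd by simp
      then have "v ((r, 0) + d) = v (r, 0)"
        using \<open>r \<noteq> 0\<close> by (intro place_add_eq(2)[OF v]) (auto simp: zero_prod_def)
      then show ?thesis using vr hd by (simp add: k_def)
    qed
  qed
  have "v ` (UNIV - {0}) = UNIV" and ext: "v \<in> extensional (UNIV - {0})"
    using v by (simp_all only: places_iff)
  then have "1 \<in> v ` (UNIV - {0})" by (simp only: UNIV_I)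
  then obtain h where h: "1 = v h" "h \<in> UNIV - {0}" by (rule imageE)
  from h(2) have "h \<noteq> 0" by simp
  then have "e * fls_subdegree (emb s h) = 1" by (rule trans[OF main[symmetric] h(1)[symmetric]])
  then have "e = 1" using e by (simp add: pos_zmult_eq_1_iff)
  show ?thesis
  proof (rule extensionalityI)
    show "v \<in> extensional (UNIV - {0})" by (rule ext)
    show "place_at s \<in> extensional (UNIV - {0})" by (simp add: place_at_def)
    show "v h = place_at s h" if "h \<in> UNIV - {0}" for h using main[of h] that \<open>e = 1\<close> by (simp add: place_at)
  qed
qed

lemma tau_product: "hyp_mult f (tau - hyp_const c) (tau + hyp_const c) = (F / xpow (2 * m), 0) - hyp_const (c * c)"
proof -
  have "hyp_mult f ((0, w) - (C, 0)) ((0, w) + (C, 0)) = (F * (w * w) - C * C, 0)" for w C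
    by (simp add: hyp_mult_def minus_prod_def plus_prod_def)
  from this[of "1 / xpow m" "Fraction_Field.Fract [:c:] 1"] show ?thesis
    unfolding hyp_const_def[of c] by (simp add: hyp_const_def[of "c * c"] minus_prod_def mult_2 xpow_add)
qed

lemma f_leading:
  assumes v: "v \<in> places K hyp_constants" and pole: "v hyp_x < 0"
  shows "(F / xpow (2 * m), 0) - hyp_const 1 \<in> maximal_ideal_of K v"
proof (rule leading_quotient[OF v pole])
  fix k assume k: "k \<le> - int (2 * m)"
  show "fls_nth (fract_laurent F) k = 1 * fls_nth (fract_laurent (xpow (2 * m))) k"
  proof (cases "k = - int (2 * m)")
    case True
    then show ?thesis using monic deg by (simp add: fract_laurent_poly laurent_nth fract_laurent_xpow nat_mult_distrib)
  next
    case False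
    then have "degree f < nat (- k)" using k deg by linarith
    then show ?thesis using False by (simp add: fract_laurent_poly laurent_nth fract_laurent_xpow coeff_eq_0)
  qed
qed

text \<open>The square of \<open>tau\<close> is \<open>f / x ^ (2 * m)\<close>, of value 1 at
  infinity because f is monic.\<close>

lemma leading_constant:
  assumes v: "v \<in> places K hyp_constants" and pole: "v hyp_x < 0" and c: "tau - hyp_const c \<in> maximal_ideal_of K v"
  shows "c * c = 1"
proof -
  have "hyp_const (2 * c) = hyp_const c + hyp_const c" by (simp add: hyp_const_def)
  then have "tau + hyp_const c = (tau - hyp_const c) + hyp_const (2 * c)" by (simp add: algebra_simps)
  moreover have "tau - hyp_const c \<in> valuation_ring_of K v" using c by auto
  ultimately have "tau + hyp_const c \<in> valuation_ring_of K v"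
    using valuation_ring_add[OF v _ valuation_ring_const[OF v]] by metis
  then have "(F / xpow (2 * m), 0) - hyp_const (c * c) \<in> maximal_ideal_of K v"
    using maximal_ideal_mult[OF v _ c] unfolding tau_product[symmetric] by (metis hyp_mult_commute)
  from maximal_ideal_diff[OF v f_leading[OF v pole] this]
  have "hyp_const (c * c) - hyp_const 1 \<in> maximal_ideal_of K v" by (simp only: diff_diff_eq2 diff_add_cancel add_diff_cancel) (simp add: algebra_simps)
  moreover have "hyp_const (c * c) - hyp_const 1 = hyp_const (c * c - 1)" by (simp add: hyp_const_def minus_prod_def)
  ultimately show ?thesis using place_const_in_maximal_ideal[OF v] by force
qed

lemma tau_at:
  assumes s: "s * s = 1" shows "tau - hyp_const s \<in> maximal_ideal_of K (place_at s)"
proof (cases "tau - hyp_const s = 0")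
  case False
  have eq: "emb s (tau - hyp_const s) * fract_laurent (xpow m) = fls_const s * (Y - fract_laurent (xpow m))"
  proof -
    have "fract_laurent (1 / xpow m) * fract_laurent (xpow m) = 1" by (simp flip: fract_laurent_mult)
    then have "fls_const s * (fract_laurent (1 / xpow m) * Y) * fract_laurent (xpow m) = fls_const s * Y"
      by (metis mult.assoc mult.commute mult.right_neutral)
    then show ?thesis
      by (simp add: emb_diff left_diff_distrib right_diff_distrib) (simp add: emb_def hyp_const_def fract_laurent_const)
  qed
  have nz: "emb s (tau - hyp_const s) \<noteq> 0" using False emb_eq_0_iff[OF s] by simp
  have "- int m + 1 \<le> fls_subdegree (emb s (tau - hyp_const s) * fract_laurent (xpow m))"
  proof (rule fls_subdegree_geI)
    show "emb s (tau - hyp_const s) * fract_laurent (xpow m) \<noteq> 0" using nz by simp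
    fix k assume "k < - int m + 1"
    then show "fls_nth (emb s (tau - hyp_const s) * fract_laurent (xpow m)) k = 0"
      unfolding eq using Y(2,3) by (cases "k = - int m") (auto simp: fract_laurent_xpow)
  qed
  moreover have "fls_subdegree (fract_laurent (xpow m)) = - int m"
    by (intro fls_subdegree_eqI) (simp_all add: fract_laurent_xpow)
  ultimately have "0 < fls_subdegree (emb s (tau - hyp_const s))" using nz by simp
  then show ?thesis using False by (simp add: place_at)
qed simp

lemma place_at_x: "place_at s hyp_x = - 1"
proof -
  have "hyp_x \<noteq> 0" by (simp add: hyp_x_def zero_prod_def Zero_fract_def eq_fract)
  then show ?thesis by (simp add: place_at emb_def hyp_x_def fract_laurent_poly laurent_subdegree)
qed

text \<open>The product of \<open>tau - 1\<close> and \<open>tau + 1\<close> vanishes at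
  \<open>v\<close>, hence one of the factors does, and its constant identifies the place.\<close>

lemma places_over_infinity:
  assumes v: "v \<in> places K hyp_constants" and pole: "v hyp_x < 0"
  shows "v = place_at 1 \<or> v = place_at (- 1)"
proof -
  have "hyp_mult f (tau - hyp_const 1) (tau + hyp_const 1) \<in> maximal_ideal_of K v"
    unfolding tau_product using f_leading[OF v pole] by (simp only: mult_1)
  moreover have nz: "tau - hyp_const 1 \<noteq> 0" "tau + hyp_const 1 \<noteq> 0"
    by (simp_all add: hyp_const_def minus_prod_def plus_prod_def zero_prod_def)
  ultimately have "0 < v (tau - hyp_const 1) + v (tau + hyp_const 1)"
    using place_mult[OF v nz] by (simp add: hyp_mult_eq_0_iff)
  then consider "0 < v (tau - hyp_const 1)" | "0 < v (tau + hyp_const 1)" by linarith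
  then show ?thesis
  proof cases
    case 1
    then show ?thesis using place_eq_place_at[OF v pole, of 1] by simp
  next
    case 2
    have "tau + hyp_const 1 = tau - hyp_const (- 1)" by (simp add: hyp_const_def)
    then show ?thesis using 2 place_eq_place_at[OF v pole, of "- 1"] by simp
  qed
qed

lemma hyp_x_power: "hyp_x [^]\<^bsub>K\<^esub> n = (xpow n, 0)"
proof -
  interpret field K by (rule field_K)
  show ?thesis
  proof (induction n)
    case 0
    then show ?case by (simp add: xpow_def One_fract_def)
  next
    case (Suc n)
    have "xpow (Suc n) = xpow n * xpow 1" using xpow_add[of n 1] by simp
    moreover have x: "hyp_x = (xpow 1, 0)" by (simp add: hyp_x_def xpow_def monom_Suc one_pCons)
    have "hyp_x [^]\<^bsub>K\<^esub> Suc n = hyp_mult f (xpow n, 0) (xpow 1, 0)"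
      using Suc unfolding x by simp
    ultimately show ?case by (simp only: hyp_mult_fract mult_zero_right)
  qed
qed

lemma infinity_place_eq:
  assumes s: "s = 1 \<or> s = - 1" and m: "m = g + 1"
  shows "infinity_place f g s = place_at s"
proof -
  interpret K: field K by (rule field_K)
  have ss: "s * s = 1" using s by auto
  have "inv\<^bsub>K\<^esub> (xpow m, 0) = (1 / xpow m, 0)"
    by (rule K.comm_inv_char) (simp_all add: hyp_mult_fract)
  moreover have minus: "x \<ominus>\<^bsub>K\<^esub> y = x - y" for x y
  proof -
    have "\<ominus>\<^bsub>K\<^esub> y = - y" by (rule K.minus_equality) simp_all
    then show ?thesis by (simp add: a_minus_def)
  qed
  ultimately have expr: "hyp_y \<otimes>\<^bsub>K\<^esub> inv\<^bsub>K\<^esub> (hyp_x [^]\<^bsub>K\<^esub> (g + 1)) \<ominus>\<^bsub>K\<^esub> hyp_const c = tau - hyp_const c" for c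
    unfolding hyp_x_power m[symmetric] minus by (simp add: hyp_y_def hyp_mult_def)
  show ?thesis
    unfolding infinity_place_def Let_def expr
  proof (rule the_equality)
    show "place_at s \<in> places K hyp_constants \<and> place_at s hyp_x < 0 \<and>
        (\<exists>c. sgn c = s \<and> tau - hyp_const c \<in> maximal_ideal_of K (place_at s))"
      using place_at_in_places[OF ss] place_at_x tau_at[OF ss] s by (auto intro!: exI[of _ s])
  next
    fix v assume v: "v \<in> places K hyp_constants \<and> v hyp_x < 0 \<and>
        (\<exists>c. sgn c = s \<and> tau - hyp_const c \<in> maximal_ideal_of K v)"
    then obtain c where c: "sgn c = s" "tau - hyp_const c \<in> maximal_ideal_of K v" by blast
    have "c * c = 1" using leading_constant v c(2) by blast
    then have "c = 1 \<or> c = - 1" by (simp add: square_eq_1_iff)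
    then have "c = s" using c(1) by auto
    then show "v = place_at s" using place_eq_place_at[of v s] v ss c(2) by blast
  qed
qed

text \<open>\<open>h = A + B * y\<close> and its conjugate \<open>h'\<close> are inverse to each
  other. At finite places both are integral, hence units; conjugation exchanges the two infinite
  places, so the orders of \<open>h\<close> there are opposite.\<close>

lemma pell_divisor:
  assumes m: "0 < m" and B: "B \<noteq> 0" and pell: "A\<^sup>2 - f * B\<^sup>2 = 1"
  obtains h k where "h \<noteq> 0" "k \<noteq> 0" "place_at 1 h = k" "place_at (- 1) h = - k"
    "\<And>v. v \<in> places K hyp_constants \<Longrightarrow> v \<noteq> place_at 1 \<Longrightarrow> v \<noteq> place_at (- 1) \<Longrightarrow> v h = 0"
proof -
  define h :: hyp_fun where "h = (Fraction_Field.Fract A 1, Fraction_Field.Fract B 1)"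
  define h' :: hyp_fun where "h' = (Fraction_Field.Fract A 1, Fraction_Field.Fract (- B) 1)"
  have "A * A - f * (B * B) = 1" using pell by (simp add: power2_eq_square)
  then have hh: "hyp_mult f h h' = (1, 0)"
    by (simp add: h_def h'_def hyp_mult_def One_fract_def Zero_fract_def eq_fract algebra_simps)
  then have nz: "h \<noteq> 0" "h' \<noteq> 0" using hyp_mult_eq_0_iff[of h h'] by (auto simp: zero_prod_def)
  have one: "(1, 0) = hyp_const 1" by (simp add: hyp_const_def One_fract_def one_pCons)
  have neg: "v h' = - v h" if v: "v \<in> places K hyp_constants" for v
    using place_mult[OF v nz] place_const[OF v, of 1] unfolding hh one by simp
  have conj: "emb (- 1) h = emb 1 h'"
  proof -
    have "fls_const (- 1) = (- 1 :: real fls)" by (intro fls_eqI) simp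
    then show ?thesis by (simp add: emb_def h_def h'_def fract_laurent_uminus flip: minus_fract)
  qed
  have p1: "place_at 1 \<in> places K hyp_constants" by (rule place_at_in_places) simp
  define k where "k = place_at 1 h"
  have "place_at (- 1) h = place_at 1 h'" using nz by (simp add: place_at conj)
  then have km: "place_at (- 1) h = - k" using neg[OF p1] by (simp add: k_def)
  have k0: "k \<noteq> 0"
  proof
    \<comment> \<open>Then \<open>h - h' = 2 * B * y\<close> would be regular at infinity, although
      \<open>B * y\<close> has a pole of order \<open>degree B + m\<close> there.\<close>
    assume "k = 0"
    then have "fls_subdegree (emb 1 h) = 0" "fls_subdegree (emb 1 h') = 0"
      using nz neg[OF p1] by (simp_all add: k_def place_at)
    then have "fls_nth (emb 1 h - emb 1 h') n = 0" if "n < 0" for n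
      using that by simp
    moreover have "emb 1 h - emb 1 h' = fls_const 2 * (laurent B * Y)"
      by (simp add: emb_def h_def h'_def fract_laurent_uminus fract_laurent_poly flip: minus_fract)
    ultimately have "fls_nth (laurent B * Y) n = 0" if "n < 0" for n
      using that by (metis fls_mult_const_nth(1) mult_eq_0_iff zero_neq_numeral)
    moreover have Y0: "Y \<noteq> 0" using Y(3) by auto
    then have "fls_subdegree (laurent B * Y) = - int (degree B) - int m"
      using B by (simp add: laurent_subdegree Y(2))
    moreover have "laurent B * Y \<noteq> 0" using B Y0 by simp
    ultimately show False
      using m nth_fls_subdegree_nonzero[of "laurent B * Y"] by fastforce
  qed
  have regular: "v h = 0" if v: "v \<in> places K hyp_constants" and "v \<noteq> place_at 1" "v \<noteq> place_at (- 1)" for v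
  proof -
    have x: "0 \<le> v hyp_x" using places_over_infinity[OF v] that by force
    have y0: "hyp_y \<noteq> 0" by (simp add: hyp_y_def zero_prod_def)
    have yy: "hyp_mult f hyp_y hyp_y = (F, 0)" by (simp add: hyp_mult_def hyp_y_def)
    have "(F, 0) \<in> valuation_ring_of K v" by (rule place_poly_nonneg[OF v x])
    then have y: "hyp_y \<in> valuation_ring_of K v"
      using place_mult[OF v y0 y0] y0 unfolding yy[symmetric] by (simp add: hyp_mult_eq_0_iff)
    have integral: "(Fraction_Field.Fract A 1, Fraction_Field.Fract C 1) \<in> valuation_ring_of K v" for C :: "real poly"
    proof -
      have "(Fraction_Field.Fract A 1, Fraction_Field.Fract C 1) =
          (Fraction_Field.Fract A 1, 0) + hyp_mult f (Fraction_Field.Fract C 1, 0) hyp_y"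
        by (simp add: hyp_mult_def hyp_y_def)
      moreover have "\<dots> \<in> valuation_ring_of K v"
        by (rule valuation_ring_add[OF v place_poly_nonneg[OF v x] valuation_ring_mult[OF v place_poly_nonneg[OF v x] y]])
      ultimately show ?thesis by metis
    qed
    have "h \<in> valuation_ring_of K v" "h' \<in> valuation_ring_of K v"
      unfolding h_def h'_def by (rule integral)+
    then have "0 \<le> v h" "0 \<le> v h'" using nz by (simp_all only: mem_valuation_ring simp_thms)
    then show ?thesis using neg[OF v] by simp
  qed
  show ?thesis
  proof (rule that[OF nz(1) k0 k_def[symmetric] km])
    show "v h = 0" if "v \<in> places K hyp_constants" "v \<noteq> place_at 1" "v \<noteq> place_at (- 1)" for v
      using that by (rule regular)
  qed
qed

end

section \<open>Torsion in the Jacobian\<close>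

context hyp_curve begin

lemma emb_hyp_const: "emb s (hyp_const c) = fls_const c"
  by (simp add: emb_def hyp_const_def fract_laurent_const)

lemma place_at_residue:
  assumes s: "s * s = 1" and a: "a \<in> valuation_ring_of K (place_at s)"
  shows "a - hyp_const (fls_nth (emb s a) 0) \<in> maximal_ideal_of K (place_at s)"
proof -
  define c where "c = fls_nth (emb s a) 0"
  have "a - hyp_const c = 0 \<or> 0 < place_at s (a - hyp_const c)"
  proof (rule disjCI)
    assume "\<not> 0 < place_at s (a - hyp_const c)"
    show "a - hyp_const c = 0"
    proof (rule ccontr)
      assume nz: "a - hyp_const c \<noteq> 0"
      have "1 \<le> fls_subdegree (emb s (a - hyp_const c))"
      proof (rule fls_subdegree_geI)
        show "emb s (a - hyp_const c) \<noteq> 0" unfolding emb_eq_0_iff[OF s] by (rule nz)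
        fix k :: int assume k: "k < 1"
        have "fls_nth (emb s a) k = 0" if "k < 0"
        proof (cases "a = 0")
          case True
          then show ?thesis by (simp add: emb_def zero_prod_def)
        next
          case False
          then show ?thesis using a that by (simp add: place_at)
        qed
        then show "fls_nth (emb s (a - hyp_const c)) k = 0"
          using k by (cases "k = 0") (auto simp: emb_diff emb_hyp_const c_def)
      qed
      then show False using \<open>\<not> 0 < _\<close> nz by (simp add: place_at)
    qed
  qed
  then show ?thesis unfolding c_def mem_maximal_ideal .
qed

lemma uminus_K: "\<ominus>\<^bsub>K\<^esub> h = - h"
proof -
  interpret field K by (rule field_K)
  show ?thesis by (rule minus_equality) simp_all
qed

text \<open>The constant term of the Laurent expansion represents each residue class by a real
  constant. The constants thus fill the residue field, which has dimension 1 over itself.\<close>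

lemma place_degree_at:
  assumes s: "s * s = 1" shows "place_degree K hyp_constants (place_at s) = 1"
proof -
  let ?v = "place_at s"
  let ?O = "valuation_ring_of K ?v" and ?M = "maximal_ideal_of K ?v"
  let ?R = "K\<lparr>carrier := ?O\<rparr>"
  note v = place_at_in_places[OF s]
  have one: "(1, 0) = hyp_const 1" by (simp add: hyp_const_def One_fract_def one_pCons)
  interpret K: field K by (rule field_K)
  have "subring ?O K"
  proof (rule K.subringI)
    show "\<one>\<^bsub>K\<^esub> \<in> ?O" unfolding hyp_field_simps one by (rule valuation_ring_const[OF v])
    show "\<ominus>\<^bsub>K\<^esub> h \<in> ?O" if "h \<in> ?O" for h
      using that place_uminus[OF v, of h] by (simp add: uminus_K)
    show "h \<otimes>\<^bsub>K\<^esub> h' \<in> ?O" if "h \<in> ?O" "h' \<in> ?O" for h h'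
      unfolding hyp_field_simps by (rule valuation_ring_mult[OF v that])
    show "h \<oplus>\<^bsub>K\<^esub> h' \<in> ?O" if "h \<in> ?O" "h' \<in> ?O" for h h'
      unfolding hyp_field_simps by (rule valuation_ring_add[OF v that])
  qed simp
  then have cring: "cring ?R" using K.subcringI' K.subcring_iff by simp
  interpret R: cring ?R by (rule cring)
  have M_sub: "h \<in> ?M \<Longrightarrow> h \<in> ?O" for h by auto
  have uminus_R: "\<ominus>\<^bsub>?R\<^esub> h = - h" if "h \<in> ?O" for h
    using that place_uminus[OF v, of h] by (intro R.minus_equality) auto
  have ideal: "ideal ?M ?R"
  proof (rule idealI[OF R.ring_axioms])
    show "subgroup ?M (add_monoid ?R)"
    proof (rule group.subgroupI[OF R.add.is_group])
      show "?M \<subseteq> carrier (add_monoid ?R)" using M_sub by auto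
      show "?M \<noteq> {}" using mem_maximal_ideal[of 0] by blast
      show "inv\<^bsub>add_monoid ?R\<^esub> h \<in> ?M" if "h \<in> ?M" for h
        using uminus_R[OF M_sub[OF that]] that place_uminus[OF v, of h] by (simp add: a_inv_def)
      show "h \<otimes>\<^bsub>add_monoid ?R\<^esub> h' \<in> ?M" if "h \<in> ?M" "h' \<in> ?M" for h h'
        using maximal_ideal_add[OF v that] by simp
    qed
    show "x \<otimes>\<^bsub>?R\<^esub> a \<in> ?M" "a \<otimes>\<^bsub>?R\<^esub> x \<in> ?M" if "a \<in> ?M" "x \<in> carrier ?R" for a x
      using maximal_ideal_mult[OF v, of x a] that hyp_mult_commute[of f a x] by simp_all
  qed
  have "maximalideal ?M ?R"
  proof (rule maximalidealI[OF ideal])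
    have "hyp_const 1 \<in> carrier ?R" using valuation_ring_const[OF v, of 1] by (simp del: mem_valuation_ring)
    moreover have "hyp_const 1 \<notin> ?M" using place_const_in_maximal_ideal[OF v, of 1] by force
    ultimately show "carrier ?R \<noteq> ?M" by metis
  next
    fix J assume J: "ideal J ?R" "?M \<subseteq> J" "J \<subseteq> carrier ?R"
    show "J = ?M \<or> J = carrier ?R"
    proof (cases "J \<subseteq> ?M")
      case False
      then obtain h where h: "h \<in> J" "h \<notin> ?M" by blast
      then have "h \<noteq> 0" "?v h = 0" using J(3) by auto
      then have "hyp_inv h \<in> ?O" using place_inv[OF v] by simp
      then have "h \<otimes>\<^bsub>?R\<^esub> hyp_inv h \<in> J" using ideal.I_r_closed[OF J(1) h(1)] by simp
      then have "\<one>\<^bsub>?R\<^esub> \<in> J" using hyp_inv[OF \<open>h \<noteq> 0\<close>] by simp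
      then show ?thesis using ideal.one_imp_carrier[OF J(1)] by simp
    qed (use J in blast)
  qed
  then have fieldQ: "field (residue_field K ?v)"
    unfolding residue_field_def by (rule maximalideal.quotient_is_field[OF _ cring])
  have coset: "?M +>\<^bsub>?R\<^esub> a = ?M +>\<^bsub>K\<^esub> a" for a
    by (simp add: a_r_coset_def')
  have coset_eq: "?M +>\<^bsub>K\<^esub> a = ?M +>\<^bsub>K\<^esub> b" if "a - b \<in> ?M" for a b
  proof -
    have sub: "?M +>\<^bsub>K\<^esub> a \<subseteq> ?M +>\<^bsub>K\<^esub> b" if "a - b \<in> ?M" for a b
    proof
      fix x assume "x \<in> ?M +>\<^bsub>K\<^esub> a"
      then obtain h where h: "h \<in> ?M" "x = h + a" by (auto simp: a_r_coset_def' simp del: mem_maximal_ideal)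
      have x: "x = (h + (a - b)) + b" by (simp add: h)
      show "x \<in> ?M +>\<^bsub>K\<^esub> b"
        unfolding a_r_coset_def' hyp_field_simps
        by (rule UN_I[OF maximal_ideal_add[OF v h(1) that]]) (simp only: x singleton_iff)
    qed
    have "b - a \<in> ?M" using that place_uminus[OF v, of "a - b"] by auto
    then show ?thesis using sub[OF that] sub[of b a] by blast
  qed
  have "(\<lambda>c. ?M +>\<^bsub>K\<^esub> c) ` hyp_constants = carrier (residue_field K ?v)"
  proof -
    have car: "carrier (residue_field K ?v) = (\<lambda>a. ?M +>\<^bsub>K\<^esub> a) ` ?O"
      unfolding residue_field_def FactRing_def A_RCOSETS_def' coset by auto
    show ?thesis unfolding car
    proof
      show "(\<lambda>c. ?M +>\<^bsub>K\<^esub> c) ` hyp_constants \<subseteq> (\<lambda>a. ?M +>\<^bsub>K\<^esub> a) ` ?O"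
        using valuation_ring_const[OF v] by blast
      show "(\<lambda>a. ?M +>\<^bsub>K\<^esub> a) ` ?O \<subseteq> (\<lambda>c. ?M +>\<^bsub>K\<^esub> c) ` hyp_constants"
        using coset_eq[OF place_at_residue[OF s]] by blast
    qed
  qed
  moreover interpret Q: field "residue_field K ?v" by (rule fieldQ)
  have "ring.dim (residue_field K ?v) (carrier (residue_field K ?v)) (carrier (residue_field K ?v)) = 1"
    using Q.dimI[OF Q.carrier_is_subfield Q.dimension_one[OF Q.carrier_is_subfield]] by (simp add: over_def)
  ultimately show ?thesis unfolding place_degree_def by simp
qed

section \<open>Divisor classes and their multiples\<close>

lemma subgroup_principal_divisors: "subgroup (principal_divisors K hyp_constants) (divisor_group K hyp_constants)"
proof (rule group.subgroupI)
  let ?P = "principal_divisors K hyp_constants" and ?G = "divisor_group K hyp_constants"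
  show G: "group ?G" by (simp add: divisor_group_def)
  show "?P \<subseteq> carrier ?G" by (auto simp: principal_divisors_def)
  have iff: "D \<in> ?P \<longleftrightarrow> D \<in> carrier ?G \<and> (\<exists>h. h \<noteq> 0 \<and> (\<forall>v\<in>places K hyp_constants. Poly_Mapping.lookup D v = v h))" for D
    by (simp only: principal_divisors_def hyp_field_simps mem_Collect_eq Bex_def Diff_iff UNIV_I singleton_iff simp_thms)
  have "0 \<in> ?P"
    unfolding iff
  proof (intro conjI exI[of _ "hyp_const 1"] ballI)
    show "Poly_Mapping.lookup 0 v = v (hyp_const 1)" if "v \<in> places K hyp_constants" for v
      using place_const[OF that, of 1] by simp
  qed (simp_all add: divisor_group_def hyp_const_0_iff)
  then show "?P \<noteq> {}" by blast
  show "inv\<^bsub>?G\<^esub> D \<in> ?P" if DP: "D \<in> ?P" for D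
  proof -
    obtain h where D: "D \<in> carrier ?G" and h: "h \<noteq> 0" "\<And>v. v \<in> places K hyp_constants \<Longrightarrow> Poly_Mapping.lookup D v = v h"
      using iff[THEN iffD1, OF DP] by metis
    have eq: "inv\<^bsub>?G\<^esub> D = - D" using D by (simp add: divisor_group_def)
    show ?thesis
      unfolding iff
    proof (intro conjI exI[of _ "hyp_inv h"] ballI)
      show "inv\<^bsub>?G\<^esub> D \<in> carrier ?G" using G D by (rule group.inv_closed)
      show "hyp_inv h \<noteq> 0"
      proof
        assume "hyp_inv h = 0"
        then have "hyp_mult f h (hyp_inv h) = 0" by (simp only: hyp_mult_eq_0_iff simp_thms)
        then show False using hyp_inv[OF h(1)] by (simp add: zero_prod_def)
      qed
      show "Poly_Mapping.lookup (inv\<^bsub>?G\<^esub> D) v = v (hyp_inv h)" if "v \<in> places K hyp_constants" for v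
        unfolding eq place_inv[OF that h(1)] h(2)[OF that, symmetric] by (rule lookup_uminus)
    qed
  qed
  show "D \<otimes>\<^bsub>?G\<^esub> D' \<in> ?P" if DP: "D \<in> ?P" and DP': "D' \<in> ?P" for D D'
  proof -
    obtain h where D: "D \<in> carrier ?G" and h: "h \<noteq> 0" "\<And>v. v \<in> places K hyp_constants \<Longrightarrow> Poly_Mapping.lookup D v = v h"
      using iff[THEN iffD1, OF DP] by metis
    obtain h' where D': "D' \<in> carrier ?G" and h': "h' \<noteq> 0" "\<And>v. v \<in> places K hyp_constants \<Longrightarrow> Poly_Mapping.lookup D' v = v h'"
      using iff[THEN iffD1, OF DP'] by metis
    have "D \<otimes>\<^bsub>?G\<^esub> D' \<in> carrier ?G" using G D D' by (simp add: group.is_monoid monoid.m_closed)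
    moreover have eq: "D \<otimes>\<^bsub>?G\<^esub> D' = D + D'" by (simp add: divisor_group_def)
    moreover have "Poly_Mapping.lookup (D + D') v = v (hyp_mult f h h')" if "v \<in> places K hyp_constants" for v
      unfolding place_mult[OF that h(1) h'(1)] h(2)[OF that, symmetric] h'(2)[OF that, symmetric] by (rule lookup_add)
    moreover have "hyp_mult f h h' \<noteq> 0" using h(1) h'(1) by (simp only: hyp_mult_eq_0_iff simp_thms)
    ultimately show ?thesis
      unfolding iff by metis
  qed
qed

lemma divisor_class_power:
  assumes D: "D \<in> carrier (divisor_group K hyp_constants)"
  shows "divisor_class K hyp_constants D [^]\<^bsub>jacobian K hyp_constants\<^esub> n =
    divisor_class K hyp_constants (frag_cmul (int n) D)"
proof -
  let ?P = "principal_divisors K hyp_constants" and ?G = "divisor_group K hyp_constants"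
  have "comm_group ?G" unfolding divisor_group_def by (rule abelian_free_Abelian_group)
  then have normal: "?P \<lhd> ?G" using subgroup_principal_divisors by (rule comm_group.subgroup_imp_normal)
  have G: "group ?G" by (simp add: divisor_group_def)
  show ?thesis
  proof (induction n)
    case 0
    have "?P #>\<^bsub>?G\<^esub> \<one>\<^bsub>?G\<^esub> = ?P"
      by (rule subgroup.rcos_const[OF subgroup_principal_divisors G
            subgroup.one_closed[OF subgroup_principal_divisors]])
    then show ?case by (simp add: nat_pow_def jacobian_def picard_group_def FactGroup_def divisor_class_def divisor_group_def)
  next
    case (Suc n)
    have nD: "frag_cmul (int n) D \<in> carrier ?G"
      using D keys_cmul[of "int n" D] by (auto simp: divisor_group_def)
    have "divisor_class K hyp_constants D [^]\<^bsub>jacobian K hyp_constants\<^esub> Suc n =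
        (?P #>\<^bsub>?G\<^esub> frag_cmul (int n) D) <#>\<^bsub>?G\<^esub> (?P #>\<^bsub>?G\<^esub> D)"
      using Suc by (simp add: nat_pow_def jacobian_def picard_group_def FactGroup_def divisor_class_def)
    also have "\<dots> = ?P #>\<^bsub>?G\<^esub> (frag_cmul (int n) D \<otimes>\<^bsub>?G\<^esub> D)"
      by (rule normal.rcos_sum[OF normal nD D])
    also have "frag_cmul (int n) D \<otimes>\<^bsub>?G\<^esub> D = frag_cmul (int (Suc n)) D"
      using frag_cmul_distrib[of "int n" 1 D] by (simp add: divisor_group_def add.commute)
    finally show ?case by (simp add: divisor_class_def)
  qed
qed

lemma torsion_from_pell:
  assumes m: "0 < m" and B: "B \<noteq> 0" and pell: "A\<^sup>2 - f * B\<^sup>2 = 1"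
  shows "torsion_element (jacobian K hyp_constants)
    (divisor_class K hyp_constants (frag_of (place_at 1) - frag_of (place_at (- 1))))"
proof -
  let ?P = "principal_divisors K hyp_constants" and ?G = "divisor_group K hyp_constants"
  obtain h k where h: "h \<noteq> 0" "k \<noteq> 0" "place_at 1 h = k" "place_at (- 1) h = - k"
    "\<And>v. v \<in> places K hyp_constants \<Longrightarrow> v \<noteq> place_at 1 \<Longrightarrow> v \<noteq> place_at (- 1) \<Longrightarrow> v h = 0"
    by (rule pell_divisor[OF assms]) blast
  define D where "D = frag_of (place_at 1) - frag_of (place_at (- 1))"
  have ne: "place_at 1 \<noteq> place_at (- 1)"
  proof
    assume "place_at 1 = place_at (- 1)"
    then have "place_at 1 h = place_at (- 1) h" by (rule fun_cong)
    then show False using h(2-4) by linarith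
  qed
  have pl: "place_at 1 \<in> places K hyp_constants" "place_at (- 1) \<in> places K hyp_constants"
    by (simp_all add: place_at_in_places)
  have lookup: "Poly_Mapping.lookup D v = (if v = place_at 1 then 1 else if v = place_at (- 1) then - 1 else 0)" for v
    using ne by (auto simp: D_def lookup_minus)
  have keys: "Poly_Mapping.keys D = {place_at 1, place_at (- 1)}"
    using ne by (auto simp: in_keys_iff lookup split: if_splits)
  have D: "D \<in> carrier ?G" using pl by (simp add: divisor_group_def keys)
  have "divisor_degree K hyp_constants D = 0"
    unfolding divisor_degree_def keys using ne by (simp add: lookup place_degree_at)
  then have mem: "divisor_class K hyp_constants D \<in> carrier (jacobian K hyp_constants)"
    using D by (auto simp: jacobian_def)
  have kD: "frag_cmul k D \<in> ?P"
  proof -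
    have "frag_cmul k D \<in> carrier ?G" using D keys_cmul[of k D] by (auto simp: divisor_group_def)
    moreover have "Poly_Mapping.lookup (frag_cmul k D) v = v h" if "v \<in> places K hyp_constants" for v
      using h(3,4) h(5)[OF that] by (auto simp: lookup)
    ultimately show ?thesis unfolding principal_divisors_def using h(1) by auto
  qed
  have G: "group ?G" by (simp add: divisor_group_def)
  \<comment> \<open>A positive exponent is required, whereas \<open>k\<close> may be negative; in
    that case the inverse divisor is used.\<close>
  have nD: "frag_cmul (int (nat \<bar>k\<bar>)) D \<in> ?P"
  proof (cases "0 < k")
    case False
    have "inv\<^bsub>?G\<^esub> frag_cmul k D \<in> ?P" by (rule subgroup.m_inv_closed[OF subgroup_principal_divisors kD])
    moreover have "frag_cmul k D \<in> carrier ?G" using kD by (simp add: principal_divisors_def)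
    then have "inv\<^bsub>?G\<^esub> frag_cmul k D = frag_cmul (- k) D" by (simp add: divisor_group_def)
    ultimately show ?thesis using False by simp
  qed (use kD in simp)
  have "divisor_class K hyp_constants D [^]\<^bsub>jacobian K hyp_constants\<^esub> nat \<bar>k\<bar> =
      divisor_class K hyp_constants (frag_cmul (int (nat \<bar>k\<bar>)) D)"
    by (rule divisor_class_power[OF D])
  also have "\<dots> = ?P"
    unfolding divisor_class_def by (rule subgroup.rcos_const[OF subgroup_principal_divisors G nD])
  also have "?P = \<one>\<^bsub>jacobian K hyp_constants\<^esub>"
    by (simp add: jacobian_def picard_group_def FactGroup_def)
  finally have pow: "divisor_class K hyp_constants D [^]\<^bsub>jacobian K hyp_constants\<^esub> nat \<bar>k\<bar> =
      \<one>\<^bsub>jacobian K hyp_constants\<^esub>" .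
  show ?thesis
    unfolding torsion_element_def D_def[symmetric]
    by (intro conjI exI[of _ "nat \<bar>k\<bar>"] mem pow) (use h(2) in simp)
qed

end

text \<open>The coordinate \<open>a i\<close> becomes the end of index \<open>i + 1\<close>, between
  the fixed ends -1 and 1. The movable left ends are thus the coordinates of odd index.\<close>

definition ends_of :: "nat \<Rightarrow> (nat \<Rightarrow> real) \<Rightarrow> nat \<Rightarrow> real" where
  "ends_of g a i = (if i = 0 then - 1 else if i \<le> 2 * g then a (i - 1) else 1)"

lemma end_poly_ends_of: "end_poly g (ends_of g a) = hyp_poly g a"
proof -
  let ?F = "\<lambda>i. [:- ends_of g a i, 1:]"
  have F: "?F 0 = [:1, 1:]" "?F (Suc (2 * g)) = [:- 1, 1:]" by (simp_all add: ends_of_def)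
  have "2 * g + 2 = Suc (Suc (2 * g))" by simp
  then have "end_poly g (ends_of g a) = ?F 0 * ((\<Prod>i<2 * g. ?F (Suc i)) * ?F (Suc (2 * g)))"
    by (simp only: end_poly_def prod.lessThan_Suc_shift[of _ "Suc (2 * g)"] prod.lessThan_Suc[of _ "2 * g"])
  also have "(\<Prod>i<2 * g. ?F (Suc i)) = (\<Prod>i<2 * g. [:- a i, 1:])"
    by (rule prod.cong) (auto simp: ends_of_def)
  finally have "end_poly g (ends_of g a) = [:1, 1:] * ((\<Prod>i<2 * g. [:- a i, 1:]) * [:- 1, 1:])"
    by (simp only: F)
  also have "\<dots> = ([:1, 1:] * [:- 1, 1:]) * (\<Prod>i<2 * g. [:- a i, 1:])" by (simp only: mult_ac)
  also have "[:1, 1:] * [:- 1, 1:] = ([:0, 1:]\<^sup>2 - 1 :: real poly)" by (simp add: power2_eq_square one_pCons)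
  also have "(\<Prod>i<2 * g. [:- a i, 1:]) = (\<Prod>i<2 * g. [:0, 1:] - [:a i:])" by simp
  finally show ?thesis by (simp only: hyp_poly_def)
qed

lemma ends_of_end_tuples: "a \<in> ordered_tuples g \<Longrightarrow> ends_of g a \<in> end_tuples g"
  unfolding end_tuples_def ordered_tuples_def ends_of_def by (auto simp: strict_mono_on_def)

lemma hyp_curve_end_poly:
  assumes e: "e \<in> end_tuples g" shows "hyp_curve (end_poly g e) (g + 1)"
proof
  show "lead_coeff (end_poly g e) = 1" unfolding end_poly_def lead_coeff_prod by simp
  show "degree (end_poly g e) = 2 * (g + 1)"
    unfolding end_poly_def by (subst degree_prod_eq_sum_degree) auto
  have "end_poly g e = [:- e 0, 1:] * (\<Prod>i\<in>{..<2 * g + 2} - {0}. [:- e i, 1:])"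
    unfolding end_poly_def by (rule prod.remove) auto
  moreover have nz: "poly (\<Prod>i\<in>{..<2 * g + 2} - {0}. [:- e i, 1:]) (e 0) \<noteq> 0"
    using end_tuples_less[OF e, of 0] unfolding poly_prod by (subst prod_zero_iff) force+
  then have "(\<Prod>i\<in>{..<2 * g + 2} - {0}. [:- e i, 1:]) \<noteq> 0" by auto
  ultimately have "Polynomial.order (e 0) (end_poly g e) = 1"
    using order_0I[OF nz] order_power_n_n[of "e 0" 1] order_mult[of "[:- e 0, 1:]"]
    by (simp del: mult_pCons_left)
  then show "\<exists>a. odd (Polynomial.order a (end_poly g e))" by (intro exI[of _ "e 0"]) simp
qed

lemma torsion_type_from_band_measures:
  assumes e: "ends_of g a \<in> end_tuples g"
    and rat: "\<And>j. j \<le> g \<Longrightarrow> band_measure g (ends_of g a) j \<in> \<rat>"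
  shows "torsion_type g a"
proof -
  interpret hyp_curve "hyp_poly g a" "g + 1"
    using hyp_curve_end_poly[OF e] unfolding end_poly_ends_of .
  have "\<exists>A B. B \<noteq> 0 \<and> A\<^sup>2 - end_poly g (ends_of g a) * B\<^sup>2 = 1"
    by (rule pell_solution[OF e rat]) blast+
  then obtain A B where "B \<noteq> 0" "A\<^sup>2 - hyp_poly g a * B\<^sup>2 = 1"
    unfolding end_poly_ends_of by blast
  then show ?thesis
    unfolding torsion_type_def Let_def
    using torsion_from_pell[of B A] infinity_place_eq[of 1 g] infinity_place_eq[of "- 1" g] by simp
qed

theorem theorem3p1:
  fixes g :: nat
  assumes "g > 0"
  shows "subtopology (Euclidean_space (2 * g)) (ordered_tuples g) closure_of
           {a \<in> ordered_tuples g. torsion_type g a} = ordered_tuples g"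
proof
  let ?S = "ordered_tuples g" and ?T = "{a \<in> ordered_tuples g. torsion_type g a}"
  have top: "topspace (subtopology (Euclidean_space (2 * g)) ?S) = ?S"
    by (auto simp: ordered_tuples_def)
  show "subtopology (Euclidean_space (2 * g)) ?S closure_of ?T \<subseteq> ?S"
    using closure_of_subset_topspace top by metis
  show "?S \<subseteq> subtopology (Euclidean_space (2 * g)) ?S closure_of ?T"
  proof
    fix a assume a: "a \<in> ?S"
    have "\<exists>b. b \<in> ?T \<and> b \<in> U"
      if aU: "a \<in> U" and opU: "openin (subtopology (Euclidean_space (2 * g)) ?S) U" for U
    proof -
      obtain V where V: "openin (powertop_real UNIV) V" "U = V \<inter> {x. \<forall>i\<ge>2 * g. x i = 0} \<inter> ?S"
        using opU unfolding Euclidean_space_def subtopology_subtopology openin_subtopology by blast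
      then obtain X where X: "a \<in> (\<Pi>\<^sub>E i\<in>UNIV. X i)" "\<And>i. open (X i)" "(\<Pi>\<^sub>E i\<in>UNIV. X i) \<subseteq> V"
        using product_topology_open_contains_basis[OF V(1), of a] aU by auto
      have "\<forall>i. \<exists>\<epsilon>>0. \<forall>x. \<bar>x - a i\<bar> < \<epsilon> \<longrightarrow> x \<in> X i"
      proof
        fix i
        have "a i \<in> X i" using X(1) by auto
        then show "\<exists>\<epsilon>>0. \<forall>x. \<bar>x - a i\<bar> < \<epsilon> \<longrightarrow> x \<in> X i"
          using X(2)[of i] unfolding open_dist dist_real_def by blast
      qed
      then obtain \<epsilon> where \<epsilon>: "\<And>i. 0 < \<epsilon> i" "\<And>i x. \<bar>x - a i\<bar> < \<epsilon> i \<Longrightarrow> x \<in> X i" by metis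
      \<comment> \<open>Only the first \<open>2 * g\<close> coordinates can move, so finitely many
        radii matter; halving turns the non-strict bound on the displacement into a strict
        one.\<close>
      define \<delta> where "\<delta> = Min (\<epsilon> ` {..<2 * g}) / 2"
      have \<delta>: "0 < \<delta>" "\<And>i. i < 2 * g \<Longrightarrow> \<delta> < \<epsilon> i"
      proof -
        have "0 \<in> {..<2 * g}" using assms by simp
        then have ne: "\<epsilon> ` {..<2 * g} \<noteq> {}" by blast
        have pos: "0 < Min (\<epsilon> ` {..<2 * g})" using \<epsilon>(1) by (subst Min_gr_iff[OF _ ne]) auto
        then show "0 < \<delta>" by (simp add: \<delta>_def)
        show "\<delta> < \<epsilon> i" if "i < 2 * g" for i
        proof -
          have "Min (\<epsilon> ` {..<2 * g}) \<le> \<epsilon> i" by (rule Min_le) (use that in auto)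
          then show ?thesis unfolding \<delta>_def using pos by linarith
        qed
      qed
      define e where "e = ends_of g a"
      have e: "e \<in> end_tuples g" unfolding e_def by (rule ends_of_end_tuples[OF a])
      obtain e' where e': "e' \<in> end_tuples g" "\<And>k. \<bar>e' k - e k\<bar> \<le> \<delta>"
        "\<And>k. k \<notin> (*) 2 ` {1..g} \<Longrightarrow> e' k = e k" "\<And>j. j \<le> g \<Longrightarrow> band_measure g e' j \<in> \<rat>"
        by (rule rational_band_measures_dense[OF assms e \<delta>(1)]) blast
      define b where "b i = (if i < 2 * g then e' (Suc i) else 0)" for i
      have fixed: "e' k = e k" if "k = 0 \<or> 2 * g < k" for k using that by (intro e'(3)) auto
      have be: "ends_of g b = e'"
      proof
        fix k
        show "ends_of g b k = e' k"
          using fixed[of k] by (cases "k = 0 \<or> 2 * g < k") (auto simp: ends_of_def b_def e_def)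
      qed
      have bS: "b \<in> ?S"
      proof -
        have "- 1 < b i" "b i < 1" if "i < 2 * g" for i
          using that end_tuples_less[OF e'(1), of 0 "Suc i"] end_tuples_less[OF e'(1), of "Suc i" "2 * g + 1"]
            fixed[of 0] fixed[of "2 * g + 1"] by (auto simp: b_def e_def ends_of_def)
        moreover have "b i < b j" if "i < j" "j < 2 * g" for i j
          using that end_tuples_less[OF e'(1), of "Suc i" "Suc j"] by (simp add: b_def)
        ultimately show ?thesis
          by (auto simp: ordered_tuples_def topspace_Euclidean_space strict_mono_on_def b_def)
      qed
      have "torsion_type g b"
        by (rule torsion_type_from_band_measures) (use be e' in simp_all)
      moreover have "b \<in> V"
      proof (rule subsetD[OF X(3)], rule PiE_I)
        fix i
        show "b i \<in> X i"
        proof (cases "i < 2 * g")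
          case True
          have "\<bar>b i - a i\<bar> \<le> \<delta>" using e'(2)[of "Suc i"] True by (simp add: b_def e_def ends_of_def)
          then show ?thesis using \<delta>(2)[OF True] by (intro \<epsilon>(2)) simp
        next
          case False
          then have "b i = a i" using a by (simp add: b_def ordered_tuples_def topspace_Euclidean_space)
          then show ?thesis using X(1) by auto
        qed
      qed simp
      ultimately show ?thesis using bS V(2) by (auto simp: b_def)
    qed
    then show "a \<in> subtopology (Euclidean_space (2 * g)) ?S closure_of ?T"
      using a unfolding in_closure_of top by blast
  qed
qed

end
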